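(* Suppose that the local channel $\mathfrak L$ of a homogeneous open quantum random walk with finite-dimensional local space $\mathfrak h$ is recurrent, i.e. $\mathcal R=\mathfrak h$. Let $\hat{\mathbb P}_{\rho,n}$ be the law of $\frac{X_n-X_0}{n}$ under $\mathbb P_\rho$. Then $(\hat{\mathbb P}_{\rho,n})_{n\ge1}$ satisfies a large deviation principle (with speed $n$) with good rate function $$\Lambda_\rho(x)=\min_{\alpha\,:\,a_\alpha(\rho)\neq0}\Lambda_\alpha(x),\qquad x\in\mathbb R^d,$$ where $a_\alpha(\rho)=\sum_{\underline k\in V}\mathrm{Tr}(A(\chi_\alpha)\rho(\underline k))$ and $\Lambda_\alpha$ is the Fenchel–Legendre transform of the logarithm of the spectral radius $\lambda_{\alpha,u}$ of the deformed restriction $\mathfrak L_{|\chi_\alpha,u}$: $$\lambda_{\alpha,u}=r(\mathfrak L_{|\chi_\alpha,u}),\qquad \Lambda_\alpha(x)=\sup_{u\in\mathbb R^d}\{\langle u,x\rangle-\log(\lambda_{\alpha,u})\},\quad x\in\mathbb R^d.$$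
   Context: **Walk.** $V\subset\mathbb R^d$ is a locally finite lattice containing $0$, positively generated by a finite set $S=\{s_1,\dots,s_v\}\neq\{0\}$. $\mathfrak h$ is a finite-dimensional complex Hilbert space, $B(\mathfrak h)$ its bounded operators, $L^1(\mathfrak h)$ its trace-class operators. $L_1,\dots,L_v\in B(\mathfrak h)$ satisfy $\sum_i L_i^*L_i=1_{\mathfrak h}$. The local channel is $\mathfrak L(\sigma)=\sum_{i=1}^v L_i\sigma L_i^*$ on $L^1(\mathfrak h)$, with dual $\mathfrak L^*(x)=\sum_i L_i^*xL_i$ on $B(\mathfrak h)$. The initial state is $\rho=\sum_{\underline k\in V}\rho(\underline k)\otimes|\underline k\rangle\langle\underline k|$ with $\rho(\underline k)\ge 0$ in $L^1(\mathfrak h)$ and $\sum_{\underline k}\mathrm{Tr}\,\rho(\underline k)=1$. **Position process.** Let $J=\{1,\dots,v\}$, $\Omega=V\times J^{\mathbb N}$ with the $\sigma$-algebra $\mathcal F$ generated by cylinder sets. $\mathbb P_\rho$ is the unique probability on $(\Omega,\mathcal F)$ with $\mathbb P_\rho(\{\underline k\}\times J^{\mathbb N})=\mathrm{Tr}\,\rho(\underline k)$ and $\mathbb P_\rho(\{(\underline k,j_1,\dots,j_n)\}\times J^{\mathbb N})=\mathrm{Tr}(L_{j_n}\cdots L_{j_1}\rho(\underline k)L_{j_1}^*\cdots L_{j_n}^* )$. For $\omega=(\underline k,j_1,j_2,\dots)$: $X_0=\underline k$, $X_{n+1}=X_n+s_{j_{n+1}}$. **Enclosures.** A subspace $\mathcal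 V\subset\mathfrak h$ is an enclosure for $\mathfrak L$ if for every positive $\omega\in L^1(\mathfrak h)$, $\mathrm{supp}(\omega)\subset\mathcal V$ implies $\mathrm{supp}(\mathfrak L(\omega))\subset\mathcal V$ (support of a positive operator $=\ker^\perp$). A minimal enclosure is a nonzero enclosure containing no enclosures other than $\{0\}$ and itself. With $p_{\mathcal V}$ the orthogonal projection onto $\mathcal V$, the absorption operator is $A(\mathcal V)=\lim_{n\to\infty}\mathfrak L^{*n}(p_{\mathcal V})$. **Decomposition.** The fast recurrent space $\mathcal R$ is the supremum (span) of the supports of all invariant states of $\mathfrak L$. There is a unique decomposition $\mathcal R=\bigoplus_{\alpha\in A}\chi_\alpha$ into finitely many mutually orthogonal nonzero enclosures, each minimal among nonzero enclosures $\chi$ with the property: every minimal enclosure $\mathcal W$ satisfies $\mathcal W\perp\chi$ or $\mathcal W\subset\chi$. **Deformation.** For $u\in\mathbb R^d$, $\mathfrak L_{|\chi_\alpha,u}(\sigma)=\sum_{i=1}^v e^{u\cdot s_i}L_i\sigma L_i^*$ acting on $L^1(\chi_\alpha)\simeq p_{\chi_\alpha}L^1(\mathfrak h)p_{\chi_\alpha}$; $r(\cdot)$ denotes spectral radius. **Large deviation principle.** It means that for every Borel $B\subset\mathbb R^d$, $-\inf_{x\in\mathring B}\Lambda_\rho(x)\le\liminf_n\frac1n\log\hat{\mathbb P}_{\rho,n}(B)\le\limsup_n\frac1n\log\hat{\mathbb P}_{\rho,n}(B)\le-\inf_{x\in\overline B}\Lambda_\rho(x)$; the rate function is good if its sublevel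 sets are compact. *)

theory Defs
  imports "HOL-Probability.Probability"
begin

section \<open>Finite-dimensional Hilbert space\<close>

text \<open>The local space is the Hilbert space of complex column vectors indexed by a finite type, and
  both its bounded and its trace-class operators are the square complex matrices. The library's inner
  product on this type is the real one, hence the Hermitian product below (antilinear on the left).\<close>

type_synonym 'n hvec = "complex ^ 'n"
type_synonym 'n hop = "complex ^ 'n ^ 'n"

definition cinner :: "'n::finite hvec \<Rightarrow> 'n hvec \<Rightarrow> complex" where
  "cinner x y = (\<Sum>i\<in>UNIV. cnj (x $ i) * y $ i)"

definition cadj :: "'n::finite hop \<Rightarrow> 'n hop" where
  "cadj M = (\<chi> i j. cnj (M $ j $ i))"

definition positive_op :: "'n::finite hop \<Rightarrow> bool" where
  "positive_op M \<longleftrightarrow> (\<forall>x. cinner x (M *v x) \<in> \<real> \<and> 0 \<le> Re (cinner x (M *v x)))"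

definition corthogonal :: "'n::finite hvec set \<Rightarrow> 'n hvec set \<Rightarrow> bool" where
  "corthogonal U W \<longleftrightarrow> (\<forall>x\<in>U. \<forall>y\<in>W. cinner x y = 0)"

definition supp :: "'n::finite hop \<Rightarrow> 'n hvec set" where
  "supp M = {x. \<forall>y. M *v y = 0 \<longrightarrow> cinner y x = 0}"

definition oproj :: "'n::finite hvec set \<Rightarrow> 'n hop" where
  "oproj U = (THE Q. Q ** Q = Q \<and> cadj Q = Q \<and> range (\<lambda>x. Q *v x) = U)"


section \<open>Local channel, enclosures and recurrence\<close>

definition channel :: "('j::finite \<Rightarrow> 'n::finite hop) \<Rightarrow> 'n hop \<Rightarrow> 'n hop" where
  "channel L \<sigma> = (\<Sum>i\<in>UNIV. L i ** \<sigma> ** cadj (L i))"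

definition dual_channel :: "('j::finite \<Rightarrow> 'n::finite hop) \<Rightarrow> 'n hop \<Rightarrow> 'n hop" where
  "dual_channel L x = (\<Sum>i\<in>UNIV. cadj (L i) ** x ** L i)"

definition enclosure :: "('j::finite \<Rightarrow> 'n::finite hop) \<Rightarrow> 'n hvec set \<Rightarrow> bool" where
  "enclosure L U \<longleftrightarrow> vec.subspace U \<and>
     (\<forall>\<omega>. positive_op \<omega> \<and> supp \<omega> \<subseteq> U \<longrightarrow> supp (channel L \<omega>) \<subseteq> U)"

definition minimal_enclosure :: "('j::finite \<Rightarrow> 'n::finite hop) \<Rightarrow> 'n hvec set \<Rightarrow> bool" where
  "minimal_enclosure L U \<longleftrightarrow> enclosure L U \<and> U \<noteq> {0} \<and>
     (\<forall>W. enclosure L W \<and> W \<subseteq> U \<longrightarrow> W = {0} \<or> W = U)"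

definition absorption :: "('j::finite \<Rightarrow> 'n::finite hop) \<Rightarrow> 'n hvec set \<Rightarrow> 'n hop" where
  "absorption L U = lim (\<lambda>n. (dual_channel L ^^ n) (oproj U))"

definition invariant_state :: "('j::finite \<Rightarrow> 'n::finite hop) \<Rightarrow> 'n hop \<Rightarrow> bool" where
  "invariant_state L \<omega> \<longleftrightarrow> positive_op \<omega> \<and> trace \<omega> = 1 \<and> channel L \<omega> = \<omega>"

definition fast_recurrent_space :: "('j::finite \<Rightarrow> 'n::finite hop) \<Rightarrow> 'n hvec set" where
  "fast_recurrent_space L = vec.span (\<Union> (supp ` {\<omega>. invariant_state L \<omega>}))"

definition separating_enclosure :: "('j::finite \<Rightarrow> 'n::finite hop) \<Rightarrow> 'n hvec set \<Rightarrow> bool" where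
  "separating_enclosure L U \<longleftrightarrow> enclosure L U \<and> U \<noteq> {0} \<and>
     (\<forall>W. minimal_enclosure L W \<longrightarrow> corthogonal W U \<or> W \<subseteq> U)"

text \<open>The summands are nonzero and mutually orthogonal, hence pairwise distinct, so the
  decomposition is given by the set of its summands.\<close>

definition enclosure_decomposition ::
    "('j::finite \<Rightarrow> 'n::finite hop) \<Rightarrow> 'n hvec set set \<Rightarrow> bool" where
  "enclosure_decomposition L D \<longleftrightarrow> finite D \<and>
     (\<forall>U\<in>D. separating_enclosure L U \<and>
        (\<forall>W. separating_enclosure L W \<and> W \<subseteq> U \<longrightarrow> W = U)) \<and>
     (\<forall>U\<in>D. \<forall>W\<in>D. U \<noteq> W \<longrightarrow> corthogonal U W) \<and>
     vec.span (\<Union>D) = fast_recurrent_space L"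


section \<open>Walk and position process\<close>

definition locally_finite_lattice :: "(real ^ 'd::finite) set \<Rightarrow> bool" where
  "locally_finite_lattice V \<longleftrightarrow> 0 \<in> V \<and> (\<forall>x\<in>V. \<forall>y\<in>V. x - y \<in> V) \<and> (\<forall>r. finite (V \<inter> cball 0 r))"

definition positively_generated :: "(real ^ 'd::finite) set \<Rightarrow> (real ^ 'd) set \<Rightarrow> bool" where
  "positively_generated V S \<longleftrightarrow> V = range (\<lambda>m :: real ^ 'd \<Rightarrow> nat. \<Sum>x\<in>S. real (m x) *\<^sub>R x)"

definition initial_state :: "(real ^ 'd::finite) set \<Rightarrow> (real ^ 'd \<Rightarrow> 'n::finite hop) \<Rightarrow> bool" where
  "initial_state V \<rho> \<longleftrightarrow> (\<forall>k\<in>V. positive_op (\<rho> k)) \<and> ((\<lambda>k. trace (\<rho> k)) has_sum 1) V"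

text \<open>The path \<open>(k, j\<^sub>1, j\<^sub>2, \<dots>)\<close> is the pair \<open>(k, w)\<close> with \<open>w n = j\<^bsub>n+1\<^esub>\<close>.\<close>

definition cylinder :: "(real ^ 'd::finite) \<Rightarrow> 'j list \<Rightarrow> ((real ^ 'd) \<times> (nat \<Rightarrow> 'j)) set" where
  "cylinder k js = {k} \<times> {w. \<forall>i<length js. w i = js ! i}"

text \<open>\<open>path_op L [j\<^sub>1, \<dots>, j\<^sub>n]\<close> is the product \<open>L j\<^sub>n \<dots> L j\<^sub>1\<close>.\<close>

fun path_op :: "('j \<Rightarrow> 'n::finite hop) \<Rightarrow> 'j list \<Rightarrow> 'n hop" where
  "path_op L [] = mat 1"
| "path_op L (j # js) = path_op L js ** L j"

text \<open>The requirements below determine the path law uniquely; the empty word gives the law of the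
  starting point.\<close>

definition path_law :: "(real ^ 'd::finite) set \<Rightarrow> ('j::finite \<Rightarrow> 'n::finite hop) \<Rightarrow>
    (real ^ 'd \<Rightarrow> 'n hop) \<Rightarrow> ((real ^ 'd) \<times> (nat \<Rightarrow> 'j)) measure \<Rightarrow> bool" where
  "path_law V L \<rho> P \<longleftrightarrow> prob_space P \<and>
     sets P = sets (sigma (V \<times> UNIV) {cylinder k js | k js. k \<in> V}) \<and>
     (\<forall>k\<in>V. \<forall>js. complex_of_real (measure P (cylinder k js)) =
        trace (path_op L js ** \<rho> k ** cadj (path_op L js)))"

primrec position :: "('j \<Rightarrow> real ^ 'd::finite) \<Rightarrow> nat \<Rightarrow> (real ^ 'd) \<times> (nat \<Rightarrow> 'j) \<Rightarrow> real ^ 'd" where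
  "position s 0 \<omega> = fst \<omega>"
| "position s (Suc n) \<omega> = position s n \<omega> + s (snd \<omega> n)"

definition mean_displacement_law ::
    "('j \<Rightarrow> real ^ 'd::finite) \<Rightarrow> ((real ^ 'd) \<times> (nat \<Rightarrow> 'j)) measure \<Rightarrow> nat \<Rightarrow> (real ^ 'd) measure" where
  "mean_displacement_law s P n =
     distr P borel (\<lambda>\<omega>. (position s n \<omega> - position s 0 \<omega>) /\<^sub>R real n)"


section \<open>Deformed channel and rate function\<close>

definition block :: "'n::finite hvec set \<Rightarrow> 'n hop set" where
  "block U = range (\<lambda>\<sigma>. oproj U ** \<sigma> ** oproj U)"

definition deformed_channel :: "('j::finite \<Rightarrow> real ^ 'd::finite) \<Rightarrow> ('j \<Rightarrow> 'n::finite hop) \<Rightarrow>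
    real ^ 'd \<Rightarrow> 'n hop \<Rightarrow> 'n hop" where
  "deformed_channel s L u \<sigma> = (\<Sum>i\<in>UNIV. exp (u \<bullet> s i) *\<^sub>R (L i ** \<sigma> ** cadj (L i)))"

text \<open>Spectrum of a linear map \<open>\<Phi>\<close> of the complex matrix space \<open>X\<close> into itself; multiplication by
  the scalar \<open>z\<close> is multiplication by the matrix \<open>mat z\<close>.\<close>

definition op_spectrum :: "'n::finite hop set \<Rightarrow> ('n hop \<Rightarrow> 'n hop) \<Rightarrow> complex set" where
  "op_spectrum X \<Phi> = {z. \<not> bij_betw (\<lambda>\<sigma>. mat z ** \<sigma> - \<Phi> \<sigma>) X X}"

definition op_spectral_radius :: "'n::finite hop set \<Rightarrow> ('n hop \<Rightarrow> 'n hop) \<Rightarrow> real" where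
  "op_spectral_radius X \<Phi> = (SUP z\<in>op_spectrum X \<Phi>. cmod z)"

definition deformed_radius :: "('j::finite \<Rightarrow> real ^ 'd::finite) \<Rightarrow> ('j \<Rightarrow> 'n::finite hop) \<Rightarrow>
    'n hvec set \<Rightarrow> real ^ 'd \<Rightarrow> real" where
  "deformed_radius s L U u = op_spectral_radius (block U) (deformed_channel s L u)"

definition enclosure_rate :: "('j::finite \<Rightarrow> real ^ 'd::finite) \<Rightarrow> ('j \<Rightarrow> 'n::finite hop) \<Rightarrow>
    'n hvec set \<Rightarrow> real ^ 'd \<Rightarrow> ereal" where
  "enclosure_rate s L U x = (SUP u. ereal (u \<bullet> x - ln (deformed_radius s L U u)))"

definition absorption_weight :: "(real ^ 'd::finite) set \<Rightarrow> ('j::finite \<Rightarrow> 'n::finite hop) \<Rightarrow>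
    (real ^ 'd \<Rightarrow> 'n hop) \<Rightarrow> 'n hvec set \<Rightarrow> complex" where
  "absorption_weight V L \<rho> U = (\<Sum>\<^sub>\<infinity>k\<in>V. trace (absorption L U ** \<rho> k))"

definition walk_rate :: "(real ^ 'd::finite) set \<Rightarrow> ('j::finite \<Rightarrow> real ^ 'd) \<Rightarrow>
    ('j \<Rightarrow> 'n::finite hop) \<Rightarrow> (real ^ 'd \<Rightarrow> 'n hop) \<Rightarrow> 'n hvec set set \<Rightarrow> real ^ 'd \<Rightarrow> ereal" where
  "walk_rate V s L \<rho> D x =
     Min ((\<lambda>U. enclosure_rate s L U x) ` {U \<in> D. absorption_weight V L \<rho> U \<noteq> 0})"


section \<open>Large deviations\<close>

definition ext_ln :: "real \<Rightarrow> ereal" where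
  "ext_ln p = (if p = 0 then - \<infinity> else ereal (ln p))"

text \<open>Compactness of the sublevel sets subsumes lower semicontinuity.\<close>

definition good_rate_function :: "(real ^ 'd::finite \<Rightarrow> ereal) \<Rightarrow> bool" where
  "good_rate_function I \<longleftrightarrow> (\<forall>x. 0 \<le> I x) \<and> (\<forall>c::real. compact {x. I x \<le> ereal c})"

definition large_deviation_principle ::
    "(nat \<Rightarrow> (real ^ 'd::finite) measure) \<Rightarrow> (real ^ 'd \<Rightarrow> ereal) \<Rightarrow> bool" where
  "large_deviation_principle \<mu> I \<longleftrightarrow> (\<forall>B\<in>sets borel.
     - (INF x\<in>interior B. I x) \<le> liminf (\<lambda>n. ereal (1 / real n) * ext_ln (measure (\<mu> n) B)) \<and>
     liminf (\<lambda>n. ereal (1 / real n) * ext_ln (measure (\<mu> n) B))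
       \<le> limsup (\<lambda>n. ereal (1 / real n) * ext_ln (measure (\<mu> n) B)) \<and>
     limsup (\<lambda>n. ereal (1 / real n) * ext_ln (measure (\<mu> n) B)) \<le> - (INF x\<in>closure B. I x))"

end

theory Submission
  imports Defs
begin

text \<open>
  By recurrence every enclosure reduces all the Kraus operators, so the space splits into orthogonal
  minimal enclosures and the law of the walk is the corresponding finite mixture. It suffices to bound
  each component exponentially: two non-orthogonal minimal enclosures have the same deformed spectral
  radius (compress the Perron eigenvector of one to the other), hence the radius is constant on the
  minimal enclosures inside one summand of the decomposition.

  On a minimal enclosure, Brouwer's theorem gives a positive definite eigenvector of the dual deformed
  channel. It makes the Laplace transform comparable to the \<open>n\<close>-th power of the spectral radius, and
  the upper bound follows from Chebyshev's inequality and compactness.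

  The lower bound avoids differentiability of the spectral radius. By irreducibility and compactness,
  path weights are supermultiplicative up to a constant after inserting connecting words of bounded
  length. Blocks of length \<open>m\<close> may therefore be treated as independent; their Laplace transform is at
  least the \<open>m\<close>-th power of the spectral radius, by evaluating the eigenvector, as a quadratic form,
  at a maximising unit vector. A Cramer lower bound for the blocks, followed by \<open>m\<close> tending to infinity, gives
  the claim at every point, including those where the Legendre supremum is not attained.
\<close>

section \<open>The Hermitian product and positive operators\<close>

text \<open>The mixture cannot be treated as a whole: its limiting log-Laplace transform is the
  maximum of those of the components, and the Legendre transform of that maximum is convex, whereas
  a minimum of convex functions usually is not. Hence both bounds are proved for one minimal
  enclosure \<open>W\<close> at a time, with the compressed state
  \<open>oproj W ** \<rho>0 ** oproj W\<close>, and only afterwards added up. The blocks of the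
  lower bound are weighed with the unnormalised projection \<open>oproj W\<close>. It dominates
  \<open>ketbra z\<close> for every unit vector \<open>z\<close> of \<open>W\<close>, so the Laplace
  transform of the block weights is at least \<open>radius W u ^ m\<close> with no constant in
  front. Their Legendre transform is therefore at most \<open>m\<close> times the rate at every
  point, and the insertion of connecting words costs each block only a factor independent of
  \<open>m\<close>, which becomes negligible as \<open>m\<close> grows.\<close>

lemma bounded_bilinear_matrix_mult:
  "bounded_bilinear ((**) :: complex^'n::finite^'m::finite \<Rightarrow> complex^'k::finite^'n \<Rightarrow> complex^'k^'m)"
  unfolding bilinear_conv_bounded_bilinear[symmetric] bilinear_def
  by (auto intro!: linearI simp: matrix_matrix_mult_def vec_eq_iff algebra_simps sum.distrib
      scaleR_right.sum)

lemma bounded_bilinear_matrix_vector_mult: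
  "bounded_bilinear ((*v) :: complex^'n::finite^'m::finite \<Rightarrow> complex^'n \<Rightarrow> complex^'m)"
  unfolding bilinear_conv_bounded_bilinear[symmetric] bilinear_def
  by (auto intro!: linearI simp: matrix_vector_mult_def vec_eq_iff algebra_simps sum.distrib
      scaleR_right.sum)

lemma bounded_bilinear_cinner:
  "bounded_bilinear (cinner :: 'n::finite hvec \<Rightarrow> 'n hvec \<Rightarrow> complex)"
  unfolding bilinear_conv_bounded_bilinear[symmetric] bilinear_def
  by (auto intro!: linearI simp: cinner_def vec_eq_iff algebra_simps sum.distrib scaleR_right.sum)

lemma bounded_linear_trace: "bounded_linear (trace :: 'n::finite hop \<Rightarrow> complex)"
  unfolding linear_conv_bounded_linear[symmetric]
  by (auto intro!: linearI simp: trace_def sum.distrib scaleR_right.sum)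

lemma bounded_linear_cadj: "bounded_linear (cadj :: 'n::finite hop \<Rightarrow> 'n hop)"
  unfolding linear_conv_bounded_linear[symmetric]
  by (auto intro!: linearI simp: cadj_def vec_eq_iff)

lemmas matrix_mult_simps =
  bounded_bilinear.zero_left[OF bounded_bilinear_matrix_mult]
  bounded_bilinear.zero_right[OF bounded_bilinear_matrix_mult]
  bounded_bilinear.add_left[OF bounded_bilinear_matrix_mult]
  bounded_bilinear.add_right[OF bounded_bilinear_matrix_mult]
  bounded_bilinear.diff_left[OF bounded_bilinear_matrix_mult]
  bounded_bilinear.diff_right[OF bounded_bilinear_matrix_mult]
  bounded_bilinear.sum_left[OF bounded_bilinear_matrix_mult]
  bounded_bilinear.sum_right[OF bounded_bilinear_matrix_mult]
  bounded_bilinear.scaleR_left[OF bounded_bilinear_matrix_mult]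
  bounded_bilinear.scaleR_right[OF bounded_bilinear_matrix_mult]

lemmas mult_vec = matrix_vector_mul_assoc[symmetric]

lemmas mat_vec_simps =
  bounded_bilinear.add_left[OF bounded_bilinear_matrix_vector_mult]
  bounded_bilinear.add_right[OF bounded_bilinear_matrix_vector_mult]
  bounded_bilinear.diff_left[OF bounded_bilinear_matrix_vector_mult]
  bounded_bilinear.diff_right[OF bounded_bilinear_matrix_vector_mult]
  bounded_bilinear.sum_left[OF bounded_bilinear_matrix_vector_mult]
  bounded_bilinear.sum_right[OF bounded_bilinear_matrix_vector_mult]
  bounded_bilinear.scaleR_left[OF bounded_bilinear_matrix_vector_mult]
  bounded_bilinear.scaleR_right[OF bounded_bilinear_matrix_vector_mult]

lemmas cinner_simps =
  bounded_bilinear.zero_left[OF bounded_bilinear_cinner]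
  bounded_bilinear.zero_right[OF bounded_bilinear_cinner]
  bounded_bilinear.add_left[OF bounded_bilinear_cinner]
  bounded_bilinear.add_right[OF bounded_bilinear_cinner]
  bounded_bilinear.diff_left[OF bounded_bilinear_cinner]
  bounded_bilinear.diff_right[OF bounded_bilinear_cinner]
  bounded_bilinear.sum_left[OF bounded_bilinear_cinner]
  bounded_bilinear.sum_right[OF bounded_bilinear_cinner]
  bounded_bilinear.scaleR_left[OF bounded_bilinear_cinner]
  bounded_bilinear.scaleR_right[OF bounded_bilinear_cinner]

lemmas trace_simps =
  linear_0[OF bounded_linear.linear[OF bounded_linear_trace]]
  linear_add[OF bounded_linear.linear[OF bounded_linear_trace]]
  linear_diff[OF bounded_linear.linear[OF bounded_linear_trace]]
  linear_sum[OF bounded_linear.linear[OF bounded_linear_trace]]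
  linear_scale[OF bounded_linear.linear[OF bounded_linear_trace]]

lemma cinner_smult_right: "cinner x (c *s y) = c * cinner x y"
  by (simp add: cinner_def sum_distrib_left algebra_simps)

lemma cinner_smult_left: "cinner (c *s x) y = cnj c * cinner x y"
  by (simp add: cinner_def sum_distrib_left algebra_simps)

lemma cinner_commute: "cinner y x = cnj (cinner x y)"
  by (simp add: cinner_def mult.commute)

lemma cinner_eq_0_commute: "cinner y x = 0 \<longleftrightarrow> cinner x y = 0"
  by (subst cinner_commute) auto

lemma Re_cinner: "Re (cinner x y) = x \<bullet> y"
  by (simp add: cinner_def inner_vec_def inner_complex_def)

lemma cinner_self: "cinner x x = of_real ((norm x)\<^sup>2)"
proof -
  have "Im (cinner x x) = 0"
    using cinner_commute[of x x] by (metis complex_cnj complex.collapse complex.inject equal_neg_zero complex_cnj_cancel_iff cnj.simps(2))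
  then show ?thesis
    by (auto simp: complex_eq_iff Re_cinner power2_norm_eq_inner)
qed

lemma cinner_self_eq_0: "cinner x x = 0 \<longleftrightarrow> x = 0"
  by (simp add: cinner_self)

lemma cinner_matrix: "cinner x (M *v y) = cinner (cadj M *v x) y"
proof -
  have "cinner x (M *v y) = (\<Sum>i\<in>UNIV. \<Sum>j\<in>UNIV. cnj (x $ i) * (M $ i $ j * y $ j))"
    by (simp add: cinner_def matrix_vector_mult_def sum_distrib_left)
  also have "\<dots> = (\<Sum>j\<in>UNIV. \<Sum>i\<in>UNIV. cnj (x $ i) * (M $ i $ j * y $ j))"
    by (rule sum.swap)
  also have "\<dots> = cinner (cadj M *v x) y"
    by (simp add: cinner_def matrix_vector_mult_def cadj_def sum_distrib_left sum_distrib_right algebra_simps)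
  finally show ?thesis .
qed

lemma cadj_cadj [simp]: "cadj (cadj M) = M"
  by (simp add: cadj_def vec_eq_iff)

lemma cinner_matrix_left: "cinner (M *v x) y = cinner x (cadj M *v y)"
  by (simp add: cinner_matrix)

lemma cadj_mult: "cadj (M ** N) = cadj N ** cadj M"
  by (simp add: cadj_def vec_eq_iff matrix_matrix_mult_def mult.commute)

lemma cadj_mat_1 [simp]: "cadj (mat 1) = mat 1"
  by (auto simp: cadj_def vec_eq_iff mat_def)

lemma cadj_sum: "cadj (\<Sum>i\<in>I. f i) = (\<Sum>i\<in>I. cadj (f i))"
  by (rule linear_sum[OF bounded_linear.linear[OF bounded_linear_cadj]])

lemma cadj_diff: "cadj (M - N) = cadj M - cadj N"
  by (rule linear_diff[OF bounded_linear.linear[OF bounded_linear_cadj]])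

lemma matrix_eqI_vec:
  fixes M N :: "complex^'n::finite^'m::finite"
  assumes "\<And>x. M *v x = N *v x"
  shows "M = N"
  using assms by (simp add: matrix_eq)

lemma trace_eq_cinner:
  fixes M :: "'n::finite hop"
  shows "trace M = (\<Sum>i\<in>UNIV. cinner (axis i 1) (M *v axis i 1))"
proof -
  have "cinner (axis i 1) (M *v axis i 1) = M $ i $ i" for i
  proof -
    have "cinner (axis i 1) (M *v axis i 1) =
       (\<Sum>k\<in>UNIV. if k = i then M $ i $ i else 0)"
      unfolding cinner_def by (rule sum.cong) (auto simp: axis_def matrix_vector_mult_def if_distrib cong: if_cong)
    then show ?thesis by simp
  qed
  then show ?thesis by (simp add: trace_def)
qed

abbreviation quad :: "'n::finite hop \<Rightarrow> 'n hvec \<Rightarrow> real" where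
  "quad M x \<equiv> Re (cinner x (M *v x))"

lemma positive_op_Re: "positive_op M \<Longrightarrow> 0 \<le> quad M x"
  by (simp add: positive_op_def)

lemma positive_op_cinner_real:
  "positive_op M \<Longrightarrow> cinner x (M *v x) = of_real (quad M x)"
  unfolding positive_op_def by (metis of_real_Re)

lemma positive_op_0 [simp]: "positive_op 0"
  by (simp add: positive_op_def cinner_simps)

lemma positive_op_add: "positive_op M \<Longrightarrow> positive_op N \<Longrightarrow> positive_op (M + N)"
  by (simp add: positive_op_def cinner_simps mat_vec_simps)

lemma positive_op_sum: "(\<And>i. i \<in> I \<Longrightarrow> positive_op (f i)) \<Longrightarrow> positive_op (\<Sum>i\<in>I. f i)"
  by (induction I rule: infinite_finite_induct) (auto intro: positive_op_add)

lemma positive_op_scaleR: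
  assumes "positive_op M" "0 \<le> c"
  shows "positive_op (c *\<^sub>R M)"
  using assms by (auto simp: positive_op_def cinner_simps mat_vec_simps complex_is_Real_iff)

lemma positive_op_conj:
  assumes "positive_op M"
  shows "positive_op (N ** M ** cadj N)"
proof -
  have "cinner x ((N ** M ** cadj N) *v x) = cinner (cadj N *v x) (M *v (cadj N *v x))" for x
    by (simp add: mult_vec cinner_matrix[of x N])
  then show ?thesis using assms by (simp add: positive_op_def)
qed

lemma positive_op_conj':
  assumes "positive_op M"
  shows "positive_op (cadj N ** M ** N)"
  using positive_op_conj[OF assms, of "cadj N"] by simp

lemma positive_op_mat_1 [simp]: "positive_op (mat 1)"
  by (simp add: positive_op_def cinner_self)

text \<open>Polarisation: the form is real at \<open>x + y\<close> and at
  \<open>x + \<i> *s y\<close>, which ties the imaginary and the real part of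
  \<open>cinner x (M *v y)\<close> to those of \<open>cinner y (M *v x)\<close>.\<close>

lemma positive_op_cadj:
  assumes "positive_op M"
  shows "cadj M = M"
proof -
  have *: "cinner y (M *v x) = cnj (cinner x (M *v y))" for x y
  proof -
    have r: "Im (cinner z (M *v z)) = 0" for z
      using assms by (simp add: positive_op_def complex_is_Real_iff)
    have "Im (cinner x (M *v y)) + Im (cinner y (M *v x)) = 0"
      using r[of "x + y"] r[of x] r[of y] by (simp add: cinner_simps mat_vec_simps)
    moreover have "Re (cinner x (M *v y)) - Re (cinner y (M *v x)) = 0"
      using r[of "x + \<i> *s y"] r[of x] r[of y]
      by (simp add: cinner_simps mat_vec_simps matrix_vector_mult_scaleR cinner_smult_left
          cinner_smult_right vec.scale algebra_simps)
    ultimately show ?thesis by (simp add: complex_eq_iff)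
  qed
  show ?thesis
  proof (rule matrix_eqI_vec)
    fix x
    have "cinner y (cadj M *v x) = cinner y (M *v x)" for y
      using *[of x y] cinner_matrix_left[of M y x] by (simp add: cinner_commute[of "M *v y" x])
    then have "cinner (cadj M *v x - M *v x) (cadj M *v x - M *v x) = 0"
      by (simp add: cinner_simps)
    then show "cadj M *v x = M *v x"
      by (simp add: cinner_self_eq_0)
  qed
qed

text \<open>Along the line \<open>x + t *\<^sub>R y\<close> with \<open>y = M *v x\<close> the form
  equals \<open>2 * t * (norm y)\<^sup>2 + t\<^sup>2 * q\<close>. A nonnegative quadratic without
  constant term has no linear term, so \<open>y = 0\<close>.\<close>

lemma positive_op_cinner_zero:
  assumes "positive_op M" "quad M x = 0"
  shows "M *v x = 0"
proof -
  define y where "y = M *v x"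
  define q where "q = quad M y"
  have a: "cinner y (M *v x) = of_real ((norm y)\<^sup>2)" by (simp add: y_def cinner_self)
  have b: "cinner x (M *v y) = of_real ((norm y)\<^sup>2)"
    using cinner_matrix[of x M y] positive_op_cadj[OF assms(1)] by (simp add: y_def cinner_self)
  have ge: "0 \<le> 2 * t * (norm y)\<^sup>2 + t\<^sup>2 * q" for t :: real
  proof -
    have "0 \<le> quad M (x + t *\<^sub>R y)"
      by (rule positive_op_Re[OF assms(1)])
    also have "\<dots> = 2 * t * (norm y)\<^sup>2 + t\<^sup>2 * q"
      using assms(2) a b by (simp add: cinner_simps mat_vec_simps q_def power2_eq_square algebra_simps)
    finally show ?thesis .
  qed
  have q0: "0 \<le> q" unfolding q_def by (rule positive_op_Re[OF assms(1)])
  have "(norm y)\<^sup>2 = 0"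
  proof (rule ccontr)
    assume n: "(norm y)\<^sup>2 \<noteq> 0"
    define r where "r = (norm y)\<^sup>2"
    have r: "r > 0" using n by (simp add: r_def)
    \<comment> \<open>The vertex would be \<open>- r / q\<close>; the shift by \<open>1\<close>
      keeps the denominator positive when \<open>q = 0\<close>.\<close>
    have "0 \<le> 2 * (- r / (q + 1)) * r + (- r / (q + 1))\<^sup>2 * q" using ge[of "- r / (q + 1)"] by (simp only: r_def)
    also have "\<dots> = (r\<^sup>2 / (q+1)\<^sup>2) * (- (q + 2))"
    proof -
      define D where "D = q + 1"
      have "2 * (- r / D) * r + (- r / D)\<^sup>2 * (D - 1) = (r\<^sup>2 / D\<^sup>2) * (- (D + 1))" if "D \<noteq> 0"
        using that by (simp add: field_simps power2_eq_square)
      from this show ?thesis using q0 by (simp add: D_def add.commute)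
    qed
    also have "\<dots> < 0" using r q0 by (intro mult_pos_neg) auto
    finally show False by simp
  qed
  then show ?thesis by (simp add: y_def)
qed

lemma positive_op_trace:
  assumes "positive_op M"
  shows "trace M = of_real (Re (trace M))" "0 \<le> Re (trace M)"
proof -
  have "trace M = of_real (\<Sum>i\<in>UNIV. Re (cinner (axis i 1) (M *v axis i 1)))"
    using positive_op_cinner_real[OF assms] by (simp add: trace_eq_cinner)
  then show "trace M = of_real (Re (trace M))" by (metis Re_complex_of_real)
  show "0 \<le> Re (trace M)"
    using positive_op_Re[OF assms] by (auto simp: trace_eq_cinner intro: sum_nonneg)
qed

lemma positive_op_cinner_le_trace:
  assumes "positive_op M"
  shows "Re (cinner (axis i 1) (M *v axis i 1)) \<le> Re (trace M)"
  using member_le_sum[of i UNIV "\<lambda>i. Re (cinner (axis i 1) (M *v axis i 1))"] positive_op_Re[OF assms]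
  by (simp add: trace_eq_cinner)

lemma positive_op_trace_0:
  assumes "positive_op M" "Re (trace M) = 0"
  shows "M = 0"
proof -
  have "M *v axis i 1 = 0" for i
    using positive_op_cinner_le_trace[OF assms(1), of i] positive_op_Re[OF assms(1), of "axis i 1"]
      assms(2) by (intro positive_op_cinner_zero[OF assms(1)]) simp
  then show ?thesis
    by (simp add: vec_eq_iff matrix_vector_mult_def axis_def if_distrib cong: if_cong)
qed

lemma positive_op_trace_pos:
  assumes "positive_op M" "M \<noteq> 0"
  shows "0 < Re (trace M)"
  using positive_op_trace_0[OF assms(1)] positive_op_trace(2)[OF assms(1)] assms(2) by force

section \<open>Continuity, closedness of the positive cone and norm bounds by the trace\<close>

lemma continuous_on_cinner [continuous_intros]:
  "continuous_on S f \<Longrightarrow> continuous_on S g \<Longrightarrow> continuous_on S (\<lambda>x. cinner (f x) (g x))"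
  by (rule bounded_bilinear.continuous_on[OF bounded_bilinear_cinner])

lemma continuous_on_matrix_mult [continuous_intros]:
  fixes f :: "_ \<Rightarrow> complex^'n::finite^'m::finite" and g :: "_ \<Rightarrow> complex^'k::finite^'n"
  shows "continuous_on S f \<Longrightarrow> continuous_on S g \<Longrightarrow> continuous_on S (\<lambda>x. f x ** g x)"
  by (rule bounded_bilinear.continuous_on[OF bounded_bilinear_matrix_mult])

lemma continuous_on_matrix_vector_mult' [continuous_intros]:
  fixes f :: "_ \<Rightarrow> complex^'n::finite^'m::finite"
  shows "continuous_on S f \<Longrightarrow> continuous_on S g \<Longrightarrow> continuous_on S (\<lambda>x. f x *v g x)"
  by (rule bounded_bilinear.continuous_on[OF bounded_bilinear_matrix_vector_mult])

lemma continuous_on_trace [continuous_intros]: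
  fixes f :: "_ \<Rightarrow> 'n::finite hop"
  shows "continuous_on S f \<Longrightarrow> continuous_on S (\<lambda>x. trace (f x))"
  by (rule bounded_linear.continuous_on[OF bounded_linear_trace])

lemma closed_positive_op: "closed {M :: 'n::finite hop. positive_op M}"
proof -
  have "{M :: 'n hop. positive_op M} =
      (\<Inter>x. {M. Im (cinner x (M *v x)) = 0 \<and> 0 \<le> quad M x})"
    by (auto simp: positive_op_def complex_is_Real_iff)
  moreover have "closed {M :: 'n hop. Im (cinner x (M *v x)) = 0 \<and> 0 \<le> quad M x}" for x
    by (intro closed_Collect_conj closed_Collect_eq closed_Collect_le continuous_intros)
  ultimately show ?thesis by (auto intro: closed_INT)
qed

lemma norm_vec_le_sum: "norm (x :: 'b::real_normed_vector ^ 'n::finite) \<le> (\<Sum>i\<in>UNIV. norm (x $ i))"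
  by (simp add: norm_vec_def L2_set_le_sum)

text \<open>Positivity on the span of two basis vectors, with the phase \<open>c\<close> chosen so
  that the cross term becomes \<open>- norm (M $ i $ j)\<close>. The bound is not sharp; what
  matters is that the trace controls the norm.\<close>

lemma positive_op_norm_entry:
  assumes "positive_op (M :: 'n::finite hop)"
  shows "norm (M $ i $ j) \<le> 2 * Re (trace M)"
proof -
  let ?e = "\<lambda>i. axis i 1 :: 'n hvec"
  have ent: "cinner (?e i) (M *v ?e j) = M $ i $ j" for i j
  proof -
    have "cinner (?e i) (M *v ?e j) = (\<Sum>k\<in>UNIV. if k = i then M $ i $ j else 0)"
      unfolding cinner_def by (rule sum.cong) (auto simp: axis_def matrix_vector_mult_def if_distrib cong: if_cong)
    then show ?thesis by simp
  qed
  have d: "Re (M $ i $ i) \<le> Re (trace M)" for i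
    using positive_op_cinner_le_trace[OF assms, of i] by (simp add: ent)
  define c where "c = - cnj (sgn (M $ i $ j))"
  have h: "M $ j $ i = cnj (M $ i $ j)"
    using positive_op_cadj[OF assms] by (simp add: cadj_def vec_eq_iff)
  have c1: "c * cnj c * M $ j $ j = M $ j $ j \<or> M $ i $ j = 0"
    using complex_norm_square[of "sgn (M $ i $ j)"] by (auto simp: c_def norm_sgn mult.commute)
  have c2: "c * M $ i $ j = - of_real (norm (M $ i $ j))"
    by (cases "M $ i $ j = 0") (auto simp: c_def sgn_eq field_simps complex_norm_square[symmetric] power2_eq_square)
  have "0 \<le> quad M (?e i + c *s ?e j)"
    by (rule positive_op_Re[OF assms])
  also have "cinner (?e i + c *s ?e j) (M *v (?e i + c *s ?e j)) =
      M $ i $ i + c * M $ i $ j + cnj c * M $ j $ i + c * cnj c * M $ j $ j"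
    by (simp add: cinner_simps mat_vec_simps cinner_smult_left cinner_smult_right vec.scale ent algebra_simps)
  also have "cnj c * M $ j $ i = cnj (c * M $ i $ j)" by (simp add: h)
  finally have "0 \<le> Re (M $ i $ i) - 2 * norm (M $ i $ j) + Re (c * cnj c * M $ j $ j)"
    by (simp add: c2 del: complex_cnj_mult)
  note A = this
  show ?thesis
  proof (cases "M $ i $ j = 0")
    case True
    then show ?thesis using positive_op_trace(2)[OF assms] by simp
  next
    case False
    then have e: "c * cnj c * M $ j $ j = M $ j $ j" using c1 by blast
    show ?thesis
      using A[unfolded e] d[of i] d[of j] positive_op_trace(2)[OF assms] by linarith
  qed
qed

text \<open>With this bound the positive operators of trace one form a bounded set, and the initial
  state is absolutely summable as soon as its traces are.\<close>

lemma positive_op_norm_le: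
  assumes "positive_op (M :: 'n::finite hop)"
  shows "norm M \<le> (2 * real CARD('n) * real CARD('n)) * Re (trace M)"
proof -
  have "norm M \<le> (\<Sum>i\<in>UNIV. \<Sum>j\<in>UNIV. norm (M $ i $ j))"
    by (rule order_trans[OF norm_vec_le_sum]) (intro sum_mono norm_vec_le_sum)
  also have "\<dots> \<le> (\<Sum>i\<in>(UNIV::'n set). \<Sum>j\<in>(UNIV::'n set). 2 * Re (trace M))"
    by (intro sum_mono positive_op_norm_entry assms)
  finally show ?thesis by (simp add: algebra_simps)
qed

section \<open>Orthogonal projections and enclosures\<close>

lemma subspace_of_vec_subspace:
  assumes "vec.subspace (U :: 'n::finite hvec set)"
  shows "subspace U"
proof -
  have "c *\<^sub>R x = of_real c *s x" for c and x :: "'n hvec"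
    by (simp add: vec_eq_iff) (simp add: scaleR_conv_of_real)
  then show ?thesis
    using assms by (auto simp: subspace_def vec.subspace_def)
qed

text \<open>The real orthogonal decomposition yields only \<open>Re (cinner u z) = 0\<close>.
  Applied to \<open>\<i> *s u\<close> as well, which lies in the complex subspace \<open>U\<close>,
  it also removes the imaginary part.\<close>

lemma ex_orthogonal_decomp:
  assumes "vec.subspace (U :: 'n::finite hvec set)"
  shows "\<exists>!y. y \<in> U \<and> (\<forall>u\<in>U. cinner u (x - y) = 0)"
proof -
  have sub: "span U = U"
    using subspace_of_vec_subspace[OF assms] by (simp add: span_eq_iff)
  obtain y z where y: "y \<in> U" and z: "\<And>w. w \<in> U \<Longrightarrow> orthogonal z w" and x: "x = y + z"
    using orthogonal_subspace_decomp_exists[of U x] unfolding sub by metis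
  have "cinner u (x - y) = 0" if u: "u \<in> U" for u
  proof -
    have iu: "\<i> *s u \<in> U" using assms u by (simp add: vec.subspace_def)
    have "Re (cinner u z) = 0" "Re (cinner (\<i> *s u) z) = 0"
      using z[OF u] z[OF iu] by (auto simp: Re_cinner orthogonal_def inner_commute)
    then show ?thesis by (simp add: x cinner_smult_left complex_eq_iff)
  qed
  moreover have "y' = y''" if "y' \<in> U" "\<forall>u\<in>U. cinner u (x - y') = 0"
      "y'' \<in> U" "\<forall>u\<in>U. cinner u (x - y'') = 0" for y' y''
  proof -
    have "y' - y'' \<in> U" using that assms by (simp add: vec.subspace_diff)
    then have "cinner (y' - y'') (x - y'' - (x - y')) = 0"
      using that by (simp only: cinner_simps) simp
    then show ?thesis by (simp add: cinner_self_eq_0)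
  qed
  ultimately show ?thesis using y by blast
qed

text \<open>Makes the definite description in \<open>oproj\<close> meaningful. For two candidates
  \<open>Q\<close>, \<open>R\<close> with the same range, each fixes the image of the other, so
  \<open>Q ** R = R\<close> and \<open>R ** Q = Q\<close>; the adjoint of the second identity reads
  \<open>Q ** R = Q\<close>.\<close>

lemma ex1_oproj:
  assumes "vec.subspace (U :: 'n::finite hvec set)"
  shows "\<exists>!Q. Q ** Q = Q \<and> cadj Q = Q \<and> range (\<lambda>x. Q *v x) = U"
proof -
  define f where "f x = (THE y. y \<in> U \<and> (\<forall>u\<in>U. cinner u (x - y) = 0))" for x
  have f: "f x \<in> U" "\<And>u. u \<in> U \<Longrightarrow> cinner u (x - f x) = 0" for x
    using theI'[OF ex_orthogonal_decomp[OF assms, of x]] by (auto simp: f_def)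
  have f_eq: "f x = y" if "y \<in> U" "\<And>u. u \<in> U \<Longrightarrow> cinner u (x - y) = 0" for x y
    using ex_orthogonal_decomp[OF assms, of x] that f(1)[of x] f(2)[of _ x] by blast
  have lin: "Vector_Spaces.linear (*s) (*s) f"
  proof (rule Vector_Spaces.linear_iff[THEN iffD2], intro conjI allI)
    show "vector_space ((*s) :: complex \<Rightarrow> 'n hvec \<Rightarrow> 'n hvec)" by (rule vec.vector_space_axioms)
    show "vector_space ((*s) :: complex \<Rightarrow> 'n hvec \<Rightarrow> 'n hvec)" by (rule vec.vector_space_axioms)
    fix x y c
    show "f (x + y) = f x + f y"
    proof (rule f_eq)
      show "f x + f y \<in> U" using f assms by (simp add: vec.subspace_add)
      show "cinner u (x + y - (f x + f y)) = 0" if "u \<in> U" for u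
        using f(2)[OF that, of x] f(2)[OF that, of y] by (simp add: cinner_simps)
    qed
    show "f (c *s x) = c *s f x"
    proof (rule f_eq)
      show "c *s f x \<in> U" using f assms by (simp add: vec.subspace_scale)
      show "cinner u (c *s x - c *s f x) = 0" if "u \<in> U" for u
        using f(2)[OF that, of x] by (simp only: vec.scale_right_diff_distrib[symmetric] cinner_smult_right) simp
    qed
  qed
  define Q where "Q = matrix f"
  have Q: "Q *v x = f x" for x
    unfolding Q_def using matrix_works[OF lin] by simp
  have fU: "f x = x" if "x \<in> U" for x
    by (rule f_eq) (auto simp: that cinner_simps)
  have fp: "cinner x (f y) = cinner (f x) (f y)" for x y
    using f(2)[OF f(1)[of y], of x] by (subst (1 2) cinner_commute) (simp add: cinner_simps)
  have QQ: "Q ** Q = Q"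
    by (rule matrix_eqI_vec) (simp add: mult_vec Q fU f(1))
  have Qa: "cadj Q = Q"
  proof (rule matrix_eqI_vec)
    fix x
    have "cinner (cadj Q *v x) y = cinner (Q *v x) y" for y
    proof -
      have "cinner (cadj Q *v x) y = cinner x (f y)"
        by (simp add: cinner_matrix_left Q)
      also have "\<dots> = cinner (f x) (f y)" by (rule fp)
      also have "\<dots> = cinner (f x) y" using f(2)[OF f(1)[of x], of y] by (simp add: cinner_simps)
      finally show ?thesis by (simp add: Q)
    qed
    then have "cinner (cadj Q *v x - Q *v x) (cadj Q *v x - Q *v x) = 0" by (simp add: cinner_simps)
    then show "cadj Q *v x = Q *v x" by (simp add: cinner_self_eq_0)
  qed
  have Qr: "range (\<lambda>x. Q *v x) = U"
    using f(1) fU by (auto simp: Q image_iff) (metis)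
  show ?thesis
  proof (rule ex1I)
    show "Q ** Q = Q \<and> cadj Q = Q \<and> range (\<lambda>x. Q *v x) = U" using QQ Qa Qr by simp
    fix R assume R: "R ** R = R \<and> cadj R = R \<and> range (\<lambda>x. R *v x) = U"
    have "Q ** R = R"
    proof (rule matrix_eqI_vec)
      fix x
      have "R *v x \<in> U" using R by auto
      then show "(Q ** R) *v x = R *v x" by (simp add: mult_vec Q fU)
    qed
    moreover have "R ** Q = Q"
    proof (rule matrix_eqI_vec)
      fix x
      have "Q *v x \<in> range (\<lambda>x. R *v x)" using R Q f(1) by simp
      then obtain z where z: "Q *v x = R *v z" by auto
      show "(R ** Q) *v x = Q *v x"
        using R by (simp add: mult_vec z) (simp add: matrix_vector_mul_assoc)
    qed
    then have "cadj (R ** Q) = Q" using Qa by simp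
    then have "Q ** R = Q" using R Qa by (simp add: cadj_mult)
    ultimately show "R = Q" by simp
  qed
qed

context
  fixes U :: "'n::finite hvec set"
  assumes U: "vec.subspace U"
begin

lemma oproj_idem: "oproj U ** oproj U = oproj U"
  and oproj_cadj: "cadj (oproj U) = oproj U"
  and range_oproj: "range (\<lambda>x. oproj U *v x) = U"
  using theI'[OF ex1_oproj[OF U]] by (simp_all add: oproj_def)

lemma oproj_in: "oproj U *v x \<in> U"
  using range_oproj by auto

lemma oproj_idem_vec: "oproj U *v (oproj U *v x) = oproj U *v x"
  by (simp add: matrix_vector_mul_assoc oproj_idem)

lemma oproj_fix: "x \<in> U \<Longrightarrow> oproj U *v x = x"
  using range_oproj oproj_idem_vec by (metis imageE)

lemma positive_oproj: "positive_op (oproj U)"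
  using positive_op_conj[OF positive_op_mat_1, of "oproj U"] by (simp add: oproj_cadj oproj_idem)

lemma cinner_oproj: "cinner (oproj U *v x) y = cinner x (oproj U *v y)"
  by (simp add: cinner_matrix_left oproj_cadj)

lemma oproj_eq_0: "oproj U *v x = 0 \<longleftrightarrow> (\<forall>u\<in>U. cinner u x = 0)"
proof
  assume "oproj U *v x = 0"
  then show "\<forall>u\<in>U. cinner u x = 0"
    using cinner_oproj oproj_fix by (metis bounded_bilinear.zero_right[OF bounded_bilinear_cinner])
next
  assume "\<forall>u\<in>U. cinner u x = 0"
  then have "cinner (oproj U *v x) (oproj U *v x) = 0"
    by (simp add: cinner_oproj[symmetric] oproj_idem_vec oproj_in)
  then show "oproj U *v x = 0" by (simp add: cinner_self_eq_0)
qed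

end

lemma corthogonal_sym: "corthogonal U W \<longleftrightarrow> corthogonal W U"
  unfolding corthogonal_def using cinner_eq_0_commute by blast

lemma oproj_corthogonal:
  assumes "vec.subspace U" "vec.subspace W" "corthogonal U W"
  shows "oproj U ** oproj W = 0"
proof (rule matrix_eqI_vec)
  fix x
  show "(oproj U ** oproj W) *v x = 0 *v x"
    using assms oproj_in[OF assms(2)]
    by (simp add: mult_vec oproj_eq_0[OF assms(1)] corthogonal_def)
qed

lemma oproj_subset:
  assumes "vec.subspace U" "vec.subspace W" "U \<subseteq> W"
  shows "oproj W ** oproj U = oproj U"
proof (rule matrix_eqI_vec)
  fix x
  show "(oproj W ** oproj U) *v x = oproj U *v x"
    using oproj_fix[OF assms(2) subsetD[OF assms(3) oproj_in[OF assms(1), of x]]]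
    by (simp add: mult_vec)
qed

lemma corthogonal_span_left:
  assumes "corthogonal A W"
  shows "corthogonal (vec.span A) W"
  unfolding corthogonal_def
proof safe
  fix x y assume x: "x \<in> vec.span A" and y: "y \<in> W"
  show "cinner x y = 0"
    using x
  proof (induction rule: vec.span_induct_alt)
    case base show ?case by (simp add: cinner_simps)
  next
    case (step c x z)
    then show ?case using assms y by (simp add: cinner_simps cinner_smult_left corthogonal_def)
  qed
qed

section \<open>Enclosures as joint invariant subspaces of the Kraus operators\<close>

definition ketbra :: "'n::finite hvec \<Rightarrow> 'n hop" where
  "ketbra x = (\<chi> i j. x $ i * cnj (x $ j))"

lemma ketbra_vec: "ketbra x *v y = cinner x y *s x"
  by (simp add: ketbra_def cinner_def vec_eq_iff matrix_vector_mult_def sum_distrib_left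
      sum_distrib_right algebra_simps)

lemma positive_ketbra: "positive_op (ketbra x)"
proof -
  have "cinner y (ketbra x *v y) = of_real ((norm (cinner x y))\<^sup>2)" for y
    by (simp only: ketbra_vec cinner_smult_right cinner_commute[of x y] complex_norm_square) simp
  then show ?thesis by (simp add: positive_op_def)
qed

text \<open>Turns the definition by supports into invariance under the Kraus operators. Necessity is
  tested on the rank-one operators \<open>ketbra x\<close>. For sufficiency, a positive operator
  supported in \<open>U\<close> has range in \<open>U\<close> and kills the orthogonal complement,
  which the adjoints \<open>cadj (L i)\<close> preserve.\<close>

lemma enclosure_iff:
  "enclosure L U \<longleftrightarrow> vec.subspace U \<and> (\<forall>j. \<forall>x\<in>U. L j *v x \<in> U)"
proof (intro iffI conjI allI ballI)
  assume e: "enclosure L U"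
  then show sub: "vec.subspace U" by (simp add: enclosure_def)
  fix j x assume x: "x \<in> U"
  have "supp (ketbra x) \<subseteq> U"
  proof
    fix z assume z: "z \<in> supp (ketbra x)"
    define y where "y = oproj U *v z"
    have "ketbra x *v (z - y) = 0"
      using cinner_oproj[OF sub, of x z] oproj_fix[OF sub x] by (simp add: ketbra_vec cinner_simps y_def)
    then have "cinner (z - y) z = 0" using z by (simp add: supp_def)
    moreover have "cinner (z - y) y = 0"
      using cinner_oproj[OF sub, of "z - y" z] oproj_idem_vec[OF sub]
      by (simp add: y_def cinner_simps mat_vec_simps)
    ultimately have "z - y = 0"
      by (metis cinner_self_eq_0 bounded_bilinear.diff_right[OF bounded_bilinear_cinner] diff_0_right)
    then show "z \<in> U" using oproj_in[OF sub, of z] by (simp add: y_def)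
  qed
  then have s: "supp (channel L (ketbra x)) \<subseteq> U" using e positive_ketbra[of x] unfolding enclosure_def by blast
  have "L j *v x \<in> supp (channel L (ketbra x))"
    unfolding supp_def
  proof (clarify)
    fix y assume y: "channel L (ketbra x) *v y = 0"
    \<comment> \<open>The form of the channel image vanishes at \<open>y\<close> and is a sum of
      nonnegative terms, so each Kraus term can be read off separately.\<close>
    have "0 = quad (channel L (ketbra x)) y" by (simp add: y cinner_simps)
    also have "\<dots> = (\<Sum>i\<in>UNIV. quad (L i ** ketbra x ** cadj (L i)) y)"
      by (simp add: channel_def mat_vec_simps cinner_simps)
    finally have z: "(\<Sum>i\<in>UNIV. quad (L i ** ketbra x ** cadj (L i)) y) = 0" by simp
    have "quad (L j ** ketbra x ** cadj (L j)) y = 0"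
      using z by (subst (asm) sum_nonneg_eq_0_iff)
        (auto intro!: positive_op_Re positive_op_conj positive_ketbra)
    also have "cinner y ((L j ** ketbra x ** cadj (L j)) *v y) =
        cinner x (cadj (L j) *v y) * cinner (cadj (L j) *v y) x"
      by (simp add: mult_vec cinner_matrix[of y "L j"] ketbra_vec cinner_smult_right)
    also have "\<dots> = of_real ((norm (cinner y (L j *v x)))\<^sup>2)"
      unfolding complex_norm_square cinner_matrix[of y "L j" x]
      by (subst (1) cinner_commute) simp
    finally show "cinner y (L j *v x) = 0" by simp
  qed
  then show "L j *v x \<in> U" using s by auto
next
  assume a: "vec.subspace U \<and> (\<forall>j. \<forall>x\<in>U. L j *v x \<in> U)"
  then have sub: "vec.subspace U" by simp
  show "enclosure L U"
    unfolding enclosure_def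
  proof (intro conjI allI impI sub subsetI)
    fix \<omega> x assume w: "positive_op \<omega> \<and> supp \<omega> \<subseteq> U" and x: "x \<in> supp (channel L \<omega>)"
    have wU: "\<omega> *v z \<in> U" for z
    proof -
      have "\<omega> *v z \<in> supp \<omega>"
        using w by (auto simp: supp_def cinner_matrix positive_op_cadj cinner_simps)
      then show ?thesis using w by auto
    qed
    have wz: "\<omega> *v z = 0" if "\<And>u. u \<in> U \<Longrightarrow> cinner u z = 0" for z
    proof -
      have "cinner (\<omega> *v z) (\<omega> *v z) = cinner (\<omega> *v (\<omega> *v z)) z"
        using w by (simp add: cinner_matrix positive_op_cadj)
      then show ?thesis using that[OF wU] by (simp add: cinner_self_eq_0)
    qed
    define y where "y = x - oproj U *v x"
    have y: "cinner u y = 0" if "u \<in> U" for u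
      using cinner_oproj[OF sub, of u x] oproj_fix[OF sub that] by (simp add: y_def cinner_simps)
    have "channel L \<omega> *v y = 0"
    proof -
      have "\<omega> *v (cadj (L i) *v y) = 0" for i
        by (rule wz) (use a y in \<open>simp add: cinner_matrix\<close>)
      then show ?thesis
        by (simp add: channel_def mat_vec_simps mult_vec)
    qed
    then have "cinner y x = 0" using x by (simp add: supp_def)
    moreover have "cinner y (oproj U *v x) = 0"
      using y[OF oproj_in[OF sub]] by (simp add: cinner_eq_0_commute)
    ultimately have "cinner y y = 0" by (simp add: y_def cinner_simps)
    then show "x \<in> U" using oproj_in[OF sub, of x] by (simp add: cinner_self_eq_0 y_def)
  qed
qed

lemma enclosure_subspace: "enclosure L U \<Longrightarrow> vec.subspace U"
  by (simp add: enclosure_iff)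

lemma enclosure_span:
  assumes "\<And>W. W \<in> F \<Longrightarrow> enclosure L W"
  shows "enclosure L (vec.span (\<Union>F))"
  unfolding enclosure_iff
proof (intro conjI allI ballI)
  show "vec.subspace (vec.span (\<Union>F))" by (rule vec.subspace_span)
  fix j x assume "x \<in> vec.span (\<Union>F)"
  then show "L j *v x \<in> vec.span (\<Union>F)"
  proof (induction rule: vec.span_induct_alt)
    case base then show ?case by (simp add: vec.span_zero)
  next
    case (step c x y)
    then obtain W where "W \<in> F" "x \<in> W" by auto
    then have "L j *v x \<in> \<Union>F" using assms by (auto simp: enclosure_iff)
    then show ?case using step
      by (simp add: mat_vec_simps vec.scale vec.span_add vec.span_scale vec.span_base)
  qed
qed

lemma enclosure_Int: "enclosure L U \<Longrightarrow> enclosure L W \<Longrightarrow> enclosure L (U \<inter> W)"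
  by (simp add: enclosure_iff vec.subspace_inter)

lemma ex_minimal_enclosure:
  assumes "enclosure L U" "U \<noteq> {0}"
  obtains W where "minimal_enclosure L W" "W \<subseteq> U"
  using assms
proof (induction "vec.dim U" arbitrary: U thesis rule: less_induct)
  case less
  show ?case
  proof (cases "minimal_enclosure L U")
    case True
    then show ?thesis using less(2) by blast
  next
    case False
    then obtain W where W: "enclosure L W" "W \<subseteq> U" "W \<noteq> {0}" "W \<noteq> U"
      using less(3,4) by (auto simp: minimal_enclosure_def)
    then have "vec.dim W < vec.dim U"
      using vec.subspace_dim_equal[of W U] less(3) by (auto simp: enclosure_iff not_le[symmetric])
    then obtain W' where "minimal_enclosure L W'" "W' \<subseteq> W"
      using less(1)[of W] W by auto
    then show ?thesis using less(2) W by blast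
  qed
qed

section \<open>Recurrent channels\<close>

locale recurrent_channel =
  fixes L :: "'j::finite \<Rightarrow> 'n::finite hop"
  assumes kraus: "(\<Sum>i\<in>UNIV. cadj (L i) ** L i) = mat 1"
    and recurrent: "fast_recurrent_space L = UNIV"
begin

text \<open>Individual invariant states may be degenerate; recurrence says that their supports span
  jointly, so a vector killed by all of them is orthogonal to the whole space.\<close>

lemma invariant_faithful:
  assumes "\<And>\<omega>. invariant_state L \<omega> \<Longrightarrow> \<omega> *v x = 0"
  shows "x = 0"
proof -
  have "corthogonal (\<Union> (supp ` {\<omega>. invariant_state L \<omega>})) {x}"
    using assms by (auto simp: corthogonal_def supp_def) (metis cinner_eq_0_commute)
  then have "corthogonal (fast_recurrent_space L) {x}"
    unfolding fast_recurrent_space_def by (rule corthogonal_span_left)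
  then have "cinner x x = 0" by (simp add: recurrent corthogonal_def)
  then show ?thesis by (simp add: cinner_self_eq_0)
qed

text \<open>The commutators \<open>K i\<close> satisfy \<open>(\<Sum>i\<in>UNIV. cadj (K i) ** K i)
  = (\<Sum>i\<in>UNIV. cadj (L i) ** p ** L i) - p\<close>, and pairing this difference with an
  invariant state gives zero. So each \<open>K i\<close> vanishes against every invariant state, and
  joint faithfulness forces \<open>K i = 0\<close>.\<close>

lemma oproj_commute:
  assumes "enclosure L U"
  shows "L i ** oproj U = oproj U ** L i"
proof -
  have sub: "vec.subspace U" using assms by (rule enclosure_subspace)
  define p where "p = oproj U"
  define K where "K i = p ** L i - L i ** p" for i
  have pp: "p ** p = p" "cadj p = p" by (simp_all add: p_def oproj_idem oproj_cadj sub)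
  have pLp: "p ** L i ** p = L i ** p" for i
  proof (rule matrix_eqI_vec)
    fix x
    have "L i *v (p *v x) \<in> U"
      using assms oproj_in[OF sub, of x] by (simp add: enclosure_iff p_def)
    then show "(p ** L i ** p) *v x = (L i ** p) *v x"
      by (simp add: mult_vec p_def oproj_fix[OF sub])
  qed
  have pLp': "p ** cadj (L i) ** p = p ** cadj (L i)" for i
    using arg_cong[OF pLp[of i], of cadj] by (simp add: cadj_mult pp matrix_mul_assoc)
  have pp': "X ** p ** p = X ** p" for X :: "'n hop"
    by (simp add: matrix_mul_assoc[symmetric] pp)
  have sumk: "(\<Sum>i\<in>UNIV. X ** cadj (L i) ** L i ** Y) = X ** Y" for X Y :: "'n hop"
    using kraus by (simp add: matrix_mul_assoc[symmetric] matrix_mult_simps(8)[symmetric])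
      (simp add: matrix_mul_assoc matrix_mult_simps(7)[symmetric] matrix_mult_simps(8)[symmetric])
  \<comment> \<open>The factors \<open>mat 1\<close> bring the correction terms into the shape
    \<open>X ** cadj (L i) ** L i ** Y\<close> that \<open>sumk\<close> evaluates.\<close>
  have KK: "cadj (K i) ** K i = cadj (L i) ** p ** L i - p ** cadj (L i) ** L i ** mat 1
     - mat 1 ** cadj (L i) ** L i ** p + p ** cadj (L i) ** L i ** p" for i
  proof -
    have "cadj (L i) ** p ** L i ** p = cadj (L i) ** L i ** p"
      using pLp[of i] by (simp add: matrix_mul_assoc[symmetric])
    then show ?thesis
      by (simp add: K_def cadj_mult cadj_diff pp matrix_mult_simps matrix_mul_assoc pp' pLp')
  qed
  have sumKK: "(\<Sum>i\<in>UNIV. cadj (K i) ** K i) = (\<Sum>i\<in>UNIV. cadj (L i) ** p ** L i) - p"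
    unfolding KK sum.distrib sum_subtractf sumk by (simp add: pp)
  have K0: "K i = 0" for i
  proof -
    have "cadj (K i) *v x = 0" for x
    proof (rule invariant_faithful)
      fix \<omega> assume w: "invariant_state L \<omega>"
      have pos: "positive_op \<omega>" and inv: "channel L \<omega> = \<omega>" using w by (auto simp: invariant_state_def)
      have "(\<Sum>i\<in>UNIV. trace (K i ** \<omega> ** cadj (K i))) = trace ((\<Sum>i\<in>UNIV. cadj (K i) ** K i) ** \<omega>)"
        by (simp add: trace_simps matrix_mult_simps trace_mul_sym[of "K _ ** \<omega>"] matrix_mul_assoc)
      also have "\<dots> = (\<Sum>i\<in>UNIV. trace (cadj (L i) ** p ** L i ** \<omega>)) - trace (p ** \<omega>)"
        by (simp add: sumKK matrix_mult_simps trace_simps)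
      also have "(\<Sum>i\<in>UNIV. trace (cadj (L i) ** p ** L i ** \<omega>)) = trace (p ** channel L \<omega>)"
        by (simp add: channel_def trace_simps matrix_mult_simps matrix_mul_assoc
            trace_mul_sym[of "p ** L _ ** \<omega>"])
      also have "\<dots> = trace (p ** \<omega>)" by (simp add: inv)
      finally have s: "(\<Sum>i\<in>UNIV. Re (trace (K i ** \<omega> ** cadj (K i)))) = 0"
        by (simp add: Re_sum[symmetric])
      have "Re (trace (K i ** \<omega> ** cadj (K i))) = 0"
        using s by (subst (asm) sum_nonneg_eq_0_iff)
          (auto intro!: positive_op_trace(2) positive_op_conj pos)
      then have "K i ** \<omega> ** cadj (K i) = 0"
        by (intro positive_op_trace_0 positive_op_conj pos)
      then have "cinner x ((K i ** \<omega> ** cadj (K i)) *v x) = 0" by (simp add: cinner_simps)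
      then have "cinner (cadj (K i) *v x) (\<omega> *v (cadj (K i) *v x)) = 0"
        by (simp add: mult_vec cinner_matrix[of x "K i"])
      then show "\<omega> *v (cadj (K i) *v x) = 0"
        by (intro positive_op_cinner_zero[OF pos]) simp
    qed
    then have "cadj (K i) = 0" by (intro matrix_eqI_vec) simp
    then have "cadj (cadj (K i)) = cadj 0" by simp
    then show ?thesis by (simp add: vec_eq_iff cadj_def)
  qed
  show ?thesis using K0[of i] by (simp add: K_def p_def)
qed

text \<open>The part of \<open>U\<close> orthogonal to \<open>W\<close>. It is invariant because
  \<open>oproj W\<close> commutes with each \<open>L j\<close>, a consequence of recurrence.\<close>

lemma enclosure_complement:
  assumes "enclosure L U" "enclosure L W"
  shows "enclosure L {x \<in> U. oproj W *v x = 0}"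
proof -
  have "oproj W *v (L j *v x) = L j *v (oproj W *v x)" for j x
    using oproj_commute[OF assms(2), of j] by (simp add: matrix_vector_mul_assoc)
  then show ?thesis
    using assms by (auto simp: enclosure_iff vec.subspace_def mat_vec_simps vec.scale)
qed

text \<open>A minimal enclosure is split off and the induction continues on its orthogonal
  complement in \<open>U\<close>, of smaller dimension. The result is recorded as a sum of
  projections, the form that later splits traces; the family \<open>F\<close> is in general not
  unique.\<close>

lemma minimal_decomposition:
  assumes "enclosure L U"
  obtains F where "finite F" "\<And>W. W \<in> F \<Longrightarrow> minimal_enclosure L W" "\<And>W. W \<in> F \<Longrightarrow> W \<subseteq> U"
    "(\<Sum>W\<in>F. oproj W) = oproj U"
  using assms
proof (induction "vec.dim U" arbitrary: U thesis rule: less_induct)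
  case less
  have sub: "vec.subspace U" using less(3) by (rule enclosure_subspace)
  show ?case
  proof (cases "U = {0}")
    case True
    have "oproj U *v x = 0" for x using oproj_in[OF sub, of x] True by simp
    then have "oproj U = 0" by (intro matrix_eqI_vec) simp
    then show ?thesis using less(2)[of "{}"] by simp
  next
    case False
    then obtain W where W: "minimal_enclosure L W" "W \<subseteq> U"
      using ex_minimal_enclosure less(3) by blast
    then have We: "enclosure L W" and W0: "W \<noteq> {0}" by (auto simp: minimal_enclosure_def)
    have subW: "vec.subspace W" using We by (rule enclosure_subspace)
    define U' where "U' = {x \<in> U. oproj W *v x = 0}"
    have U': "enclosure L U'" unfolding U'_def by (rule enclosure_complement[OF less(3) We])
    have subU': "vec.subspace U'" using U' by (rule enclosure_subspace)
    obtain w where w: "w \<in> W" "w \<noteq> 0" using W0 vec.subspace_0[OF subW] by blast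
    then have "w \<notin> U'" by (simp add: U'_def oproj_fix[OF subW])
    then have "U' \<noteq> U" using w W by auto
    then have "vec.dim U' < vec.dim U"
      using vec.subspace_dim_equal[of U' U] sub subU' by (auto simp: U'_def not_le[symmetric])
    then obtain F where F: "finite F" "\<And>W. W \<in> F \<Longrightarrow> minimal_enclosure L W" "\<And>W. W \<in> F \<Longrightarrow> W \<subseteq> U'"
      "(\<Sum>W\<in>F. oproj W) = oproj U'"
      using less(1)[of U'] U' by metis
    have "W \<notin> F" using F(3) w \<open>w \<notin> U'\<close> by auto
    moreover have "oproj U = oproj W + oproj U'"
    proof (rule matrix_eqI_vec)
      fix x
      define y where "y = oproj U *v x - oproj W *v x"
      have WU: "oproj W *v (oproj U *v x) = oproj W *v x"
        using arg_cong[OF oproj_subset[OF subW sub W(2)], of cadj]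
        by (simp add: cadj_mult oproj_cadj[OF subW] oproj_cadj[OF sub] matrix_vector_mul_assoc)
      have "y \<in> U'"
        using oproj_in[OF sub, of x] oproj_in[OF subW, of x] W(2) vec.subspace_diff[OF sub]
        by (auto simp: U'_def y_def mat_vec_simps WU oproj_idem_vec[OF subW])
      moreover have "oproj U' *v (x - y) = 0"
      proof (subst oproj_eq_0[OF subU'], intro ballI)
        fix u assume u: "u \<in> U'"
        then have "u \<in> U" "oproj W *v u = 0" by (auto simp: U'_def)
        then show "cinner u (x - y) = 0"
          using cinner_oproj[OF sub, of u x] cinner_oproj[OF subW, of u x]
          by (simp add: y_def cinner_simps oproj_fix[OF sub])
      qed
      ultimately have "oproj U' *v x = y"
        by (simp add: mat_vec_simps oproj_fix[OF subU'])
      then show "oproj U *v x = (oproj W + oproj U') *v x"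
        by (simp add: mat_vec_simps y_def)
    qed
    ultimately show ?thesis
      using F W by (intro less(2)[of "insert W F"]) (auto simp: U'_def)
  qed
qed

end

section \<open>Deformed channels and the Perron-Frobenius eigenvalue\<close>

lemma mat_matrix_mult: "mat z ** (A :: 'n::finite hop) = (\<chi> i j. z * A $ i $ j)"
  by (simp add: mat_def matrix_matrix_mult_def vec_eq_iff if_distrib[of "\<lambda>x. x * _"] cong: if_cong)

lemma mat_commute: "mat z ** (A :: 'n::finite hop) = A ** mat z"
  by (simp add: mat_matrix_mult) (simp add: mat_def matrix_matrix_mult_def vec_eq_iff
      if_distrib[of "\<lambda>x. _ * x"] mult.commute cong: if_cong)

lemma mat_of_real_mult: "mat (complex_of_real c) ** (A :: 'n::finite hop) = c *\<^sub>R A"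
  by (simp add: mat_matrix_mult vec_eq_iff) (simp add: scaleR_conv_of_real)

text \<open>The Euclidean product is the real part of the Hilbert-Schmidt product, so orthogonality
  to a range becomes trace duality between the deformed channel and its dual.\<close>

lemma inner_hop: "(A :: 'n::finite hop) \<bullet> B = Re (trace (cadj A ** B))"
proof -
  have "A \<bullet> B = (\<Sum>i\<in>UNIV. \<Sum>j\<in>UNIV. Re (cnj (A $ i $ j) * B $ i $ j))"
    by (simp add: inner_vec_def inner_complex_def)
  also have "\<dots> = (\<Sum>j\<in>UNIV. \<Sum>i\<in>UNIV. Re (cnj (A $ i $ j) * B $ i $ j))"
    by (rule sum.swap)
  also have "\<dots> = Re (trace (cadj A ** B))"
    by (simp add: trace_def matrix_matrix_mult_def cadj_def)
  finally show ?thesis .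
qed

lemma block_iff:
  assumes "vec.subspace U"
  shows "\<sigma> \<in> block U \<longleftrightarrow> oproj U ** \<sigma> ** oproj U = \<sigma>"
proof -
  have "oproj U ** (oproj U ** \<sigma> ** oproj U) ** oproj U = oproj U ** \<sigma> ** oproj U" for \<sigma>
    by (simp add: matrix_mul_assoc oproj_idem[OF assms])
       (simp add: matrix_mul_assoc[symmetric] oproj_idem[OF assms])
  then show ?thesis unfolding block_def by (auto simp: image_iff) (metis)
qed

lemma block_mult:
  assumes "vec.subspace U" "\<sigma> \<in> block U"
  shows "oproj U ** \<sigma> = \<sigma>" "\<sigma> ** oproj U = \<sigma>"
proof -
  have s: "oproj U ** \<sigma> ** oproj U = \<sigma>" using assms by (simp add: block_iff)
  have "oproj U ** (oproj U ** \<sigma> ** oproj U) = oproj U ** \<sigma> ** oproj U"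
    by (simp add: matrix_mul_assoc oproj_idem[OF assms(1)])
  then show "oproj U ** \<sigma> = \<sigma>" by (simp add: s)
  have "(oproj U ** \<sigma> ** oproj U) ** oproj U = oproj U ** \<sigma> ** oproj U"
    by (simp add: matrix_mul_assoc[symmetric] oproj_idem[OF assms(1)])
  then show "\<sigma> ** oproj U = \<sigma>" by (simp add: s)
qed

lemma subspace_block: "subspace (block U)"
  unfolding block_def
  by (auto simp: subspace_def image_iff matrix_mult_simps)
     (metis matrix_mult_simps(1,2), metis matrix_mult_simps(3,4), metis matrix_mult_simps(9,10))

lemma positive_op_trace_scaleR:
  assumes "positive_op M"
  shows "trace (c *\<^sub>R M) = complex_of_real (c * Re (trace M))"
  using positive_op_trace(1)[OF assms] trace_simps(5)[of c M] by (simp add: scaleR_conv_of_real)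

lemma norm_sgn_scaleR:
  assumes "x \<noteq> 0"
  shows "x = norm x *\<^sub>R sgn x"
  using assms by (simp add: sgn_div_norm)

lemma compact_states:
  assumes "vec.subspace (U :: 'n::finite hvec set)"
  shows "compact {h :: 'n hop. positive_op h \<and> h \<in> block U \<and> trace h = 1}"
proof -
  define S where "S = {h :: 'n hop. positive_op h} \<inter> {h. oproj U ** h ** oproj U = h} \<inter> {h. trace h = 1}"
  have S: "S = {h. positive_op h \<and> h \<in> block U \<and> trace h = 1}"
    by (auto simp: S_def block_iff[OF assms])
  have "closed S"
    unfolding S_def by (intro closed_Int closed_positive_op closed_Collect_eq continuous_intros)
  moreover have "bounded S"
    unfolding bounded_iff using positive_op_norm_le by (intro exI[of _ "2 * real CARD('n) * real CARD('n)"])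
      (force simp: S)
  ultimately show ?thesis by (simp add: compact_eq_bounded_closed S)
qed

locale deformed_walk = recurrent_channel L
  for L :: "'j::finite \<Rightarrow> 'n::finite hop" +
  fixes s :: "'j \<Rightarrow> real ^ 'd::finite"
begin

text \<open>The trace dual of the deformed channel. Its positive eigenvectors are quadratic forms,
  which can be followed along the vectors \<open>path_op L a *v x\<close>.\<close>

definition dual_deformed :: "real ^ 'd \<Rightarrow> 'n hop \<Rightarrow> 'n hop" where
  "dual_deformed u h = (\<Sum>i\<in>UNIV. exp (u \<bullet> s i) *\<^sub>R (cadj (L i) ** h ** L i))"

text \<open>Definiteness on \<open>U\<close> is what identifies \<open>l\<close>: on a nonzero
  enclosure it makes \<open>l\<close> positive and equal to the spectral radius.\<close>

definition perron_form :: "'n hvec set \<Rightarrow> real ^ 'd \<Rightarrow> 'n hop \<Rightarrow> real \<Rightarrow> bool" where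
  "perron_form U u h l \<longleftrightarrow> positive_op h \<and> h \<in> block U \<and> (\<forall>x\<in>U. h *v x = 0 \<longrightarrow> x = 0) \<and>
     dual_deformed u h = l *\<^sub>R h"

abbreviation "radius \<equiv> deformed_radius s L"

lemma cinner_dual_deformed:
  "cinner x (dual_deformed u h *v y) =
     (\<Sum>i\<in>UNIV. of_real (exp (u \<bullet> s i)) * cinner (L i *v x) (h *v (L i *v y)))"
proof -
  have "cinner x ((exp (u \<bullet> s i) *\<^sub>R (cadj (L i) ** h ** L i)) *v y) =
      exp (u \<bullet> s i) *\<^sub>R cinner (L i *v x) (h *v (L i *v y))" for i
    by (simp add: mat_vec_simps cinner_simps mult_vec cinner_matrix_left)
  then show ?thesis
    by (simp add: dual_deformed_def mat_vec_simps(5) cinner_simps(8)) (simp add: scaleR_conv_of_real)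
qed

lemma Re_cinner_dual_deformed:
  "quad (dual_deformed u h) x =
     (\<Sum>i\<in>UNIV. exp (u \<bullet> s i) * quad h (L i *v x))"
  by (simp add: cinner_dual_deformed)

lemma sum_norm_kraus: "(\<Sum>i\<in>UNIV. (norm (L i *v x))\<^sup>2) = (norm x)\<^sup>2"
proof -
  have "complex_of_real (\<Sum>i\<in>UNIV. (norm (L i *v x))\<^sup>2) = (\<Sum>i\<in>UNIV. cinner x ((cadj (L i) ** L i) *v x))"
    unfolding of_real_sum cinner_self[symmetric]
    by (simp add: mult_vec cinner_matrix_left)
  also have "\<dots> = cinner x x"
    by (simp add: cinner_simps(8)[symmetric] mat_vec_simps(5)[symmetric] kraus)
  also have "\<dots> = complex_of_real ((norm x)\<^sup>2)" by (rule cinner_self)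
  finally show ?thesis by (simp only: of_real_eq_iff)
qed

lemma positive_dual_deformed: "positive_op h \<Longrightarrow> positive_op (dual_deformed u h)"
  unfolding dual_deformed_def by (intro positive_op_sum positive_op_scaleR positive_op_conj') auto

lemma oproj_commute_cadj:
  assumes "enclosure L U"
  shows "cadj (L i) ** oproj U = oproj U ** cadj (L i)"
  using arg_cong[OF oproj_commute[OF assms, of i], of cadj] oproj_cadj[OF enclosure_subspace[OF assms]]
  by (simp add: cadj_mult)

lemma block_conj:
  assumes "enclosure L U" "\<sigma> \<in> block U"
  shows "L i ** \<sigma> ** cadj (L i) \<in> block U" "cadj (L i) ** \<sigma> ** L i \<in> block U"
proof -
  have sub: "vec.subspace U" using assms(1) by (rule enclosure_subspace)
  let ?p = "oproj U"
  have "?p ** (L i ** \<sigma> ** cadj (L i)) ** ?p = (?p ** L i) ** \<sigma> ** (cadj (L i) ** ?p)"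
    by (simp add: matrix_mul_assoc)
  also have "\<dots> = L i ** (?p ** \<sigma> ** ?p) ** cadj (L i)"
    by (simp only: oproj_commute[OF assms(1), symmetric] oproj_commute_cadj[OF assms(1)] matrix_mul_assoc)
  finally show "L i ** \<sigma> ** cadj (L i) \<in> block U" using assms(2) by (simp add: block_iff[OF sub])
  have "?p ** (cadj (L i) ** \<sigma> ** L i) ** ?p = (?p ** cadj (L i)) ** \<sigma> ** (L i ** ?p)"
    by (simp add: matrix_mul_assoc)
  also have "\<dots> = cadj (L i) ** (?p ** \<sigma> ** ?p) ** L i"
    by (simp only: oproj_commute[OF assms(1)] oproj_commute_cadj[OF assms(1), symmetric] matrix_mul_assoc)
  finally show "cadj (L i) ** \<sigma> ** L i \<in> block U" using assms(2) by (simp add: block_iff[OF sub])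
qed

lemma dual_deformed_block:
  assumes "enclosure L U" "\<sigma> \<in> block U"
  shows "dual_deformed u \<sigma> \<in> block U"
  unfolding dual_deformed_def
  by (intro subspace_sum subspace_scale subspace_block block_conj assms)

lemma deformed_channel_block:
  assumes "enclosure L U" "\<sigma> \<in> block U"
  shows "deformed_channel s L u \<sigma> \<in> block U"
  unfolding deformed_channel_def
  by (intro subspace_sum subspace_scale subspace_block block_conj assms)

lemma mat_block:
  assumes "vec.subspace U" "\<sigma> \<in> block U"
  shows "mat z ** \<sigma> \<in> block U"
proof -
  have "oproj U ** (mat z ** \<sigma>) ** oproj U = mat z ** (oproj U ** \<sigma> ** oproj U)"
    by (simp add: matrix_mul_assoc) (simp add: mat_commute[of z "oproj U", symmetric] matrix_mul_assoc)
  then show ?thesis using assms by (simp add: block_iff)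
qed

section \<open>Perron eigenvectors and the spectral radius\<close>

lemma trace_dual_deformed:
  "trace (h ** deformed_channel s L u \<sigma>) = trace (dual_deformed u h ** \<sigma>)"
  by (simp add: deformed_channel_def dual_deformed_def matrix_mult_simps trace_simps matrix_mul_assoc
      trace_mul_sym[of "h ** L _ ** \<sigma>"])

text \<open>The kernel of \<open>h\<close> in \<open>W\<close> is invariant, hence an enclosure
  inside a minimal one. It is not all of \<open>W\<close>, because \<open>h\<close> is nonzero and
  lives in the block of \<open>W\<close>; so it is trivial.\<close>

lemma minimal_block_definite:
  assumes W: "minimal_enclosure L W" and h: "h \<in> block W" "h \<noteq> 0"
    and inv: "\<And>x i. x \<in> W \<Longrightarrow> h *v x = 0 \<Longrightarrow> h *v (L i *v x) = 0"
    and x: "x \<in> W" "h *v x = 0"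
  shows "x = 0"
proof -
  have e: "enclosure L W" using W by (simp add: minimal_enclosure_def)
  then have sub: "vec.subspace W" by (rule enclosure_subspace)
  let ?K = "{x \<in> W. h *v x = 0}"
  have "enclosure L ?K"
    using e inv by (auto simp: enclosure_iff vec.subspace_def mat_vec_simps vec.scale)
  then have "?K = {0} \<or> ?K = W" using W by (auto simp: minimal_enclosure_def)
  moreover have "?K \<noteq> W"
  proof
    assume K: "?K = W"
    have "h = 0"
    proof (rule matrix_eqI_vec)
      fix y
      have "h *v y = h *v (oproj W *v y)"
        using block_mult(2)[OF sub h(1)] by (simp add: matrix_vector_mul_assoc)
      also have "\<dots> = 0" using K oproj_in[OF sub, of y] by auto
      finally show "h *v y = 0 *v y" by simp
    qed
    then show False using h by simp
  qed
  ultimately show ?thesis using x by auto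
qed

text \<open>At a vector \<open>x\<close> of the kernel the eigen equation is a vanishing sum of the
  nonnegative terms \<open>exp (u \<bullet> s i) * quad h (L i *v x)\<close>; so the kernel is
  invariant and minimality applies.\<close>

lemma minimal_perron_form:
  assumes W: "minimal_enclosure L W" and h: "positive_op h" "h \<in> block W" "h \<noteq> 0"
    and eig: "dual_deformed u h = l *\<^sub>R h"
  shows "perron_form W u h l"
  unfolding perron_form_def
proof (intro conjI h eig ballI impI)
  fix x assume x: "x \<in> W" "h *v x = 0"
  show "x = 0"
  proof (rule minimal_block_definite[OF W h(2,3) _ x])
    fix x i assume x: "x \<in> W" "h *v x = 0"
    have "quad (dual_deformed u h) x = 0" by (simp add: eig mat_vec_simps x cinner_simps)
    then have "(\<Sum>i\<in>UNIV. exp (u \<bullet> s i) * quad h (L i *v x)) = 0"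
      by (simp add: Re_cinner_dual_deformed)
    then have "exp (u \<bullet> s i) * quad h (L i *v x) = 0"
      by (subst (asm) sum_nonneg_eq_0_iff) (auto simp: positive_op_Re[OF h(1)])
    then show "h *v (L i *v x) = 0" by (intro positive_op_cinner_zero[OF h(1)]) simp
  qed
qed

text \<open>The map handed to Brouwer is the dual deformed channel divided by the trace
  \<open>t h\<close> of its value, on the compact convex set of positive block elements of trace
  one. A fixed point has eigenvalue \<open>t h\<close>, and minimality makes it definite.\<close>

lemma ex_perron_form:
  assumes W: "minimal_enclosure L W"
  obtains h l where "perron_form W u h l"
proof -
  have e: "enclosure L W" and W0: "W \<noteq> {0}" using W by (auto simp: minimal_enclosure_def)
  have sub: "vec.subspace W" using e by (rule enclosure_subspace)
  obtain w where w: "w \<in> W" "w \<noteq> 0" using W0 vec.subspace_0[OF sub] by blast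
  define S where "S = {h :: 'n hop. positive_op h \<and> h \<in> block W \<and> trace h = 1}"
  have S: "h \<in> S \<longleftrightarrow> positive_op h \<and> h \<in> block W \<and> trace h = 1" for h
    by (auto simp: S_def)
  have comp: "compact S" unfolding S_def by (rule compact_states[OF sub])
  have conv: "convex S"
  proof (rule convexI)
    fix x y and a b :: real assume xy: "x \<in> S" "y \<in> S" and ab: "0 \<le> a" "0 \<le> b" "a + b = 1"
    have "trace (a *\<^sub>R x + b *\<^sub>R y) = complex_of_real (a + b)"
      using xy by (simp add: S trace_simps) (simp add: scaleR_conv_of_real)
    then show "a *\<^sub>R x + b *\<^sub>R y \<in> S"
      using xy ab by (simp add: S positive_op_add positive_op_scaleR subspace_add subspace_scale subspace_block)
  qed
  have "oproj W \<noteq> 0" using oproj_fix[OF sub w(1)] w(2) by auto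
  then have tp: "0 < Re (trace (oproj W))" by (intro positive_op_trace_pos positive_oproj sub)
  have "(1 / Re (trace (oproj W))) *\<^sub>R oproj W \<in> S"
  proof -
    have "oproj W \<in> block W"
      by (simp add: block_iff[OF sub] oproj_idem[OF sub])
    moreover have "trace ((1 / Re (trace (oproj W))) *\<^sub>R oproj W) =
        complex_of_real (1 / Re (trace (oproj W)) * Re (trace (oproj W)))"
      by (rule positive_op_trace_scaleR[OF positive_oproj[OF sub]])
    ultimately show ?thesis
      using tp by (simp add: S positive_op_scaleR positive_oproj[OF sub] subspace_scale[OF subspace_block])
  qed
  then have ne: "S \<noteq> {}" by auto
  define t where "t h = Re (trace (dual_deformed u h))" for h
  \<comment> \<open>If the trace vanished, \<open>h\<close> would kill the range of every
    \<open>L i\<close>. Its kernel in \<open>W\<close> is then invariant, so trivial, which forces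
    \<open>L i *v w = 0\<close> for all \<open>i\<close>, against the normalisation of the Kraus
    operators.\<close>
  have tpos: "t h > 0" if h: "h \<in> S" for h
  proof (rule ccontr)
    have hp: "positive_op h" "h \<in> block W" and h0: "h \<noteq> 0" using h by (auto simp: S trace_simps)
    assume "\<not> t h > 0"
    then have "t h = 0"
      using positive_op_trace(2)[OF positive_dual_deformed[OF hp(1), of u]] by (simp add: t_def)
    then have d0: "dual_deformed u h = 0"
      unfolding t_def by (intro positive_op_trace_0 positive_dual_deformed hp)
    have hL: "h *v (L i *v x) = 0" for i x
    proof -
      have "(\<Sum>i\<in>UNIV. exp (u \<bullet> s i) * quad h (L i *v x)) = 0"
        by (subst Re_cinner_dual_deformed[symmetric]) (simp add: d0 cinner_simps)
      then have "exp (u \<bullet> s i) * quad h (L i *v x) = 0"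
        by (subst (asm) sum_nonneg_eq_0_iff) (auto simp: positive_op_Re[OF hp(1)])
      then show ?thesis by (intro positive_op_cinner_zero[OF hp(1)]) simp
    qed
    have "L i *v w = 0" for i
      by (rule minimal_block_definite[OF W hp(2) h0 _ _ hL]) (use hL e w in \<open>auto simp: enclosure_iff\<close>)
    then show False using sum_norm_kraus[of w] w by simp
  qed
  have cont_d: "continuous_on S (dual_deformed u)"
    unfolding dual_deformed_def[abs_def] by (intro continuous_intros)
  have cont: "continuous_on S (\<lambda>h. (1 / t h) *\<^sub>R dual_deformed u h)"
    unfolding t_def using tpos by (intro continuous_intros cont_d) (force simp: t_def)
  have maps: "(\<lambda>h. (1 / t h) *\<^sub>R dual_deformed u h) \<in> S \<rightarrow> S"
  proof
    fix h assume h: "h \<in> S"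
    have "trace ((1 / t h) *\<^sub>R dual_deformed u h) = complex_of_real (1 / t h * t h)"
      unfolding t_def using h by (intro positive_op_trace_scaleR positive_dual_deformed) (simp add: S)
    then show "(1 / t h) *\<^sub>R dual_deformed u h \<in> S"
      using h tpos[OF h] by (simp add: S positive_op_scaleR positive_dual_deformed
          subspace_scale[OF subspace_block] dual_deformed_block[OF e])
  qed
  obtain h where h: "h \<in> S" "(1 / t h) *\<^sub>R dual_deformed u h = h"
    using brouwer[OF comp conv ne cont maps] by metis
  have "t h *\<^sub>R ((1 / t h) *\<^sub>R dual_deformed u h) = t h *\<^sub>R h" using h by simp
  then have eig: "dual_deformed u h = t h *\<^sub>R h" using tpos[OF h(1)] by simp
  have "perron_form W u h (t h)"
    using h(1) by (intro minimal_perron_form[OF W _ _ _ eig]) (auto simp: S trace_simps)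
  then show ?thesis by (rule that)
qed

text \<open>Extreme values on the compact unit sphere of \<open>U\<close>. The maximiser
  \<open>z\<close> is handed out too: comparing the eigen equation at \<open>z\<close> with the
  bound \<open>M\<close> elsewhere leaves no multiplicative constant.\<close>

lemma form_bounds:
  assumes sub: "vec.subspace U" and U0: "U \<noteq> {0}" and h: "positive_op h"
    and def: "\<And>x. x \<in> U \<Longrightarrow> h *v x = 0 \<Longrightarrow> x = 0"
  obtains m M z where "0 < m" "0 < M" "z \<in> U" "norm z = 1" "quad h z = M"
    "\<And>x. x \<in> U \<Longrightarrow> m * (norm x)\<^sup>2 \<le> quad h x"
    "\<And>x. x \<in> U \<Longrightarrow> quad h x \<le> M * (norm x)\<^sup>2"
proof -
  let ?S = "U \<inter> sphere 0 1"
  let ?q = "\<lambda>x. quad h x"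
  have rsub: "subspace U" using sub by (rule subspace_of_vec_subspace)
  have comp: "compact ?S" by (intro closed_Int_compact closed_subspace rsub compact_sphere)
  obtain w where w: "w \<in> U" "w \<noteq> 0" using U0 vec.subspace_0[OF sub] by blast
  have "sgn w \<in> ?S" using w rsub by (simp add: sgn_div_norm subspace_scale)
  then have ne: "?S \<noteq> {}" by blast
  have cont: "continuous_on ?S ?q" by (intro continuous_intros)
  obtain y where y: "y \<in> ?S" "\<forall>x\<in>?S. ?q y \<le> ?q x"
    using continuous_attains_inf[OF comp ne cont] by metis
  obtain z where z: "z \<in> ?S" "\<forall>x\<in>?S. ?q x \<le> ?q z"
    using continuous_attains_sup[OF comp ne cont] by metis
  have pos: "0 < ?q x" if "x \<in> ?S" for x
  proof -
    have "x \<noteq> 0" "x \<in> U" using that by auto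
    then have "?q x \<noteq> 0" using def positive_op_cinner_zero[OF h] by blast
    then show ?thesis using positive_op_Re[OF h, of x] by simp
  qed
  have sc: "?q x = ?q (sgn x) * (norm x)\<^sup>2" for x
    by (cases "x = 0") (simp_all add: sgn_div_norm cinner_simps mat_vec_simps power2_eq_square field_simps)
  have S: "sgn x \<in> ?S" if "x \<in> U" "x \<noteq> 0" for x
    using that rsub by (simp add: sgn_div_norm subspace_scale)
  show ?thesis
  proof (rule that[of "?q y" "?q z" z])
    show "0 < ?q y" "0 < ?q z" "z \<in> U" "norm z = 1" using pos y z by auto
    fix x assume x: "x \<in> U"
    show "?q y * (norm x)\<^sup>2 \<le> ?q x" using y(2) S[OF x] by (cases "x = 0") (auto simp: sc[of x] cinner_simps intro!: mult_right_mono)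
    show "?q x \<le> ?q z * (norm x)\<^sup>2" using z(2) S[OF x] by (cases "x = 0") (auto simp: sc[of x] cinner_simps intro!: mult_right_mono)
  qed simp
qed

text \<open>Both bounds come from the eigen equation at the maximiser \<open>z\<close>. For the
  upper one, \<open>quad h (L i *v z)\<close> is at most
  \<open>M * (norm (L i *v z))\<^sup>2\<close> and these squared norms sum to one; for the lower
  one, some \<open>L i *v z\<close> is nonzero. The upper bound later makes the sublevel sets of the
  rate bounded.\<close>

lemma perron_form_bounds:
  assumes e: "enclosure L U" and U0: "U \<noteq> {0}" and h: "perron_form U u h l"
  shows "0 < l" "l \<le> exp (norm u * (\<Sum>i\<in>UNIV. norm (s i)))"
proof -
  have sub: "vec.subspace U" using e by (rule enclosure_subspace)
  have hp: "positive_op h" and def: "\<And>x. x \<in> U \<Longrightarrow> h *v x = 0 \<Longrightarrow> x = 0"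
    and eig: "dual_deformed u h = l *\<^sub>R h" using h by (auto simp: perron_form_def)
  obtain m M z where b: "0 < m" "0 < M" "z \<in> U" "norm z = 1" "quad h z = M"
    "\<And>x. x \<in> U \<Longrightarrow> m * (norm x)\<^sup>2 \<le> quad h x"
    "\<And>x. x \<in> U \<Longrightarrow> quad h x \<le> M * (norm x)\<^sup>2"
    using form_bounds[OF sub U0 hp def] by metis
  have lM: "l * M = (\<Sum>i\<in>UNIV. exp (u \<bullet> s i) * quad h (L i *v z))"
    by (subst Re_cinner_dual_deformed[symmetric]) (simp add: eig mat_vec_simps cinner_simps b)
  have Lz: "L i *v z \<in> U" for i using e b by (simp add: enclosure_iff)
  let ?C = "\<Sum>i\<in>UNIV. norm (s i)"
  have us: "u \<bullet> s i \<le> norm u * ?C" for i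
    by (rule order_trans[OF norm_cauchy_schwarz])
       (intro mult_left_mono member_le_sum, auto)
  have "l * M \<le> (\<Sum>i\<in>UNIV. exp (norm u * ?C) * (M * (norm (L i *v z))\<^sup>2))"
    unfolding lM by (intro sum_mono mult_mono) (use us b(7)[OF Lz] positive_op_Re[OF hp] in auto)
  also have "\<dots> = exp (norm u * ?C) * M"
    by (simp add: sum_distrib_left[symmetric] sum_norm_kraus b)
  finally show "l \<le> exp (norm u * ?C)" using b by simp
  have "0 < (\<Sum>i\<in>UNIV. exp (u \<bullet> s i) * quad h (L i *v z))"
  proof -
    obtain i where i: "L i *v z \<noteq> 0"
    proof (rule ccontr)
      assume "\<not> thesis"
      then have "L i *v z = 0" for i using that by blast
      then show False using sum_norm_kraus[of z] b(4) by simp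
    qed
    have "0 < m * (norm (L i *v z))\<^sup>2" using i b by simp
    then have "0 < quad h (L i *v z)" using b(6)[OF Lz[of i]] by linarith
    then show ?thesis by (intro sum_pos2[of UNIV i]) (auto simp: positive_op_Re[OF hp])
  qed
  then have "0 < l * M" by (simp only: lM)
  then show "0 < l" using b(2) by (rule zero_less_mult_pos2)
qed

text \<open>\<open>b\<close> is measured as a sesquilinear form against the norm \<open>N\<close>
  induced by \<open>h\<close>. At a pair \<open>(x, y)\<close> where this ratio is maximal, the
  eigen equation of \<open>b\<close> bounds \<open>cmod z\<close> times the maximum by a weighted
  sum of the same maximum, and the eigen equation of \<open>h\<close> evaluates that sum to
  \<open>l\<close> times the maximum. Since \<open>b\<close> is not assumed positive, complex
  \<open>z\<close> are covered.\<close>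

lemma dual_eigenvalue_le:
  assumes e: "enclosure L U" and U0: "U \<noteq> {0}" and h: "perron_form U u h l"
    and b: "b \<in> block U" "b \<noteq> 0" "dual_deformed u b = mat z ** b"
  shows "cmod z \<le> l"
proof -
  have sub: "vec.subspace U" using e by (rule enclosure_subspace)
  have rsub: "subspace U" using sub by (rule subspace_of_vec_subspace)
  have hp: "positive_op h" and def: "\<And>x. x \<in> U \<Longrightarrow> h *v x = 0 \<Longrightarrow> x = 0"
    and eig: "dual_deformed u h = l *\<^sub>R h" using h by (auto simp: perron_form_def)
  define N where "N x = sqrt (quad h x)" for x
  have N2: "(N x)\<^sup>2 = quad h x" for x by (simp add: N_def positive_op_Re[OF hp])
  have N0: "0 \<le> N x" for x by (simp add: N_def positive_op_Re[OF hp])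
  have Np: "0 < N x" if "x \<in> U" "x \<noteq> 0" for x
  proof -
    have "N x \<noteq> 0" using that def positive_op_cinner_zero[OF hp, of x] N2[of x] by force
    then show ?thesis using N0[of x] by simp
  qed
  let ?S = "U \<inter> sphere 0 1"
  have comp: "compact ?S" by (intro closed_Int_compact closed_subspace rsub compact_sphere)
  obtain w where w: "w \<in> U" "w \<noteq> 0" using U0 vec.subspace_0[OF sub] by blast
  have "sgn w \<in> ?S" using w rsub by (simp add: sgn_div_norm subspace_scale)
  then have ne: "?S \<times> ?S \<noteq> {}" by blast
  let ?R = "\<lambda>xy. cmod (cinner (fst xy) (b *v snd xy)) / (N (fst xy) * N (snd xy))"
  have cont: "continuous_on (?S \<times> ?S) ?R"
    unfolding N_def by (intro continuous_intros) (use Np in \<open>force simp: N_def\<close>)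
  obtain xy where "xy \<in> ?S \<times> ?S" and mx: "\<And>v. v \<in> ?S \<times> ?S \<Longrightarrow> ?R v \<le> ?R xy"
    using continuous_attains_sup[OF compact_Times[OF comp comp] ne cont] by blast
  moreover obtain x y where xy: "xy = (x, y)" by (cases xy)
  ultimately have x: "x \<in> U" "norm x = 1" and y: "y \<in> U" "norm y = 1" by auto
  define M where "M = ?R (x, y)"
  have x0: "x \<noteq> 0" and y0: "y \<noteq> 0" using x y by auto
  have Msup: "cmod (cinner v (b *v w)) \<le> M * N v * N w" if v: "v \<in> U" and w: "w \<in> U" for v w
  proof (cases "v = 0 \<or> w = 0")
    case True
    then show ?thesis by (auto simp: cinner_simps N_def)
  next
    case False
    have Nsc: "N v = norm v * N (sgn v)" for v
    proof -
      have "N (norm v *\<^sub>R sgn v) = norm v * N (sgn v)"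
        unfolding N_def by (simp add: cinner_simps mat_vec_simps mult.assoc[symmetric] real_sqrt_mult)
      then show ?thesis by (cases "v = 0") (auto simp: norm_sgn_scaleR[symmetric] N_def cinner_simps)
    qed
    have sS: "sgn v \<in> ?S" "sgn w \<in> ?S" using False v w rsub by (auto simp: sgn_div_norm subspace_scale)
    have "?R (sgn v, sgn w) \<le> M" using mx[of "(sgn v, sgn w)"] sS by (simp add: M_def xy)
    then have "cmod (cinner (sgn v) (b *v sgn w)) \<le> M * (N (sgn v) * N (sgn w))"
      using Np[of "sgn v"] Np[of "sgn w"] sS False by (simp add: field_simps sgn_zero_iff)
    then have "(norm v * norm w) * cmod (cinner (sgn v) (b *v sgn w)) \<le> (norm v * norm w) * (M * (N (sgn v) * N (sgn w)))"
      by (intro mult_left_mono) auto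
    also have "\<dots> = M * N v * N w" by (simp add: Nsc[of v] Nsc[of w])
    also have "(norm v * norm w) * cmod (cinner (sgn v) (b *v sgn w)) = cmod (cinner v (b *v w))"
      using False by (simp add: sgn_div_norm cinner_simps mat_vec_simps field_simps)
    finally show ?thesis .
  qed
  have Mp: "0 < M"
  proof (rule ccontr)
    assume M: "\<not> 0 < M"
    have z: "cinner v (b *v w) = 0" if "v \<in> U" "w \<in> U" for v w
    proof -
      have "M * N v * N w \<le> 0" using M N0[of v] N0[of w]
        by (simp add: mult_nonpos_nonneg mult_nonneg_nonneg)
      then show ?thesis using Msup[OF that] by (metis norm_le_zero_iff order_trans)
    qed
    have "b = 0"
    proof (rule matrix_eqI_vec)
      fix v
      have bv: "b *v v = oproj U *v (b *v (oproj U *v v))"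
        using b(1) by (simp add: matrix_vector_mul_assoc matrix_mul_assoc block_iff[OF sub])
      have bU: "b *v v \<in> U" by (subst bv) (rule oproj_in[OF sub])
      have "cinner (b *v v) (b *v v) = cinner (b *v v) (b *v (oproj U *v v))"
        using block_mult(2)[OF sub b(1)] by (simp add: matrix_vector_mul_assoc)
      also have "\<dots> = 0" by (rule z[OF bU oproj_in[OF sub]])
      finally show "b *v v = 0 *v v" by (simp add: cinner_self_eq_0)
    qed
    then show False using b by simp
  qed
  define \<alpha> \<beta> where "\<alpha> = N x" and "\<beta> = N y"
  have ab: "0 < \<alpha>" "0 < \<beta>" using Np x y x0 y0 by (auto simp: \<alpha>_def \<beta>_def)
  have Lx: "L i *v x \<in> U" and Ly: "L i *v y \<in> U" for i using e x y by (auto simp: enclosure_iff)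
  have eN: "(\<Sum>i\<in>UNIV. exp (u \<bullet> s i) * (N (L i *v v))\<^sup>2) = l * (N v)\<^sup>2" for v
    unfolding N2 by (subst Re_cinner_dual_deformed[symmetric]) (simp add: eig mat_vec_simps cinner_simps)
  have "cmod z * cmod (cinner x (b *v y)) = cmod (cinner x (dual_deformed u b *v y))"
  proof -
    have "(mat z ** b) *v y = z *s (b *v y)"
      by (simp add: mat_matrix_mult matrix_vector_mult_def vec_eq_iff sum_distrib_left mult.assoc)
    then show ?thesis by (simp add: b(3) cinner_smult_right norm_mult)
  qed
  also have "\<dots> \<le> (\<Sum>i\<in>UNIV. exp (u \<bullet> s i) * cmod (cinner (L i *v x) (b *v (L i *v y))))"
    unfolding cinner_dual_deformed by (rule order_trans[OF norm_sum]) (simp add: norm_mult)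
  \<comment> \<open>Scaling by \<open>\<alpha>\<close> and \<open>\<beta>\<close> balances the
    arithmetic-geometric inequality: after summation each of the two scaled squares contributes
    exactly \<open>l\<close>.\<close>
  also have "\<dots> \<le> (\<Sum>i\<in>UNIV. exp (u \<bullet> s i) * (M * (\<alpha> * \<beta>) / 2 *
      ((N (L i *v x))\<^sup>2 / \<alpha>\<^sup>2 + (N (L i *v y))\<^sup>2 / \<beta>\<^sup>2)))"
  proof (intro sum_mono mult_left_mono)
    fix i
    let ?a = "N (L i *v x)" let ?b = "N (L i *v y)"
    have "2 * (?a / \<alpha>) * (?b / \<beta>) \<le> (?a / \<alpha>)\<^sup>2 + (?b / \<beta>)\<^sup>2"
      using sum_squares_bound by blast
    then have "M * (\<alpha> * \<beta>) / 2 * (2 * (?a / \<alpha>) * (?b / \<beta>)) \<le> M * (\<alpha> * \<beta>) / 2 * ((?a / \<alpha>)\<^sup>2 + (?b / \<beta>)\<^sup>2)"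
      using Mp ab by (intro mult_left_mono) auto
    moreover have "M * (\<alpha> * \<beta>) / 2 * (2 * (?a / \<alpha>) * (?b / \<beta>)) = M * ?a * ?b"
      using ab by simp
    ultimately show "cmod (cinner (L i *v x) (b *v (L i *v y))) \<le> M * (\<alpha> * \<beta>) / 2 * (?a\<^sup>2 / \<alpha>\<^sup>2 + ?b\<^sup>2 / \<beta>\<^sup>2)"
      using Msup[OF Lx[of i] Ly[of i]] by (simp add: power_divide)
  qed auto
  also have "\<dots> = M * (\<alpha> * \<beta>) / 2 * ((\<Sum>i\<in>UNIV. exp (u \<bullet> s i) * (N (L i *v x))\<^sup>2) / \<alpha>\<^sup>2
      + (\<Sum>i\<in>UNIV. exp (u \<bullet> s i) * (N (L i *v y))\<^sup>2) / \<beta>\<^sup>2)"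
    by (simp add: sum_divide_distrib sum.distrib[symmetric] sum_distrib_left algebra_simps)
  also have "\<dots> = l * (M * (\<alpha> * \<beta>))"
    unfolding eN using ab by (simp add: \<alpha>_def \<beta>_def)
  also have Mc: "M * (\<alpha> * \<beta>) = cmod (cinner x (b *v y))"
    using ab by (simp add: M_def \<alpha>_def \<beta>_def)
  finally have "cmod z * cmod (cinner x (b *v y)) \<le> l * cmod (cinner x (b *v y))" .
  moreover have "0 < cmod (cinner x (b *v y))"
    unfolding Mc[symmetric] by (intro mult_pos_pos Mp ab)
  ultimately show ?thesis by (rule mult_right_le_imp_le)
qed

text \<open>In finite dimension a spectral value destroys surjectivity. A nonzero \<open>b\<close>
  in the block orthogonal to the range is an eigenvector of the dual with eigenvalue
  \<open>cnj z\<close>, and the bound for dual eigenvectors applies.\<close>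

lemma op_spectrum_le:
  assumes e: "enclosure L U" and U0: "U \<noteq> {0}" and h: "perron_form U u h l"
    and z: "z \<in> op_spectrum (block U) (deformed_channel s L u)"
  shows "cmod z \<le> l"
proof -
  have sub: "vec.subspace U" using e by (rule enclosure_subspace)
  define X where "X = block U"
  define f where "f \<sigma> = mat z ** \<sigma> - deformed_channel s L u \<sigma>" for \<sigma>
  have subX: "subspace X" unfolding X_def by (rule subspace_block)
  have fX: "f \<sigma> \<in> X" if "\<sigma> \<in> X" for \<sigma>
    using that unfolding X_def f_def
    by (intro subspace_diff subspace_block mat_block[OF sub] deformed_channel_block[OF e])
  have lin: "linear f"
    by (auto intro!: linearI simp: f_def deformed_channel_def matrix_mult_simps sum.distrib
        algebra_simps scaleR_right.sum)
  have nb: "\<not> bij_betw f X X" using z by (simp add: op_spectrum_def X_def f_def[abs_def])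
  have ns: "f ` X \<noteq> X"
  proof
    assume surj: "f ` X = X"
    \<comment> \<open>Rank-nullity on the block is reduced to the whole space: \<open>F\<close> acts
      as \<open>f\<close> on \<open>X\<close> and as the identity on the kernel of the compression
      \<open>T\<close>, so a surjective \<open>f\<close> gives a surjective, hence injective,
      \<open>F\<close>.\<close>
    define T where "T \<sigma> = oproj U ** \<sigma> ** oproj U" for \<sigma>
    have TX: "T \<sigma> \<in> X" for \<sigma> by (auto simp: T_def X_def block_def)
    have Tid: "T \<sigma> = \<sigma>" if "\<sigma> \<in> X" for \<sigma> using that by (simp add: T_def X_def block_iff[OF sub])
    have linT: "linear T" by (auto intro!: linearI simp: T_def matrix_mult_simps)
    define F where "F \<sigma> = f (T \<sigma>) + (\<sigma> - T \<sigma>)" for \<sigma>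
    have linF: "linear F"
      unfolding F_def by (intro linear_compose_add linear_compose_sub linear_compose[OF linT lin, unfolded o_def] linT linear_ident)
    have "surj F"
      unfolding surj_def
    proof
      show "\<exists>\<sigma>. \<tau> = F \<sigma>" for \<tau>
      proof -
        obtain \<sigma> where s: "\<sigma> \<in> X" "f \<sigma> = T \<tau>" using surj TX by (metis imageE)
        have "T (\<sigma> + (\<tau> - T \<tau>)) = \<sigma>" using s Tid TX by (simp add: linear_add[OF linT] linear_diff[OF linT])
        then have "\<tau> = F (\<sigma> + (\<tau> - T \<tau>))" by (simp add: F_def s)
        then show ?thesis by blast
      qed
    qed
    then have "inj F" using linF by (rule linear_surj_imp_inj[rotated])
    then have "inj_on F X" by (rule inj_on_subset) simp
    moreover have "F \<sigma> = f \<sigma>" if "\<sigma> \<in> X" for \<sigma> by (simp add: F_def Tid that)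
    ultimately have "inj_on f X" using inj_on_cong[of X F f] by blast
    then show False using nb surj by (simp add: bij_betw_def)
  qed
  have sf: "span (f ` X) = f ` X" using linear_subspace_image[OF lin subX] by (simp add: span_eq_iff)
  have sX: "span X = X" using subX by (simp add: span_eq_iff)
  have "span (f ` X) \<subset> span X" unfolding sf sX using ns fX by blast
  then obtain b where b: "b \<noteq> 0" "b \<in> X" "\<And>y. y \<in> f ` X \<Longrightarrow> orthogonal b y"
    using orthogonal_to_subspace_exists_gen[of "f ` X" X] unfolding sf sX by metis
  \<comment> \<open>The adjoint of \<open>f\<close>, evaluated at \<open>b\<close>. It lies in
    \<open>X\<close>, so \<open>f g\<close> is in the range, and its orthogonality to
    \<open>b\<close> reads \<open>g \<bullet> g = 0\<close>.\<close>
  define g where "g = mat (cnj z) ** b - dual_deformed u b"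
  have gX: "g \<in> X" using b(2) unfolding X_def g_def
    by (intro subspace_diff subspace_block mat_block[OF sub] dual_deformed_block[OF e])
  have adj: "b \<bullet> f \<sigma> = g \<bullet> \<sigma>" for \<sigma>
  proof -
    have cm: "cadj (mat c) = (mat (cnj c) :: 'n hop)" for c by (auto simp: cadj_def mat_def vec_eq_iff)
    have "cadj (dual_deformed u b) = dual_deformed u (cadj b)"
      by (simp add: dual_deformed_def cadj_sum linear_scale[OF bounded_linear.linear[OF bounded_linear_cadj]]
          cadj_mult matrix_mul_assoc)
    then show ?thesis
      using trace_dual_deformed[of "cadj b" u \<sigma>]
      by (simp add: inner_hop f_def g_def matrix_mult_simps trace_simps cadj_diff cadj_mult cm
          matrix_mul_assoc)
  qed
  have "g \<bullet> g = 0" using b(3)[of "f g"] gX by (simp add: adj orthogonal_def)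
  then have "dual_deformed u b = mat (cnj z) ** b" by (simp add: g_def)
  then have "cmod (cnj z) \<le> l"
    using b by (intro dual_eigenvalue_le[OF e U0 h]) (auto simp: X_def)
  then show ?thesis by simp
qed

text \<open>Pairing with \<open>h\<close> annihilates the range of
  \<open>l *\<^sub>R \<sigma> - deformed_channel s L u \<sigma>\<close>, whereas
  \<open>oproj U\<close> pairs to \<open>trace h\<close>, which is nonzero. So \<open>l\<close> is a
  spectral value, and it attains the supremum by the bound on all of them.\<close>

lemma perron_form_radius:
  assumes e: "enclosure L U" and U0: "U \<noteq> {0}" and h: "perron_form U u h l"
  shows "radius U u = l"
proof -
  have sub: "vec.subspace U" using e by (rule enclosure_subspace)
  have hp: "positive_op h" and hb: "h \<in> block U" and def: "\<And>x. x \<in> U \<Longrightarrow> h *v x = 0 \<Longrightarrow> x = 0"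
    and eig: "dual_deformed u h = l *\<^sub>R h" using h by (auto simp: perron_form_def)
  obtain w where w: "w \<in> U" "w \<noteq> 0" using U0 vec.subspace_0[OF sub] by blast
  have l0: "0 < l" by (rule perron_form_bounds[OF assms])
  have "complex_of_real l \<in> op_spectrum (block U) (deformed_channel s L u)"
    unfolding op_spectrum_def
  proof (clarsimp simp: mat_of_real_mult)
    assume bij: "bij_betw (\<lambda>\<sigma>. l *\<^sub>R \<sigma> - deformed_channel s L u \<sigma>) (block U) (block U)"
    have "oproj U \<in> block U" by (simp add: block_iff[OF sub] oproj_idem[OF sub])
    then obtain \<sigma> where s: "l *\<^sub>R \<sigma> - deformed_channel s L u \<sigma> = oproj U"
      using bij_betw_imp_surj_on[OF bij] by (metis (no_types, lifting) imageE)
    have "trace h = trace (h ** oproj U)" by (simp add: block_mult(2)[OF sub hb])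
    also have "\<dots> = trace (h ** (l *\<^sub>R \<sigma>)) - trace (h ** deformed_channel s L u \<sigma>)"
      by (simp only: s[symmetric] matrix_mult_simps trace_simps)
    also have "\<dots> = 0" unfolding trace_dual_deformed eig by (simp add: matrix_mult_simps trace_simps)
    finally have "h = 0" by (intro positive_op_trace_0[OF hp]) simp
    then show False using def[OF w(1)] w(2) by simp
  qed
  then show ?thesis
    unfolding deformed_radius_def op_spectral_radius_def
    using op_spectrum_le[OF assms] l0
    by (intro cSup_eq_maximum) (auto simp: image_iff intro!: bexI[of _ "complex_of_real l"])
qed

end

section \<open>Constancy of the radius inside a summand of the decomposition\<close>

context deformed_walk
begin

text \<open>Compression by \<open>p = oproj W\<close> commutes with the dual deformed channel, so
  \<open>p ** h ** p\<close> keeps the eigenvalue of \<open>h\<close>. It vanishes only if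
  \<open>W\<close> is orthogonal to \<open>W'\<close>, because \<open>h\<close> is definite on
  \<open>W'\<close>.\<close>

lemma minimal_radius_eq:
  assumes W: "minimal_enclosure L W" and W': "minimal_enclosure L W'" and no: "\<not> corthogonal W W'"
  shows "radius W u = radius W' u"
proof -
  have e: "enclosure L W" "enclosure L W'" and W0: "W \<noteq> {0}" "W' \<noteq> {0}"
    using W W' by (auto simp: minimal_enclosure_def)
  note sub = e[THEN enclosure_subspace]
  define p where "p = oproj W"
  obtain h l where h: "perron_form W' u h l" using ex_perron_form[OF W'] by metis
  then have hp: "positive_op h" and hb: "h \<in> block W'" and def: "\<And>x. x \<in> W' \<Longrightarrow> h *v x = 0 \<Longrightarrow> x = 0"
    and eig: "dual_deformed u h = l *\<^sub>R h" by (auto simp: perron_form_def)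
  define k where "k = p ** h ** p"
  have kp: "positive_op k"
    using positive_op_conj[OF hp, of p] by (simp add: k_def p_def oproj_cadj[OF sub(1)])
  have kb: "k \<in> block W" by (auto simp: block_def k_def p_def)
  have "cadj (L i) ** k ** L i = p ** (cadj (L i) ** h ** L i) ** p" for i
  proof -
    have "cadj (L i) ** k ** L i = (cadj (L i) ** p) ** h ** (p ** L i)"
      by (simp add: k_def matrix_mul_assoc)
    also have "\<dots> = p ** (cadj (L i) ** h ** L i) ** p"
      unfolding p_def oproj_commute_cadj[OF e(1)] oproj_commute[OF e(1), symmetric]
      by (simp add: matrix_mul_assoc)
    finally show ?thesis .
  qed
  then have "dual_deformed u k = p ** dual_deformed u h ** p"
    by (simp add: dual_deformed_def matrix_mult_simps)
  then have keig: "dual_deformed u k = l *\<^sub>R k" by (simp add: eig k_def matrix_mult_simps)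
  have k0: "k \<noteq> 0"
  proof
    assume "k = 0"
    have "oproj W' *v x = 0" if x: "x \<in> W" for x
    proof (rule def[OF oproj_in[OF sub(2)]])
      have "cinner x (h *v x) = cinner x (k *v x)"
        using x by (simp add: k_def mult_vec p_def
            cinner_oproj[OF sub(1), symmetric] oproj_fix[OF sub(1)])
      then have "h *v x = 0" using \<open>k = 0\<close> by (intro positive_op_cinner_zero[OF hp]) (simp add: cinner_simps)
      then show "h *v (oproj W' *v x) = 0"
        using block_mult(2)[OF sub(2) hb] by (simp add: matrix_vector_mul_assoc)
    qed
    then have "corthogonal W W'"
      unfolding corthogonal_def using oproj_eq_0[OF sub(2)] cinner_eq_0_commute by blast
    then show False using no by simp
  qed
  have "perron_form W u k l" by (rule minimal_perron_form[OF W kp kb k0 keig])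
  then show ?thesis using perron_form_radius[OF e(1) W0(1)] perron_form_radius[OF e(2) W0(2) h] by simp
qed

lemma not_corthogonal_self:
  assumes "vec.subspace W" "W \<noteq> {0}" "corthogonal A W" "W \<subseteq> A"
  shows False
proof -
  obtain w where "w \<in> W" "w \<noteq> 0" using assms(1,2) vec.subspace_0 by blast
  then show False using assms(3,4) cinner_self_eq_0 unfolding corthogonal_def by blast
qed

text \<open>Grouping minimal enclosures by the value of their radius avoids chains of non-orthogonal
  enclosures. Those outside the class of \<open>W\<close> are orthogonal to its span
  \<open>E\<close>, so \<open>U \<inter> E\<close> is separating; minimality of \<open>U\<close>
  gives \<open>U \<subseteq> E\<close>, which leaves no room for a \<open>W'\<close> of another
  radius.\<close>

lemma decomposition_minimal_radius_eq:
  assumes D: "enclosure_decomposition L D" and U: "U \<in> D"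
    and W: "minimal_enclosure L W" "W \<subseteq> U" and W': "minimal_enclosure L W'" "W' \<subseteq> U"
  shows "radius W' u = radius W u"
proof (rule ccontr)
  assume neq: "radius W' u \<noteq> radius W u"
  have min: "\<And>A. minimal_enclosure L A \<Longrightarrow> enclosure L A \<and> A \<noteq> {0}" by (simp add: minimal_enclosure_def)
  have sepU: "separating_enclosure L U" and minU: "\<And>E. separating_enclosure L E \<Longrightarrow> E \<subseteq> U \<Longrightarrow> E = U"
    using D U by (auto simp: enclosure_decomposition_def)
  define c where "c = {A. minimal_enclosure L A \<and> radius A u = radius W u}"
  define E where "E = vec.span (\<Union>c)"
  have cE: "A \<subseteq> E" if "A \<in> c" for A using that vec.span_superset[of "\<Union>c"] by (auto simp: E_def)
  have Ee: "enclosure L E" unfolding E_def by (rule enclosure_span) (simp add: c_def minimal_enclosure_def)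
  have ort: "corthogonal E A" if A: "minimal_enclosure L A" "A \<notin> c" for A
  proof -
    have "corthogonal B A" if "B \<in> c" for B
      using minimal_radius_eq[of B A u] A that by (auto simp: c_def)
    then have "corthogonal (\<Union>c) A" by (auto simp: corthogonal_def)
    then show ?thesis unfolding E_def by (rule corthogonal_span_left)
  qed
  have "separating_enclosure L (U \<inter> E)"
    unfolding separating_enclosure_def
  proof (intro conjI allI impI)
    show "enclosure L (U \<inter> E)" using sepU Ee by (simp add: separating_enclosure_def enclosure_Int)
    have "W \<subseteq> U \<inter> E" using W cE by (simp add: c_def)
    then show "U \<inter> E \<noteq> {0}"
      using min[OF W(1)] vec.subspace_0[OF enclosure_subspace, of L W] by blast
    fix A assume A: "minimal_enclosure L A"
    have "corthogonal A U \<or> A \<subseteq> U" using sepU A by (simp add: separating_enclosure_def)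
    moreover have "corthogonal A E \<or> A \<subseteq> E"
      using ort[OF A] cE[of A] corthogonal_sym by blast
    ultimately show "corthogonal A (U \<inter> E) \<or> A \<subseteq> U \<inter> E" by (auto simp: corthogonal_def)
  qed
  then have "U \<subseteq> E" using minU by blast
  moreover have "W' \<notin> c" using neq by (simp add: c_def)
  ultimately show False
    using ort[OF W'(1)] W'(2) min[OF W'(1)] enclosure_subspace
    by (intro not_corthogonal_self[of W' E]) auto
qed

text \<open>A summand need not be a minimal enclosure, so its Perron form is assembled from those of
  orthogonal minimal pieces. Their eigenvalues agree by the preceding lemma, and the sum is definite
  because a vector in its kernel has zero projection on every piece.\<close>

lemma ex_perron_form_decomposition:
  assumes D: "enclosure_decomposition L D" and U: "U \<in> D"
    and W: "minimal_enclosure L W" "W \<subseteq> U"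
  obtains h where "perron_form U u h (radius W u)"
proof -
  define r where "r = radius W u"
  have eU: "enclosure L U" using D U by (simp add: enclosure_decomposition_def separating_enclosure_def)
  have subU: "vec.subspace U" using eU by (rule enclosure_subspace)
  obtain F where F: "finite F" "\<And>W. W \<in> F \<Longrightarrow> minimal_enclosure L W" "\<And>W. W \<in> F \<Longrightarrow> W \<subseteq> U"
    "(\<Sum>W\<in>F. oproj W) = oproj U" using minimal_decomposition[OF eU] by metis
  have F': "enclosure L A" "A \<noteq> {0}" if "A \<in> F" for A using F(2)[OF that] by (auto simp: minimal_enclosure_def)
  have "\<exists>h. perron_form A u h r" if A: "A \<in> F" for A
  proof -
    obtain h l where h: "perron_form A u h l" using ex_perron_form[OF F(2)[OF A]] by metis
    then have "l = r"
      using perron_form_radius[OF F'[OF A] h] decomposition_minimal_radius_eq[OF D U W F(2,3)[OF A]]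
      by (simp add: r_def)
    then show ?thesis using h by blast
  qed
  then obtain H where H: "\<And>A. A \<in> F \<Longrightarrow> perron_form A u (H A) r" by metis
  have Hp: "positive_op (H A)" and Hb: "H A \<in> block A" and Hdef: "\<And>x. x \<in> A \<Longrightarrow> H A *v x = 0 \<Longrightarrow> x = 0"
    and Heig: "dual_deformed u (H A) = r *\<^sub>R H A" if "A \<in> F" for A
    using H[OF that] by (auto simp: perron_form_def)
  define h where "h = (\<Sum>A\<in>F. H A)"
  have "perron_form U u h r"
    unfolding perron_form_def
  proof (intro conjI ballI impI)
    show hp: "positive_op h" unfolding h_def by (intro positive_op_sum Hp)
    show "h \<in> block U"
      unfolding h_def
    proof (intro subspace_sum subspace_block)
      fix A assume A: "A \<in> F"
      have subA: "vec.subspace A" using F'(1)[OF A] by (rule enclosure_subspace)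
      have 1: "oproj U ** oproj A = oproj A" by (rule oproj_subset[OF subA subU F(3)[OF A]])
      have 2: "oproj A ** oproj U = oproj A"
        using arg_cong[OF 1, of cadj] by (simp add: cadj_mult oproj_cadj[OF subA] oproj_cadj[OF subU])
      have "oproj U ** (oproj A ** H A ** oproj A) ** oproj U = oproj U ** oproj A ** H A ** (oproj A ** oproj U)"
        by (simp add: matrix_mul_assoc)
      then have "oproj U ** (oproj A ** H A ** oproj A) ** oproj U = oproj A ** H A ** oproj A"
        by (simp add: 1 2)
      then show "H A \<in> block U"
        using Hb[OF A] by (simp add: block_iff[OF subU] block_iff[OF subA])
    qed
    show "dual_deformed u h = r *\<^sub>R h"
    proof -
      have "dual_deformed u h = (\<Sum>A\<in>F. dual_deformed u (H A))"
        unfolding dual_deformed_def h_def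
        by (simp add: matrix_mult_simps scaleR_right.sum sum.swap[of _ F])
      also have "\<dots> = r *\<^sub>R h" by (simp add: Heig h_def scaleR_right.sum)
      finally show ?thesis .
    qed
    fix x assume x: "x \<in> U" "h *v x = 0"
    have "0 = quad h x" by (simp add: x cinner_simps)
    also have "\<dots> = (\<Sum>A\<in>F. quad (H A) x)" by (simp add: h_def mat_vec_simps cinner_simps)
    finally have z: "(\<Sum>A\<in>F. quad (H A) x) = 0" by simp
    have "oproj A *v x = 0" if A: "A \<in> F" for A
    proof -
      have subA: "vec.subspace A" using F'(1)[OF A] by (rule enclosure_subspace)
      have "quad (H A) x = 0"
        using z A by (subst (asm) sum_nonneg_eq_0_iff) (auto simp: F positive_op_Re Hp)
      then have "H A *v x = 0" by (intro positive_op_cinner_zero Hp A)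
      then show ?thesis
        using block_mult(2)[OF subA Hb[OF A]]
        by (intro Hdef[OF A oproj_in[OF subA]]) (simp add: matrix_vector_mul_assoc)
    qed
    then have "(\<Sum>A\<in>F. oproj A) *v x = 0" by (simp add: mat_vec_simps)
    then show "x = 0" using oproj_fix[OF subU x(1)] by (simp add: F)
  qed
  then show ?thesis using that by (simp add: r_def)
qed

lemma decomposition_radius_eq:
  assumes D: "enclosure_decomposition L D" and U: "U \<in> D"
    and W: "minimal_enclosure L W" "W \<subseteq> U"
  shows "radius U u = radius W u"
proof -
  have "enclosure L U" "U \<noteq> {0}"
    using D U by (auto simp: enclosure_decomposition_def separating_enclosure_def)
  moreover obtain h where "perron_form U u h (radius W u)"
    by (rule ex_perron_form_decomposition[OF assms])
  ultimately show ?thesis by (rule perron_form_radius)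
qed

text \<open>A minimal enclosure inside no summand is orthogonal to all of them, hence to their span,
  which is the whole space by recurrence.\<close>

lemma decomposition_cover:
  assumes D: "enclosure_decomposition L D" and W: "minimal_enclosure L W"
  shows "\<exists>U\<in>D. W \<subseteq> U"
proof (rule ccontr)
  assume no: "\<not> (\<exists>U\<in>D. W \<subseteq> U)"
  have "corthogonal U W" if U: "U \<in> D" for U
  proof -
    have "separating_enclosure L U" using D U unfolding enclosure_decomposition_def by blast
    then have "corthogonal W U \<or> W \<subseteq> U" using W unfolding separating_enclosure_def by blast
    then show ?thesis using no U corthogonal_sym by blast
  qed
  then have "corthogonal (\<Union>D) W" by (auto simp: corthogonal_def)
  then have "corthogonal (vec.span (\<Union>D)) W" by (rule corthogonal_span_left)
  moreover have "vec.span (\<Union>D) = UNIV" using D recurrent by (simp add: enclosure_decomposition_def)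
  ultimately show False
    using not_corthogonal_self[of W UNIV] W enclosure_subspace[of L W] by (auto simp: minimal_enclosure_def)
qed

lemma minimal_radius:
  assumes W: "minimal_enclosure L W"
  obtains h where "perron_form W u h (radius W u)"
proof -
  obtain h l where h: "perron_form W u h l" using ex_perron_form[OF W] by metis
  then show ?thesis using that perron_form_radius[of W u h l] W by (auto simp: minimal_enclosure_def)
qed

section \<open>Absorption operators and the undeformed radius\<close>

lemma dual_deformed_0_oproj:
  assumes "enclosure L U"
  shows "dual_deformed 0 (oproj U) = oproj U" "dual_channel L (oproj U) = oproj U"
proof -
  have "(\<Sum>i\<in>UNIV. cadj (L i) ** oproj U ** L i) = (\<Sum>i\<in>UNIV. cadj (L i) ** L i) ** oproj U"
    by (simp add: matrix_mult_simps matrix_mul_assoc[symmetric] oproj_commute[OF assms, symmetric])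
  then show "dual_deformed 0 (oproj U) = oproj U" "dual_channel L (oproj U) = oproj U"
    by (simp_all add: dual_deformed_def dual_channel_def kraus)
qed

text \<open>The sequence under the limit is constant: the projection commutes with the Kraus
  operators and is therefore fixed by the dual channel.\<close>

lemma absorption_enclosure:
  assumes "enclosure L U"
  shows "absorption L U = oproj U"
proof -
  have "(dual_channel L ^^ n) (oproj U) = oproj U" for n
    by (induction n) (simp_all add: dual_deformed_0_oproj[OF assms])
  then show ?thesis by (simp add: absorption_def)
qed

text \<open>At \<open>u = 0\<close> the projection itself is a Perron form with eigenvalue
  \<open>1\<close>. This makes the rate nonnegative.\<close>

lemma enclosure_radius_0:
  assumes "enclosure L U" "U \<noteq> {0}"
  shows "radius U 0 = 1"
proof -
  have sub: "vec.subspace U" using assms(1) by (rule enclosure_subspace)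
  have "perron_form U 0 (oproj U) 1"
    by (simp add: perron_form_def positive_oproj[OF sub] block_iff[OF sub] oproj_idem[OF sub]
        dual_deformed_0_oproj[OF assms(1)] oproj_fix[OF sub])
  then show ?thesis by (rule perron_form_radius[OF assms])
qed

text \<open>Each minimal \<open>W\<close> lies in \<open>U\<close> or is orthogonal to it, so
  \<open>oproj U ** oproj W\<close> is \<open>oproj W\<close> or \<open>0\<close>. Any minimal
  decomposition thus refines the given one.\<close>

lemma oproj_minimal_sum:
  assumes D: "enclosure_decomposition L D" and U: "U \<in> D"
    and F: "finite F" "\<And>W. W \<in> F \<Longrightarrow> minimal_enclosure L W" "(\<Sum>W\<in>F. oproj W) = mat 1"
  shows "oproj U = (\<Sum>W\<in>{W\<in>F. W \<subseteq> U}. oproj W)"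
proof -
  have sep: "separating_enclosure L U" using D U by (simp add: enclosure_decomposition_def)
  then have eU: "enclosure L U" by (simp add: separating_enclosure_def)
  have "oproj U = oproj U ** (\<Sum>W\<in>F. oproj W)" by (simp add: F)
  also have "\<dots> = (\<Sum>W\<in>F. if W \<subseteq> U then oproj W else 0)"
    unfolding matrix_mult_simps
  proof (rule sum.cong[OF refl])
    fix W assume W: "W \<in> F"
    have eW: "enclosure L W" using F(2)[OF W] by (simp add: minimal_enclosure_def)
    show "oproj U ** oproj W = (if W \<subseteq> U then oproj W else 0)"
    proof (cases "W \<subseteq> U")
      case True
      then show ?thesis using oproj_subset[OF enclosure_subspace[OF eW] enclosure_subspace[OF eU]] by simp
    next
      case False
      then have "corthogonal U W"
        using sep F(2)[OF W] corthogonal_sym[of U W] by (auto simp: separating_enclosure_def)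
      then show ?thesis
        using False oproj_corthogonal[OF enclosure_subspace[OF eU] enclosure_subspace[OF eW]] by simp
    qed
  qed
  also have "\<dots> = (\<Sum>W\<in>{W\<in>F. W \<subseteq> U}. oproj W)" by (simp add: F(1) sum.inter_filter)
  finally show ?thesis .
qed

end

section \<open>Path weights\<close>

lemma finite_words [simp]: "finite {a :: 'j::finite list. length a = n}"
  using finite_lists_length_eq[of "UNIV :: 'j set" n] by simp

lemma words_0: "{a :: 'j list. length a = 0} = {[]}"
  by auto

lemma sum_words_append:
  fixes F :: "'j::finite list \<Rightarrow> 'b::comm_monoid_add"
  shows "(\<Sum>a | length a = m + n. F a) = (\<Sum>a | length a = m. \<Sum>b | length b = n. F (a @ b))"
proof -
  have "(\<Sum>a | length a = m. \<Sum>b | length b = n. F (a @ b)) =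
      (\<Sum>(a, b)\<in>{a. length a = m} \<times> {b. length b = n}. F (a @ b))"
    by (rule sum.cartesian_product)
  also have "\<dots> = (\<Sum>a | length a = m + n. F a)"
    by (rule sum.reindex_bij_witness[where i = "\<lambda>a. (take m a, drop m a)" and j = "\<lambda>(a, b). a @ b"]) auto
  finally show ?thesis by simp
qed

lemma sum_words_Suc:
  fixes F :: "'j::finite list \<Rightarrow> 'b::comm_monoid_add"
  shows "(\<Sum>a | length a = Suc n. F a) = (\<Sum>j\<in>UNIV. \<Sum>a | length a = n. F (j # a))"
proof -
  have "(\<Sum>j\<in>UNIV. \<Sum>a | length a = n. F (j # a)) = (\<Sum>(j, a)\<in>UNIV \<times> {a. length a = n}. F (j # a))"
    by (rule sum.cartesian_product)
  also have "\<dots> = (\<Sum>a | length a = Suc n. F a)"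
    by (rule sum.reindex_bij_witness[where i = "\<lambda>a. (hd a, tl a)" and j = "\<lambda>(j, a). j # a"])
      (auto simp: length_Suc_conv)
  finally show ?thesis by simp
qed

lemma norm_smult: "norm (c *s (x :: 'n::finite hvec)) = cmod c * norm x"
proof -
  have "complex_of_real ((norm (c *s x))\<^sup>2) = complex_of_real ((cmod c * norm x)\<^sup>2)"
    unfolding cinner_self[symmetric] power_mult_distrib of_real_mult complex_norm_square
    by (simp add: cinner_smult_left cinner_smult_right mult.assoc)
  then have "(norm (c *s x))\<^sup>2 = (cmod c * norm x)\<^sup>2" by (simp only: of_real_eq_iff)
  then show ?thesis by (rule power2_eq_imp_eq) auto
qed

lemma cmod_cinner_le: "cmod (cinner x y) \<le> norm x * norm y"
proof -
  define c where "c = cnj (sgn (cinner x y))"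
  have "c * cinner x y = complex_of_real (cmod (cinner x y))"
    by (cases "cinner x y = 0") (auto simp: c_def sgn_eq field_simps complex_norm_square[symmetric] power2_eq_square)
  then have "cmod (cinner x y) = Re (cinner x (c *s y))" by (simp add: cinner_smult_right)
  also have "\<dots> \<le> norm x * norm (c *s y)" unfolding Re_cinner by (rule norm_cauchy_schwarz)
  also have "\<dots> = norm x * (cmod c * norm y)" by (simp add: norm_smult)
  also have "cmod c * norm y \<le> norm y" by (auto simp: c_def norm_sgn)
  finally show ?thesis by (simp add: mult_left_mono)
qed

lemma trace_ketbra: "trace (ketbra x) = complex_of_real ((norm x)\<^sup>2)"
  unfolding cinner_self[symmetric] by (simp add: trace_def ketbra_def cinner_def mult.commute)

lemma conj_ketbra: "A ** ketbra x ** cadj A = ketbra (A *v x)"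
  by (rule matrix_eqI_vec)
     (simp add: mult_vec ketbra_vec vec.scale cinner_matrix_left)

lemma path_op_append: "path_op L (a @ b) = path_op L b ** path_op L a"
  by (induction a) (simp_all add: matrix_mul_assoc)

text \<open>The probability of reading the word \<open>a\<close> from the internal state
  \<open>\<sigma>\<close>, extended linearly to all matrices; linearity and monotonicity in
  \<open>\<sigma>\<close> carry the comparisons below.\<close>

definition weight :: "('j \<Rightarrow> 'n::finite hop) \<Rightarrow> 'j list \<Rightarrow> 'n hop \<Rightarrow> real" where
  "weight L a \<sigma> = Re (trace (path_op L a ** \<sigma> ** cadj (path_op L a)))"

definition displacement :: "('j \<Rightarrow> real ^ 'd::finite) \<Rightarrow> 'j list \<Rightarrow> real ^ 'd" where
  "displacement s a = sum_list (map s a)"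

lemma displacement_simps [simp]:
  "displacement s [] = 0" "displacement s (j # a) = s j + displacement s a"
  "displacement s (a @ b) = displacement s a + displacement s b"
  by (simp_all add: displacement_def)

lemma weight_nonneg: "positive_op \<sigma> \<Longrightarrow> 0 \<le> weight L a \<sigma>"
  unfolding weight_def by (intro positive_op_trace(2) positive_op_conj)

lemma weight_linear: "linear (weight L a)"
  by (rule linearI) (simp_all add: weight_def matrix_mult_simps trace_simps)

lemma weight_append: "weight L (a @ b) \<sigma> = weight L b (path_op L a ** \<sigma> ** cadj (path_op L a))"
  by (simp add: weight_def path_op_append cadj_mult matrix_mul_assoc)

lemma weight_Nil [simp]: "weight L [] \<sigma> = Re (trace \<sigma>)"
  by (simp add: weight_def)

lemma weight_mono: "positive_op (\<tau> - \<sigma>) \<Longrightarrow> weight L a \<sigma> \<le> weight L a \<tau>"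
  using weight_nonneg[of "\<tau> - \<sigma>" L a] by (simp add: linear_diff[OF weight_linear])

lemma weight_ketbra: "weight L a (ketbra x) = (norm (path_op L a *v x))\<^sup>2"
  by (simp only: weight_def conj_ketbra trace_ketbra Re_complex_of_real)

lemma ketbra_le_oproj:
  assumes "vec.subspace W" "z \<in> W" "norm z = 1"
  shows "positive_op (oproj W - ketbra z)"
proof -
  have "cinner x ((oproj W - ketbra z) *v x) =
      complex_of_real ((norm (oproj W *v x))\<^sup>2 - (cmod (cinner z (oproj W *v x)))\<^sup>2)" for x
  proof -
    have 1: "cinner x (oproj W *v x) = cinner (oproj W *v x) (oproj W *v x)"
      by (simp add: cinner_oproj[OF assms(1)] oproj_idem_vec[OF assms(1)])
    have 2: "cinner z x = cinner z (oproj W *v x)"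
      using assms by (simp add: cinner_oproj[OF assms(1), symmetric] oproj_fix)
    have 3: "cinner x (ketbra z *v x) = cinner z x * cnj (cinner z x)"
      by (simp only: ketbra_vec cinner_smult_right cinner_commute[of z x]) simp
    show ?thesis
      by (simp only: mat_vec_simps cinner_simps 1 3 2 cinner_self of_real_diff complex_norm_square[of "cinner _ _"])
  qed
  moreover have "(cmod (cinner z (oproj W *v x)))\<^sup>2 \<le> (norm (oproj W *v x))\<^sup>2" for x
    using cmod_cinner_le[of z "oproj W *v x"] assms by (intro power_mono) auto
  ultimately show ?thesis unfolding positive_op_def by (auto simp del: of_real_diff)
qed

lemma weight_oproj:
  assumes "vec.subspace W"
  shows "weight L a (oproj W) = (\<Sum>i\<in>UNIV. (norm (path_op L a *v (oproj W *v axis i 1)))\<^sup>2)"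
proof -
  let ?A = "path_op L a" let ?p = "oproj W"
  have "trace (?A ** ?p ** cadj ?A) = trace ((?A ** ?p) ** cadj (?A ** ?p))"
    by (simp add: cadj_mult oproj_cadj[OF assms] matrix_mul_assoc)
       (simp add: matrix_mul_assoc[symmetric] oproj_idem[OF assms])
  also have "\<dots> = trace (cadj (?A ** ?p) ** (?A ** ?p))" by (rule trace_mul_sym)
  also have "\<dots> = (\<Sum>i\<in>UNIV. cinner (?A *v (?p *v axis i 1)) (?A *v (?p *v axis i 1)))"
    unfolding trace_eq_cinner
    by (simp add: mult_vec cadj_mult cinner_matrix_left)
  finally show ?thesis by (simp add: weight_def cinner_self)
qed

text \<open>The form of a block element at \<open>x\<close> equals its form at
  \<open>oproj W *v x\<close>, so operator inequalities in the block can be tested on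
  \<open>W\<close>.\<close>

lemma positive_op_blockI:
  assumes sub: "vec.subspace W" and \<tau>: "\<tau> \<in> block W"
    and W: "\<And>y. y \<in> W \<Longrightarrow> cinner y (\<tau> *v y) \<in> \<real> \<and> 0 \<le> quad \<tau> y"
  shows "positive_op \<tau>"
  unfolding positive_op_def
proof
  fix x
  have "\<tau> = oproj W ** \<tau> ** oproj W" using \<tau> block_iff[OF sub] by simp
  then have "cinner x (\<tau> *v x) = cinner x ((oproj W ** \<tau> ** oproj W) *v x)" by simp
  also have "\<dots> = cinner (oproj W *v x) (\<tau> *v (oproj W *v x))"
    by (simp add: mult_vec cinner_oproj[OF sub, symmetric])
  finally show "cinner x (\<tau> *v x) \<in> \<real> \<and> 0 \<le> quad \<tau> x" using W[OF oproj_in[OF sub]] by simp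
qed

lemma positive_op_le_oproj:
  assumes sub: "vec.subspace W" and \<sigma>: "positive_op \<sigma>" "\<sigma> \<in> block W"
  obtains K where "0 < K" "positive_op (K *\<^sub>R oproj W - \<sigma>)"
proof -
  obtain K where K: "0 < K" "\<And>x. norm (\<sigma> *v x) \<le> norm x * K"
    using bounded_linear.pos_bounded[OF bounded_bilinear.bounded_linear_right[OF bounded_bilinear_matrix_vector_mult, of \<sigma>]]
    by blast
  have "positive_op (K *\<^sub>R oproj W - \<sigma>)"
  proof (rule positive_op_blockI[OF sub])
    show "K *\<^sub>R oproj W - \<sigma> \<in> block W"
      by (intro subspace_diff subspace_scale subspace_block \<sigma>) (simp add: block_iff[OF sub] oproj_idem[OF sub])
    fix y assume y: "y \<in> W"
    have "cinner y ((K *\<^sub>R oproj W - \<sigma>) *v y) = complex_of_real (K * (norm y)\<^sup>2 - quad \<sigma> y)"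
      using positive_op_cinner_real[OF \<sigma>(1), of y] cinner_self[of y]
      by (simp add: mat_vec_simps cinner_simps oproj_fix[OF sub y]) (simp add: scaleR_conv_of_real)
    moreover have "quad \<sigma> y \<le> K * (norm y)\<^sup>2"
    proof -
      have "quad \<sigma> y \<le> norm y * norm (\<sigma> *v y)"
        using cmod_cinner_le[of y "\<sigma> *v y"] complex_Re_le_cmod order_trans by blast
      also have "\<dots> \<le> norm y * (norm y * K)" by (intro mult_left_mono K(2)) simp
      finally show ?thesis by (simp add: power2_eq_square algebra_simps)
    qed
    ultimately show "cinner y ((K *\<^sub>R oproj W - \<sigma>) *v y) \<in> \<real> \<and> 0 \<le> quad (K *\<^sub>R oproj W - \<sigma>) y"
      by (simp del: of_real_diff)
  qed
  then show ?thesis using that K by blast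
qed

context deformed_walk
begin

abbreviation "disp \<equiv> displacement s"

lemma norm_displacement: "norm (disp a) \<le> (\<Sum>i\<in>UNIV. norm (s i)) * real (length a)"
proof (induction a)
  case (Cons j a)
  have "norm (s j) \<le> (\<Sum>i\<in>UNIV. norm (s i))" by (intro member_le_sum) auto
  then show ?case using Cons norm_triangle_ineq[of "s j" "disp a"] by (simp add: algebra_simps)
qed simp

lemma path_op_enclosure: "enclosure L U \<Longrightarrow> x \<in> U \<Longrightarrow> path_op L a *v x \<in> U"
  by (induction a arbitrary: x) (auto simp: mult_vec enclosure_iff)

lemma path_op_block:
  assumes "enclosure L U" "\<sigma> \<in> block U"
  shows "path_op L a ** \<sigma> ** cadj (path_op L a) \<in> block U"
  using assms(2)
proof (induction a arbitrary: \<sigma>)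
  case (Cons j a)
  from Cons.IH[OF block_conj(1)[OF assms(1) Cons.prems, of j]] show ?case
    by (simp add: cadj_mult matrix_mul_assoc)
qed simp

lemma oproj_commute_path:
  assumes "enclosure L U"
  shows "path_op L a ** oproj U = oproj U ** path_op L a"
proof (induction a)
  case (Cons j a)
  have "path_op L (j # a) ** oproj U = path_op L a ** (L j ** oproj U)" by (simp add: matrix_mul_assoc)
  also have "\<dots> = (path_op L a ** oproj U) ** L j" by (simp add: oproj_commute[OF assms] matrix_mul_assoc)
  finally show ?case by (simp add: Cons matrix_mul_assoc)
qed simp

section \<open>Total mass and Laplace transforms of the path weights\<close>

lemma weight_sum_step: "(\<Sum>j\<in>UNIV. Re (trace (L j ** \<sigma> ** cadj (L j)))) = Re (trace \<sigma>)"
proof -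
  have "(\<Sum>j\<in>UNIV. trace (L j ** \<sigma> ** cadj (L j))) = trace ((\<Sum>j\<in>UNIV. cadj (L j) ** L j) ** \<sigma>)"
    by (simp add: matrix_mult_simps trace_simps trace_mul_sym[of "L _ ** \<sigma>"] matrix_mul_assoc)
  then show ?thesis by (simp add: kraus Re_sum[symmetric])
qed

lemma sum_weight: "(\<Sum>a | length a = n. weight L a \<sigma>) = Re (trace \<sigma>)"
proof (induction n arbitrary: \<sigma>)
  case (Suc n)
  have "(\<Sum>a | length a = Suc n. weight L a \<sigma>) =
      (\<Sum>j\<in>UNIV. \<Sum>a | length a = n. weight L a (L j ** \<sigma> ** cadj (L j)))"
    unfolding sum_words_Suc using weight_append[of L "[_]"] by simp
  then show ?case by (simp add: Suc weight_sum_step)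
qed (simp add: words_0)

text \<open>The \<open>n\<close>-fold eigen equation written along words. The identity is exact, and
  both Laplace bounds are read off from it.\<close>

lemma perron_form_sum:
  assumes "perron_form U u h l"
  shows "(\<Sum>a | length a = n. exp (u \<bullet> disp a) *
      quad h (path_op L a *v x)) = l ^ n * quad h x"
proof (induction n arbitrary: x)
  case (Suc n)
  have eig: "dual_deformed u h = l *\<^sub>R h" using assms by (simp add: perron_form_def)
  have "(\<Sum>a | length a = Suc n. exp (u \<bullet> disp a) *
      quad h (path_op L a *v x)) =
    (\<Sum>j\<in>UNIV. exp (u \<bullet> s j) * (\<Sum>a | length a = n. exp (u \<bullet> disp a) *
      quad h (path_op L a *v (L j *v x))))"
    by (simp add: sum_words_Suc sum_distrib_left inner_add_right exp_add matrix_vector_mul_assoc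
        mult.assoc)
  also have "\<dots> = l ^ n * (\<Sum>j\<in>UNIV. exp (u \<bullet> s j) * quad h (L j *v x))"
    unfolding Suc by (simp add: sum_distrib_left algebra_simps)
  also have "\<dots> = l ^ Suc n * quad h x"
    unfolding Re_cinner_dual_deformed[symmetric] by (simp add: eig mat_vec_simps cinner_simps)
  finally show ?case .
qed (simp add: words_0)

lemma minimal_form_bounds:
  assumes W: "minimal_enclosure L W"
  obtains h m M z where "perron_form W u h (radius W u)"
    "0 < m" "0 < M" "z \<in> W" "norm z = 1" "quad h z = M"
    "\<And>x. x \<in> W \<Longrightarrow> m * (norm x)\<^sup>2 \<le> quad h x"
    "\<And>x. x \<in> W \<Longrightarrow> quad h x \<le> M * (norm x)\<^sup>2"
proof -
  have W': "vec.subspace W" "W \<noteq> {0}"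
    using W by (auto simp: minimal_enclosure_def intro: enclosure_subspace)
  obtain h where h: "perron_form W u h (radius W u)" by (rule minimal_radius[OF W])
  then have hp: "positive_op h" and def: "\<And>x. x \<in> W \<Longrightarrow> h *v x = 0 \<Longrightarrow> x = 0"
    by (auto simp: perron_form_def)
  show ?thesis by (rule form_bounds[OF W' hp def]) (use h that in blast)+
qed

text \<open>The form equals \<open>M\<close> at the maximiser \<open>z\<close> and is at most
  \<open>M\<close> times the squared norm at the endpoint of a path, so the two factors
  \<open>M\<close> cancel. Since \<open>ketbra z\<close> is dominated by \<open>oproj W\<close>, the
  vector may be replaced by the projection.\<close>

lemma laplace_weight_lower:
  assumes W: "minimal_enclosure L W"
  shows "radius W u ^ n \<le> (\<Sum>a | length a = n. exp (u \<bullet> disp a) * weight L a (oproj W))"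
proof -
  have e: "enclosure L W" using W by (simp add: minimal_enclosure_def)
  have sub: "vec.subspace W" using e by (rule enclosure_subspace)
  obtain h m M z where h: "perron_form W u h (radius W u)"
    and b: "0 < m" "0 < M" "z \<in> W" "norm z = 1" "quad h z = M"
    "\<And>x. x \<in> W \<Longrightarrow> m * (norm x)\<^sup>2 \<le> quad h x"
    "\<And>x. x \<in> W \<Longrightarrow> quad h x \<le> M * (norm x)\<^sup>2"
    by (rule minimal_form_bounds[OF W, where u = u]) blast
  have "radius W u ^ n * M = (\<Sum>a | length a = n. exp (u \<bullet> disp a) *
      quad h (path_op L a *v z))"
    using perron_form_sum[OF h, of z n] b by simp
  also have "\<dots> \<le> (\<Sum>a | length a = n. exp (u \<bullet> disp a) * (M * weight L a (oproj W)))"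
  proof (intro sum_mono mult_left_mono)
    fix a
    have "quad h (path_op L a *v z) \<le> M * (norm (path_op L a *v z))\<^sup>2"
      by (intro b(7) path_op_enclosure[OF e] b)
    also have "\<dots> \<le> M * weight L a (oproj W)"
      unfolding weight_ketbra[symmetric]
      by (intro mult_left_mono weight_mono ketbra_le_oproj sub b(3,4)) (use b in simp)
    finally show "quad h (path_op L a *v z) \<le> M * weight L a (oproj W)" .
  qed simp
  also have "\<dots> = M * (\<Sum>a | length a = n. exp (u \<bullet> disp a) * weight L a (oproj W))"
    by (simp add: sum_distrib_left algebra_simps)
  finally show ?thesis using b(2) by (simp add: mult.commute)
qed

text \<open>The state is dominated by \<open>K *\<^sub>R oproj W\<close>, whose weight is a sum of
  squared norms over the projected basis vectors; the lower bound \<open>m\<close> on the form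
  reduces each of them to the iterated eigen equation. The constant may depend on \<open>u\<close>
  but not on \<open>n\<close>.\<close>

lemma laplace_weight_upper:
  assumes W: "minimal_enclosure L W" and \<sigma>: "positive_op \<sigma>" "\<sigma> \<in> block W"
  obtains C where "0 \<le> C"
    "\<And>n. (\<Sum>a | length a = n. exp (u \<bullet> disp a) * weight L a \<sigma>) \<le> C * radius W u ^ n"
proof -
  have e: "enclosure L W" using W by (simp add: minimal_enclosure_def)
  have sub: "vec.subspace W" using e by (rule enclosure_subspace)
  obtain h m M z where h: "perron_form W u h (radius W u)"
    and b: "0 < m" "0 < M" "z \<in> W" "norm z = 1" "quad h z = M"
    "\<And>x. x \<in> W \<Longrightarrow> m * (norm x)\<^sup>2 \<le> quad h x"
    "\<And>x. x \<in> W \<Longrightarrow> quad h x \<le> M * (norm x)\<^sup>2"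
    by (rule minimal_form_bounds[OF W, where u = u]) blast
  obtain K where K: "0 < K" "positive_op (K *\<^sub>R oproj W - \<sigma>)"
    using positive_op_le_oproj[OF sub \<sigma>] by metis
  let ?q = "\<lambda>x. quad h x"
  let ?e = "\<lambda>i. oproj W *v axis i 1"
  let ?r = "radius W u"
  define C where "C = K / m * (\<Sum>i\<in>UNIV. ?q (?e i))"
  have w: "weight L a \<sigma> \<le> K / m * (\<Sum>i\<in>UNIV. ?q (path_op L a *v ?e i))" for a
  proof -
    have "weight L a \<sigma> \<le> K * weight L a (oproj W)"
      using weight_mono[OF K(2), of L a] by (simp add: linear_scale[OF weight_linear])
    also have "\<dots> \<le> K * (\<Sum>i\<in>UNIV. ?q (path_op L a *v ?e i) / m)"
    proof -
      have "m * (norm (path_op L a *v ?e i))\<^sup>2 \<le> ?q (path_op L a *v ?e i)" for i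
        by (intro b(6) path_op_enclosure[OF e] oproj_in sub)
      then show ?thesis unfolding weight_oproj[OF sub]
        using K(1) b(1) by (intro mult_left_mono sum_mono) (auto simp: field_simps)
    qed
    finally show ?thesis by (simp add: sum_divide_distrib[symmetric])
  qed
  have "(\<Sum>a | length a = n. exp (u \<bullet> disp a) * weight L a \<sigma>) \<le> C * ?r ^ n" for n
  proof -
    have "(\<Sum>a | length a = n. exp (u \<bullet> disp a) * weight L a \<sigma>) \<le>
      (\<Sum>a | length a = n. exp (u \<bullet> disp a) * (K / m * (\<Sum>i\<in>UNIV. ?q (path_op L a *v ?e i))))"
      by (intro sum_mono mult_left_mono w) simp
    also have "\<dots> = (\<Sum>a | length a = n. \<Sum>i\<in>UNIV. K / m * (exp (u \<bullet> disp a) * ?q (path_op L a *v ?e i)))"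
      by (simp add: sum_distrib_left mult_ac)
    also have "\<dots> = (\<Sum>i\<in>UNIV. K / m * (\<Sum>a | length a = n. exp (u \<bullet> disp a) * ?q (path_op L a *v ?e i)))"
      by (subst sum.swap) (simp only: sum_distrib_left)
    also have "\<dots> = C * ?r ^ n"
      unfolding perron_form_sum[OF h] by (simp add: C_def sum_distrib_left sum_distrib_right mult_ac)
    finally show ?thesis .
  qed
  moreover have "0 \<le> C"
    unfolding C_def using K(1) b(1) by (intro mult_nonneg_nonneg sum_nonneg positive_op_Re)
      (use h in \<open>auto simp: perron_form_def\<close>)
  ultimately show ?thesis using that by blast
qed

text \<open>The vectors of \<open>W\<close> whose forward orbits stay orthogonal to \<open>x\<close>
  form an enclosure that misses \<open>x\<close>, so it is \<open>{0}\<close>. If no word gave a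
  positive form at \<open>x\<close>, the whole range of \<open>\<sigma>\<close> would lie in
  it.\<close>

lemma ex_connecting_word:
  assumes W: "minimal_enclosure L W" and \<sigma>: "positive_op \<sigma>" "\<sigma> \<in> block W" "\<sigma> \<noteq> 0"
    and x: "x \<in> W" "x \<noteq> 0"
  obtains c where "0 < quad (path_op L c ** \<sigma> ** cadj (path_op L c)) x"
proof (rule ccontr)
  assume no: "\<not> thesis"
  have e: "enclosure L W" using W by (simp add: minimal_enclosure_def)
  have sub: "vec.subspace W" using e by (rule enclosure_subspace)
  define E where "E = {y \<in> W. \<forall>c. cinner x (path_op L c *v y) = 0}"
  have "L j *v y \<in> E" if y: "y \<in> E" for j y
  proof -
    have "cinner x (path_op L c *v (L j *v y)) = 0" for c
    proof -
      have "cinner x (path_op L (j # c) *v y) = 0" using y unfolding E_def by blast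
      then show ?thesis by (simp add: matrix_vector_mul_assoc)
    qed
    then show ?thesis using y e by (auto simp: E_def enclosure_iff)
  qed
  moreover have "vec.subspace E"
    using sub by (auto simp: E_def vec.subspace_def mat_vec_simps cinner_simps vec.scale cinner_smult_right)
  ultimately have "enclosure L E" by (simp add: enclosure_iff)
  then have "E = {0} \<or> E = W" using W by (simp add: minimal_enclosure_def E_def)
  moreover have "x \<notin> E"
  proof
    assume "x \<in> E"
    then have "cinner x (path_op L [] *v x) = 0" unfolding E_def by blast
    then show False using x by (simp add: cinner_self_eq_0)
  qed
  ultimately have E0: "E = {0}" using x by auto
  have z: "\<sigma> *v (cadj (path_op L c) *v x) = 0" for c
  proof (rule positive_op_cinner_zero[OF \<sigma>(1)])
    have eq: "cinner x ((path_op L c ** \<sigma> ** cadj (path_op L c)) *v x) =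
        cinner (cadj (path_op L c) *v x) (\<sigma> *v (cadj (path_op L c) *v x))"
      by (simp add: mult_vec cinner_matrix_left)
    have "\<not> 0 < quad (path_op L c ** \<sigma> ** cadj (path_op L c)) x"
      using no that by blast
    then show "quad \<sigma> (cadj (path_op L c) *v x) = 0"
      unfolding eq using positive_op_Re[OF \<sigma>(1), of "cadj (path_op L c) *v x"] by simp
  qed
  have "\<sigma> = 0"
  proof (rule matrix_eqI_vec)
    fix y
    have "\<sigma> *v y = oproj W *v (\<sigma> *v y)" using block_mult(1)[OF sub \<sigma>(2)] by (simp add: matrix_vector_mul_assoc)
    then have 1: "\<sigma> *v y \<in> W" using oproj_in[OF sub] by metis
    have "cinner x (path_op L c *v (\<sigma> *v y)) = cinner (\<sigma> *v (cadj (path_op L c) *v x)) y" for c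
      by (simp add: cinner_matrix positive_op_cadj[OF \<sigma>(1)])
    then have "\<sigma> *v y \<in> E" using 1 by (simp add: E_def z cinner_simps)
    then show "\<sigma> *v y = 0 *v y" using E0 by simp
  qed
  then show False using \<sigma>(3) by simp
qed

text \<open>All lengths up to \<open>N\<close> are summed, because the words connecting states to
  vectors may need different lengths, as in periodic walks.\<close>

definition reach :: "nat \<Rightarrow> 'n hop \<Rightarrow> 'n hop" where
  "reach N \<sigma> = (\<Sum>l\<le>N. \<Sum>c | length c = l. path_op L c ** \<sigma> ** cadj (path_op L c))"

lemma weight_reach: "weight L b (reach N \<sigma>) = (\<Sum>l\<le>N. \<Sum>c | length c = l. weight L (c @ b) \<sigma>)"
  by (simp add: reach_def linear_sum[OF weight_linear] weight_append)

lemma reach_positive: "positive_op \<sigma> \<Longrightarrow> positive_op (reach N \<sigma>)"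
  unfolding reach_def by (intro positive_op_sum positive_op_conj)

lemma cinner_reach_ge:
  assumes "positive_op \<sigma>" "length c \<le> N"
  shows "quad (path_op L c ** \<sigma> ** cadj (path_op L c)) x \<le> quad (reach N \<sigma>) x"
proof -
  let ?f = "\<lambda>c. quad (path_op L c ** \<sigma> ** cadj (path_op L c)) x"
  have p: "0 \<le> ?f c" for c by (intro positive_op_Re positive_op_conj assms)
  have "?f c \<le> (\<Sum>d | length d = length c. ?f d)" by (rule member_le_sum) (auto simp: p)
  also have "\<dots> \<le> (\<Sum>l\<le>N. \<Sum>d | length d = l. ?f d)"
    using assms(2) by (intro member_le_sum[where f = "\<lambda>l. \<Sum>d | length d = l. ?f d"]) (auto intro!: sum_nonneg p)
  also have "\<dots> = quad (reach N \<sigma>) x"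
    by (simp add: reach_def mat_vec_simps cinner_simps)
  finally show ?thesis .
qed

text \<open>Quantitative irreducibility: summed over connecting words of at most \<open>N\<close>
  letters, the evolved state dominates \<open>\<kappa>\<close> times its initial trace times
  \<open>oproj W\<close>. Compactness of the pairs of a state and a unit vector makes
  \<open>N\<close> and \<open>\<kappa>\<close> uniform, and general \<open>\<sigma>\<close> follow
  by scaling. Neither constant depends on the word \<open>b\<close> or its length.\<close>

lemma decoupling:
  assumes W: "minimal_enclosure L W"
  obtains N \<kappa> where "0 < \<kappa>"
    "\<And>\<sigma> b. positive_op \<sigma> \<Longrightarrow> \<sigma> \<in> block W \<Longrightarrow>
       \<kappa> * Re (trace \<sigma>) * weight L b (oproj W) \<le> (\<Sum>l\<le>N. \<Sum>c | length c = l. weight L (c @ b) \<sigma>)"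
proof -
  have e: "enclosure L W" using W by (simp add: minimal_enclosure_def)
  have sub: "vec.subspace W" using e by (rule enclosure_subspace)
  define S where "S = {\<sigma>. positive_op \<sigma> \<and> \<sigma> \<in> block W \<and> trace \<sigma> = 1}"
  define X where "X = W \<inter> sphere 0 1"
  have comp: "compact (S \<times> X)"
    unfolding S_def X_def
    by (intro compact_Times compact_states sub closed_Int_compact closed_subspace
        subspace_of_vec_subspace compact_sphere)
  define F where "F N v = Re (cinner (snd v) (reach N (fst v) *v snd v))" for N v
  have cont: "continuous_on A (F N)" for A N
    unfolding F_def reach_def by (intro continuous_intros)
  have op: "open {v. 0 < F N v}" for N
    by (rule open_Collect_less) (use cont in \<open>auto intro: continuous_on_const\<close>)
  have cover: "S \<times> X \<subseteq> (\<Union>N\<in>UNIV. {v. 0 < F N v})"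
  proof
    fix v assume "v \<in> S \<times> X"
    then obtain \<sigma> x where v: "v = (\<sigma>, x)" "\<sigma> \<in> S" "x \<in> X" by auto
    have "\<sigma> \<noteq> 0" "x \<noteq> 0" using v by (auto simp: S_def X_def trace_simps)
    then obtain c where c: "0 < quad (path_op L c ** \<sigma> ** cadj (path_op L c)) x"
      using ex_connecting_word[OF W, of \<sigma> x] v by (auto simp: S_def X_def)
    also have "\<dots> \<le> F (length c) v"
      unfolding F_def v(1) fst_conv snd_conv by (rule cinner_reach_ge) (use v in \<open>auto simp: S_def\<close>)
    finally show "v \<in> (\<Union>N\<in>UNIV. {v. 0 < F N v})" by blast
  qed
  obtain I where I: "finite I" "S \<times> X \<subseteq> (\<Union>N\<in>I. {v. 0 < F N v})"
    using compactE_image[OF comp op cover] by metis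
  \<comment> \<open>The default \<open>0\<close> gives the maximum a value even if the subcover is
    empty.\<close>
  define N where "N = Max (insert 0 I)"
  have F_mono: "F n v \<le> F N v" if "n \<in> I" "fst v \<in> S" for n v
  proof -
    have "n \<le> N" using that I by (simp add: N_def)
    moreover have "0 \<le> Re (cinner (snd v) ((path_op L c ** fst v ** cadj (path_op L c)) *v snd v))" for c
      using that by (intro positive_op_Re positive_op_conj) (simp add: S_def)
    ultimately show ?thesis
      unfolding F_def reach_def mat_vec_simps cinner_simps Re_sum
      by (intro sum_mono2 sum_nonneg) auto
  qed
  have FN: "0 < F N v" if v: "v \<in> S \<times> X" for v
  proof -
    obtain n where "n \<in> I" "0 < F n v" using I(2) v by blast
    then show ?thesis using F_mono[of n v] v by (auto intro: less_le_trans)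
  qed
  obtain \<kappa> where k: "0 < \<kappa>" "\<And>v. v \<in> S \<times> X \<Longrightarrow> \<kappa> \<le> F N v"
  proof (cases "S \<times> X = {}")
    case True
    then show ?thesis using that[of 1] True by (metis emptyE zero_less_one)
  next
    case False
    obtain v0 where "v0 \<in> S \<times> X" "\<forall>v\<in>S \<times> X. F N v0 \<le> F N v"
      using continuous_attains_inf[OF comp False cont] by metis
    then show ?thesis using that[of "F N v0"] FN by blast
  qed
  have key: "\<kappa> * weight L b (oproj W) \<le> weight L b (reach N \<sigma>)" if \<sigma>: "\<sigma> \<in> S" for \<sigma> b
  proof -
    have \<sigma>': "positive_op \<sigma>" "\<sigma> \<in> block W" using \<sigma> by (auto simp: S_def)
    have rb: "reach N \<sigma> \<in> block W"
      unfolding reach_def by (intro subspace_sum subspace_block path_op_block[OF e] \<sigma>')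
    have rp: "positive_op (reach N \<sigma>)" by (rule reach_positive[OF \<sigma>'(1)])
    have "positive_op (reach N \<sigma> - \<kappa> *\<^sub>R oproj W)"
    proof (rule positive_op_blockI[OF sub])
      show "reach N \<sigma> - \<kappa> *\<^sub>R oproj W \<in> block W"
        by (intro subspace_diff subspace_scale subspace_block rb) (simp add: block_iff[OF sub] oproj_idem[OF sub])
      fix y assume y: "y \<in> W"
      have "cinner y ((reach N \<sigma> - \<kappa> *\<^sub>R oproj W) *v y) = complex_of_real (quad (reach N \<sigma>) y - \<kappa> * (norm y)\<^sup>2)"
        using positive_op_cinner_real[OF rp, of y] cinner_self[of y]
        by (simp add: mat_vec_simps cinner_simps oproj_fix[OF sub y]) (simp add: scaleR_conv_of_real)
      moreover have "\<kappa> * (norm y)\<^sup>2 \<le> quad (reach N \<sigma>) y"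
      proof (cases "y = 0")
        case False
        then have "sgn y \<in> X" using y subspace_of_vec_subspace[OF sub]
          by (simp add: X_def sgn_div_norm subspace_scale)
        then have "\<kappa> \<le> F N (\<sigma>, sgn y)" using \<sigma> by (intro k(2)) simp
        then have "\<kappa> * (norm y)\<^sup>2 \<le> F N (\<sigma>, sgn y) * (norm y)\<^sup>2" by (intro mult_right_mono) auto
        also have "\<dots> = quad (reach N \<sigma>) y"
          using False by (simp add: F_def sgn_div_norm mat_vec_simps cinner_simps power2_eq_square field_simps)
        finally show ?thesis .
      qed (simp add: cinner_simps)
      ultimately show "cinner y ((reach N \<sigma> - \<kappa> *\<^sub>R oproj W) *v y) \<in> \<real> \<and>
          0 \<le> quad (reach N \<sigma> - \<kappa> *\<^sub>R oproj W) y"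
        by (simp del: of_real_diff)
    qed
    from weight_mono[OF this, of L b] show ?thesis by (simp add: linear_scale[OF weight_linear])
  qed
  have "\<kappa> * Re (trace \<sigma>) * weight L b (oproj W) \<le> (\<Sum>l\<le>N. \<Sum>c | length c = l. weight L (c @ b) \<sigma>)"
    if \<sigma>: "positive_op \<sigma>" "\<sigma> \<in> block W" for \<sigma> b
  proof (cases "\<sigma> = 0")
    case True
    then show ?thesis by (simp add: trace_simps linear_0[OF weight_linear])
  next
    case False
    define t where "t = Re (trace \<sigma>)"
    have t: "0 < t" unfolding t_def by (rule positive_op_trace_pos[OF \<sigma>(1) False])
    have "trace ((1 / t) *\<^sub>R \<sigma>) = 1"
      using positive_op_trace_scaleR[OF \<sigma>(1), of "1 / t"] t by (simp add: t_def)
    then have "(1 / t) *\<^sub>R \<sigma> \<in> S"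
      using \<sigma> t by (simp add: S_def positive_op_scaleR subspace_scale[OF subspace_block])
    from key[OF this, of b] have "\<kappa> * weight L b (oproj W) \<le> (1 / t) * (\<Sum>l\<le>N. \<Sum>c | length c = l. weight L (c @ b) \<sigma>)"
      unfolding weight_reach by (simp add: linear_scale[OF weight_linear] sum_divide_distrib)
    then show ?thesis using t by (simp add: t_def[symmetric] field_simps)
  qed
  then show ?thesis using that k(1) by blast
qed

end

section \<open>A lower bound of Cramer type\<close>

text \<open>Transfer operator of a walk with steps \<open>v a\<close> and unnormalised weights
  \<open>g a\<close>: its \<open>k\<close>-th power, applied to an indicator and evaluated at
  \<open>0\<close>, is the product weight of all \<open>k\<close>-tuples of blocks whose total
  displacement hits the set.\<close>

definition block_op :: "'a set \<Rightarrow> ('a \<Rightarrow> real) \<Rightarrow> ('a \<Rightarrow> 'e::euclidean_space) \<Rightarrow> ('e \<Rightarrow> real) \<Rightarrow> 'e \<Rightarrow> real" where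
  "block_op A g v f y = (\<Sum>a\<in>A. g a * f (y + v a))"

lemma block_op_mono:
  assumes "\<And>a. a \<in> A \<Longrightarrow> 0 \<le> g a" "\<And>y. f y \<le> f' y"
  shows "(block_op A g v ^^ k) f y \<le> (block_op A g v ^^ k) f' y"
proof (induction k arbitrary: y)
  case (Suc k)
  then show ?case by (simp add: block_op_def) (intro sum_mono mult_left_mono assms Suc)
qed (simp add: assms)

lemma block_op_nonneg:
  assumes "\<And>a. a \<in> A \<Longrightarrow> 0 \<le> g a" "\<And>y. 0 \<le> f y"
  shows "0 \<le> (block_op A g v ^^ k) f y"
proof (induction k arbitrary: y)
  case (Suc k)
  then show ?case by (simp add: block_op_def) (intro sum_nonneg mult_nonneg_nonneg assms Suc)
qed (simp add: assms)

lemma block_op_scale: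
  "(block_op A g v ^^ k) (\<lambda>y. c * f y) y = c * (block_op A g v ^^ k) f y"
proof (induction k arbitrary: y)
  case (Suc k)
  then show ?case by (simp add: block_op_def sum_distrib_left algebra_simps)
qed simp

text \<open>Tilted concave quadratics are stable under the block operator. Bounding an indicator below by one
  of them and iterating explicitly replaces the weak law of large numbers under the tilted measure.\<close>

lemma block_op_tilted_quadratic:
  fixes v :: "'a \<Rightarrow> 'e::euclidean_space"
  assumes Z: "Z = (\<Sum>a\<in>A. g a * exp (u \<bullet> v a))" "Z \<noteq> 0"
    and c: "c = (\<Sum>a\<in>A. (g a * exp (u \<bullet> v a) / Z) *\<^sub>R v a)"
    and q: "q = (\<Sum>a\<in>A. g a * exp (u \<bullet> v a) / Z * (norm (v a - c))\<^sup>2)"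
  shows "(block_op A g v ^^ k) (\<lambda>z. exp (u \<bullet> z) * (\<alpha> - \<theta> * (norm (z - b))\<^sup>2)) y =
    Z ^ k * (exp (u \<bullet> y) * (\<alpha> - \<theta> * ((norm (y + real k *\<^sub>R c - b))\<^sup>2 + real k * q)))"
proof (induction k arbitrary: y)
  case (Suc k)
  define p where "p a = g a * exp (u \<bullet> v a) / Z" for a
  have p1: "(\<Sum>a\<in>A. p a) = 1" using Z by (simp add: p_def sum_divide_distrib[symmetric])
  have pc: "(\<Sum>a\<in>A. p a *\<^sub>R (v a - c)) = 0"
    using p1 by (simp add: scaleR_diff_right sum_subtractf c p_def scaleR_left.sum[symmetric])
  have qp: "(\<Sum>a\<in>A. p a * (norm (v a - c))\<^sup>2) = q" by (simp add: q p_def)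
  define w where "w = y + c + real k *\<^sub>R c - b"
  have nrm: "(norm (y + v a + real k *\<^sub>R c - b))\<^sup>2 = (norm w)\<^sup>2 + 2 * (w \<bullet> (v a - c)) + (norm (v a - c))\<^sup>2" for a
  proof -
    have *: "y + v a + real k *\<^sub>R c - b = w + (v a - c)" by (simp add: w_def)
    show ?thesis unfolding * power2_norm_eq_inner
      by (simp only: inner_add_left inner_add_right) (simp add: inner_commute)
  qed
  have "(\<Sum>a\<in>A. p a * (\<alpha> - \<theta> * ((norm (y + v a + real k *\<^sub>R c - b))\<^sup>2 + real k * q))) =
     \<alpha> * (\<Sum>a\<in>A. p a) - \<theta> * ((norm w)\<^sup>2 * (\<Sum>a\<in>A. p a) + 2 * (w \<bullet> (\<Sum>a\<in>A. p a *\<^sub>R (v a - c)))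
        + (\<Sum>a\<in>A. p a * (norm (v a - c))\<^sup>2) + real k * q * (\<Sum>a\<in>A. p a))"
    unfolding nrm by (simp add: inner_sum_right sum_distrib_left sum_distrib_right sum.distrib sum_subtractf algebra_simps)
  also have "\<dots> = \<alpha> - \<theta> * ((norm w)\<^sup>2 + real (Suc k) * q)"
    unfolding p1 pc qp by (simp add: algebra_simps)
  finally have s: "(\<Sum>a\<in>A. p a * (\<alpha> - \<theta> * ((norm (y + v a + real k *\<^sub>R c - b))\<^sup>2 + real k * q))) =
     \<alpha> - \<theta> * ((norm (y + real (Suc k) *\<^sub>R c - b))\<^sup>2 + real (Suc k) * q)"
    by (simp add: w_def algebra_simps)
  have gp: "g a * exp (u \<bullet> v a) = Z * p a" for a using Z by (simp add: p_def)
  have "(block_op A g v ^^ Suc k) (\<lambda>z. exp (u \<bullet> z) * (\<alpha> - \<theta> * (norm (z - b))\<^sup>2)) y =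
     (\<Sum>a\<in>A. g a * (Z ^ k * (exp (u \<bullet> (y + v a)) * (\<alpha> - \<theta> * ((norm (y + v a + real k *\<^sub>R c - b))\<^sup>2 + real k * q)))))"
    by (simp add: block_op_def[of A g v "(block_op A g v ^^ k) _"] Suc)
  also have "\<dots> = Z ^ k * (exp (u \<bullet> y) * (\<Sum>a\<in>A. (g a * exp (u \<bullet> v a)) * (\<alpha> - \<theta> * ((norm (y + v a + real k *\<^sub>R c - b))\<^sup>2 + real k * q))))"
    unfolding sum_distrib_left by (intro sum.cong refl) (simp add: inner_add_right exp_add)
  also have "\<dots> = Z ^ Suc k * (exp (u \<bullet> y) * (\<Sum>a\<in>A. p a * (\<alpha> - \<theta> * ((norm (y + v a + real k *\<^sub>R c - b))\<^sup>2 + real k * q))))"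
    unfolding gp sum_distrib_left by (intro sum.cong refl) simp
  finally show ?case unfolding s .
qed simp

text \<open>The quadratic penalty makes the minimum over \<open>u\<close> attained even when the Legendre supremum is
  not; the price is that the tilted mean is only close to \<open>x\<close>.\<close>

lemma ex_tilt:
  fixes v :: "'a \<Rightarrow> 'e::euclidean_space"
  assumes A: "finite A" and g: "\<And>a. a \<in> A \<Longrightarrow> 0 \<le> g a" and g0: "0 < (\<Sum>a\<in>A. g a)"
    and l: "\<And>u. u \<bullet> x - ln (\<Sum>a\<in>A. g a * exp (u \<bullet> v a)) \<le> l" and \<epsilon>: "0 < \<epsilon>"
  obtains u Z c where "Z = (\<Sum>a\<in>A. g a * exp (u \<bullet> v a))" "0 < Z"
    "c = (\<Sum>a\<in>A. (g a * exp (u \<bullet> v a) / Z) *\<^sub>R v a)" "norm (c - x) < \<epsilon>" "u \<bullet> c - ln Z \<le> l"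
proof -
  define Z where "Z u = (\<Sum>a\<in>A. g a * exp (u \<bullet> v a))" for u
  have Zp: "0 < Z u" for u
  proof -
    obtain a where a: "a \<in> A" "0 < g a"
      using g0 g by (metis less_eq_real_def sum.neutral less_irrefl)
    have "0 < g a * exp (u \<bullet> v a)" using a by simp
    also have "\<dots> \<le> Z u" unfolding Z_def using a g by (intro member_le_sum) (auto simp: A)
    finally show ?thesis .
  qed
  define K where "K = ln (Z 0) + l"
  have K0: "0 \<le> K" using l[of 0] by (simp add: K_def Z_def)
  \<comment> \<open>Chosen for the final estimate: the gradient equation gives
    \<open>norm (c - x) = 2 * \<eta> * norm u\<close>, and
    \<open>\<eta> * (norm u)\<^sup>2 \<le> K\<close>, so the squared distance is at most
    \<open>4 * \<eta> * K\<close>, which is below \<open>\<epsilon>\<^sup>2\<close>.\<close>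
  define \<eta> where "\<eta> = \<epsilon>\<^sup>2 / (8 * (K + 1))"
  have \<eta>: "0 < \<eta>" using \<epsilon> K0 by (simp add: \<eta>_def)
  define F where "F u = ln (Z u) - u \<bullet> x + \<eta> * (norm u)\<^sup>2" for u
  have Fge: "\<eta> * (norm u)\<^sup>2 - l \<le> F u" for u using l[of u] by (simp add: F_def Z_def)
  have F0: "F 0 = K - l" by (simp add: F_def K_def)
  \<comment> \<open>Beyond this radius the penalty is at least \<open>K + 1\<close>, so
    \<open>F\<close> is at least \<open>K + 1 - l\<close> there, above \<open>F 0 = K - l\<close>;
    the minimum over the ball is therefore global.\<close>
  define R where "R = sqrt ((K + 1) / \<eta>)"
  have R0: "0 < R" using \<eta> K0 by (simp add: R_def)
  have contZ: "continuous_on S Z" for S unfolding Z_def by (intro continuous_intros)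
  have cont: "continuous_on (cball 0 R) F"
    unfolding F_def using Zp by (intro continuous_intros contZ) (simp add: less_imp_neq[symmetric])
  obtain u where u: "u \<in> cball 0 R" "\<forall>w\<in>cball 0 R. F u \<le> F w"
    using continuous_attains_inf[OF compact_cball _ cont] R0 by (metis cball_eq_empty less_le_not_le not_less)
  have min: "F u \<le> F w" for w
  proof (cases "w \<in> cball 0 R")
    case False
    then have "R\<^sup>2 \<le> (norm w)\<^sup>2" using R0 by (intro power_mono) auto
    then have "\<eta> * R\<^sup>2 \<le> \<eta> * (norm w)\<^sup>2" using \<eta> by simp
    moreover have "\<eta> * R\<^sup>2 = K + 1" using \<eta> K0 by (simp add: R_def)
    ultimately have "F 0 \<le> F w" using Fge[of w] F0 by linarith
    moreover have "F u \<le> F 0" using u R0 by simp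
    ultimately show ?thesis by linarith
  qed (use u in blast)
  define c where "c = (\<Sum>a\<in>A. (g a * exp (u \<bullet> v a) / Z u) *\<^sub>R v a)"
  have grad: "(c - x + (2 * \<eta>) *\<^sub>R u) \<bullet> d = 0" for d
  proof -
    define \<phi> where "\<phi> t = F (u + t *\<^sub>R d)" for t :: real
    have Zt: "Z (u + t *\<^sub>R d) = (\<Sum>a\<in>A. g a * exp (u \<bullet> v a + t * (d \<bullet> v a)))" for t
      by (simp add: Z_def inner_add_left)
    have dZ: "((\<lambda>t. Z (u + t *\<^sub>R d)) has_real_derivative (\<Sum>a\<in>A. g a * exp (u \<bullet> v a) * (d \<bullet> v a))) (at 0)"
      unfolding Zt by (auto intro!: derivative_eq_intros sum.cong)
    have nrm: "(norm (u + t *\<^sub>R d))\<^sup>2 = (norm u)\<^sup>2 + 2 * t * (u \<bullet> d) + t\<^sup>2 * (norm d)\<^sup>2" for t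
      unfolding power2_norm_eq_inner
      by (simp add: inner_add_left inner_add_right inner_commute) (simp add: power2_eq_square)
    have "(\<phi> has_real_derivative
        ((\<Sum>a\<in>A. g a * exp (u \<bullet> v a) * (d \<bullet> v a)) / Z u - d \<bullet> x + \<eta> * (2 * (u \<bullet> d)))) (at 0)"
      unfolding \<phi>_def F_def nrm inner_add_left inner_scaleR_left
      by (auto intro!: derivative_eq_intros dZ simp: Zp field_simps)
    moreover have "\<forall>t. \<bar>0 - t\<bar> < 1 \<longrightarrow> \<phi> 0 \<le> \<phi> t" using min by (simp add: \<phi>_def)
    ultimately have "(\<Sum>a\<in>A. g a * exp (u \<bullet> v a) * (d \<bullet> v a)) / Z u - d \<bullet> x + \<eta> * (2 * (u \<bullet> d)) = 0"
      by (intro DERIV_local_min[of \<phi> _ 0 1]) auto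
    moreover have "c \<bullet> d = (\<Sum>a\<in>A. g a * exp (u \<bullet> v a) * (d \<bullet> v a)) / Z u"
      by (simp add: c_def inner_sum_left sum_divide_distrib) (simp add: inner_commute)
    ultimately show ?thesis
      unfolding inner_add_left inner_diff_left inner_scaleR_left inner_commute[of x d] by linarith
  qed
  have cx: "c - x = - ((2 * \<eta>) *\<^sub>R u)"
    using grad[of "c - x + (2 * \<eta>) *\<^sub>R u"] by (simp add: eq_neg_iff_add_eq_0)
  show ?thesis
  proof (rule that[of "Z u" u c])
    show "Z u = (\<Sum>a\<in>A. g a * exp (u \<bullet> v a))" by (simp add: Z_def)
    show "0 < Z u" by (rule Zp)
    show "c = (\<Sum>a\<in>A. (g a * exp (u \<bullet> v a) / Z u) *\<^sub>R v a)" by (rule c_def)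
    have "\<eta> * (norm u)\<^sup>2 \<le> K" using Fge[of u] min[of 0] F0 by linarith
    then have "4 * \<eta> * (\<eta> * (norm u)\<^sup>2) \<le> 4 * \<eta> * K" using \<eta> by (intro mult_left_mono) auto
    also have "\<dots> = \<epsilon>\<^sup>2 * (K / (2 * (K + 1)))" using K0 by (simp add: \<eta>_def field_simps)
    also have "\<dots> < \<epsilon>\<^sup>2 * 1" using K0 \<epsilon> by (intro mult_strict_left_mono) (auto simp: field_simps)
    finally have "(norm (c - x))\<^sup>2 < \<epsilon>\<^sup>2"
      by (simp add: cx power2_eq_square algebra_simps)
    then show "norm (c - x) < \<epsilon>" using \<epsilon> by (simp add: power2_less_imp_less)
    have "u \<bullet> c - ln (Z u) = u \<bullet> x - ln (Z u) + u \<bullet> (c - x)" by (simp add: inner_diff_right)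
    \<comment> \<open>The penalty pushes the tilted mean against \<open>u\<close>, so replacing
      \<open>x\<close> by \<open>c\<close> can only lower the exponent.\<close>
    also have "u \<bullet> (c - x) = - (2 * \<eta> * (norm u)\<^sup>2)" by (simp add: cx power2_norm_eq_inner)
    also have "u \<bullet> x - ln (Z u) + - (2 * \<eta> * (norm u)\<^sup>2) \<le> u \<bullet> x - ln (Z u)" using \<eta> by simp
    also have "\<dots> \<le> l" using l[of u] by (simp add: Z_def)
    finally show "u \<bullet> c - ln (Z u) \<le> l" .
  qed
qed

text \<open>The indicator is bounded below by a tilted concave quadratic centred at \<open>k\<close>
  times the tilted mean, whose iterate is explicit. The factor
  \<open>1 - q / (real k * d\<^sup>2)\<close> is Chebyshev's estimate for the tilted walk.\<close>

lemma block_op_lower_bound: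
  fixes v :: "'a \<Rightarrow> 'e::euclidean_space"
  assumes A: "finite A" and g: "\<And>a. a \<in> A \<Longrightarrow> 0 \<le> g a" and g0: "0 < (\<Sum>a\<in>A. g a)"
    and l: "\<And>u. u \<bullet> x - ln (\<Sum>a\<in>A. g a * exp (u \<bullet> v a)) \<le> l" and \<epsilon>: "0 < \<epsilon>" and \<delta>: "0 < \<delta>"
  shows "\<forall>\<^sub>F k in sequentially. exp (- real k * (l + \<delta>)) \<le>
    (block_op A g v ^^ k) (indicat_real (ball (real k *\<^sub>R x) (real k * \<epsilon>))) 0"
proof -
  obtain u Z c where Z: "Z = (\<Sum>a\<in>A. g a * exp (u \<bullet> v a))" "0 < Z"
    and c: "c = (\<Sum>a\<in>A. (g a * exp (u \<bullet> v a) / Z) *\<^sub>R v a)" "norm (c - x) < \<epsilon> / 2" "u \<bullet> c - ln Z \<le> l"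
    by (rule ex_tilt[OF A g g0 l half_gt_zero[OF \<epsilon>]])
  define q where "q = (\<Sum>a\<in>A. g a * exp (u \<bullet> v a) / Z * (norm (v a - c))\<^sup>2)"
  \<comment> \<open>The radius per block: half of \<open>\<epsilon>\<close> keeps the smaller ball
    inside the target, and the second entry limits the cost of removing the tilt to
    \<open>\<delta> / 2\<close> per block.\<close>
  define d where "d = min (\<epsilon> / 2) (\<delta> / (2 * (norm u + 1)))"
  have d: "0 < d" "d \<le> \<epsilon> / 2"
    unfolding d_def using \<epsilon> \<delta> by (simp_all add: add_nonneg_pos del: divide_const_simps)
  have du: "d * norm u \<le> \<delta> / 2"
  proof -
    have "d * norm u \<le> \<delta> / (2 * (norm u + 1)) * (norm u + 1)"
      using d \<delta> by (intro mult_mono) (auto simp: d_def)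
    also have "\<dots> = \<delta> / 2"
    proof -
      have "\<delta> / (2 * X) * X = \<delta> / 2" if "0 < X" for X using that by simp
      from this[of "norm u + 1"] show ?thesis using norm_ge_zero[of u] by linarith
    qed
    finally show ?thesis .
  qed
  have bound: "exp (- real k * (l + \<delta> / 2)) * (1 - q / (real k * d\<^sup>2)) \<le>
      (block_op A g v ^^ k) (indicat_real (ball (real k *\<^sub>R x) (real k * \<epsilon>))) 0"
    if k: "0 < k" and qk: "q / (real k * d\<^sup>2) \<le> 1" for k
  proof -
    \<comment> \<open>\<open>\<theta>\<close> makes the quadratic vanish at distance
      \<open>real k * d\<close> from the centre \<open>b\<close> and negative beyond;
      \<open>C\<close> makes the scaled exponential at most one within that distance.\<close>
    define \<theta> where "\<theta> = 1 / (real k * d)\<^sup>2"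
    define b where "b = real k *\<^sub>R c"
    define C where "C = exp (- real k * (d * norm u + u \<bullet> c))"
    have pt: "C * (exp (u \<bullet> z) * (1 - \<theta> * (norm (z - b))\<^sup>2)) \<le> indicat_real (ball (real k *\<^sub>R x) (real k * \<epsilon>)) z" for z
    proof (cases "norm (z - b) < real k * d")
      case True
      have "dist (real k *\<^sub>R x) z = norm ((z - b) + real k *\<^sub>R (c - x))"
        by (simp add: dist_norm b_def algebra_simps norm_minus_commute)
      also have "\<dots> \<le> norm (z - b) + real k * norm (c - x)"
        using norm_triangle_ineq[of "z - b" "real k *\<^sub>R (c - x)"] by simp
      also have "\<dots> < real k * d + real k * (\<epsilon> / 2)"
        using True c(2) k by (intro add_strict_mono) simp_all
      also have "\<dots> \<le> real k * (\<epsilon> / 2) + real k * (\<epsilon> / 2)"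
        by (intro add_right_mono mult_left_mono d(2)) simp
      finally have "z \<in> ball (real k *\<^sub>R x) (real k * \<epsilon>)" by (simp add: algebra_simps)
      moreover have "C * exp (u \<bullet> z) \<le> 1"
      proof -
        have "u \<bullet> (z - b) \<le> norm u * norm (z - b)" by (rule norm_cauchy_schwarz)
        also have "\<dots> \<le> norm u * (real k * d)" using True by (intro mult_left_mono) auto
        finally have "u \<bullet> z \<le> real k * (d * norm u + u \<bullet> c)" by (simp add: b_def inner_diff_right algebra_simps)
        then show ?thesis by (simp add: C_def exp_add[symmetric])
      qed
      moreover have "1 - \<theta> * (norm (z - b))\<^sup>2 \<le> 1" by (simp add: \<theta>_def)
      moreover have "0 \<le> 1 - \<theta> * (norm (z - b))\<^sup>2"
      proof -
        have "(norm (z - b))\<^sup>2 \<le> (real k * d)\<^sup>2" using True by (intro power_mono) auto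
        then show ?thesis using k d by (simp add: \<theta>_def field_simps)
      qed
      moreover have "0 \<le> C * exp (u \<bullet> z)" by (simp add: C_def)
      ultimately show ?thesis using mult_mono[of "C * exp (u \<bullet> z)" 1 "1 - \<theta> * (norm (z - b))\<^sup>2" 1]
        by (simp add: mult.assoc)
    next
      case False
      have "(real k * d)\<^sup>2 \<le> (norm (z - b))\<^sup>2" using False d k by (intro power_mono) auto
      then have "1 - \<theta> * (norm (z - b))\<^sup>2 \<le> 0" using k d by (simp add: \<theta>_def field_simps)
      then have "C * (exp (u \<bullet> z) * (1 - \<theta> * (norm (z - b))\<^sup>2)) \<le> 0"
        by (intro mult_nonneg_nonpos) (auto simp: C_def)
      then show ?thesis by (rule order_trans) simp
    qed
    have "(block_op A g v ^^ k) (\<lambda>z. C * (exp (u \<bullet> z) * (1 - \<theta> * (norm (z - b))\<^sup>2))) 0 =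
        C * (Z ^ k * (1 - \<theta> * (real k * q)))"
      unfolding block_op_scale using block_op_tilted_quadratic[OF Z(1) _ c(1) q_def, of k 1 \<theta> b 0] Z(2)
      by (simp add: b_def)
    moreover have "\<theta> * (real k * q) = q / (real k * d\<^sup>2)"
      using k d by (simp add: \<theta>_def power2_eq_square field_simps)
    moreover have "C * Z ^ k = exp (- real k * (d * norm u + (u \<bullet> c - ln Z)))"
    proof -
      have "Z ^ k = exp (real k * ln Z)" using Z(2) by (simp add: exp_of_nat_mult)
      then show ?thesis by (simp add: C_def exp_add[symmetric] algebra_simps)
    qed
    ultimately have "(block_op A g v ^^ k) (\<lambda>z. C * (exp (u \<bullet> z) * (1 - \<theta> * (norm (z - b))\<^sup>2))) 0 =
        exp (- real k * (d * norm u + (u \<bullet> c - ln Z))) * (1 - q / (real k * d\<^sup>2))"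
      by (simp add: mult.assoc[symmetric])
    moreover have "exp (- real k * (l + \<delta> / 2)) \<le> exp (- real k * (d * norm u + (u \<bullet> c - ln Z)))"
      using du c(3) k by simp
    ultimately have "exp (- real k * (l + \<delta> / 2)) * (1 - q / (real k * d\<^sup>2)) \<le>
        (block_op A g v ^^ k) (\<lambda>z. C * (exp (u \<bullet> z) * (1 - \<theta> * (norm (z - b))\<^sup>2))) 0"
      using qk by (simp only:) (intro mult_right_mono, simp_all)
    also have "\<dots> \<le> (block_op A g v ^^ k) (indicat_real (ball (real k *\<^sub>R x) (real k * \<epsilon>))) 0"
      by (rule block_op_mono[OF g pt])
    finally show ?thesis .
  qed
  have "((\<lambda>k. q / (real k * d\<^sup>2)) \<longlongrightarrow> 0) sequentially"
  proof -
    have "((\<lambda>k. (q / d\<^sup>2) * inverse (real k)) \<longlongrightarrow> (q / d\<^sup>2) * 0) sequentially"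
      by (intro tendsto_mult tendsto_const lim_inverse_n)
    then show ?thesis by (simp add: field_simps)
  qed
  then have e1: "\<forall>\<^sub>F k in sequentially. q / (real k * d\<^sup>2) < 1 / 2" by (rule order_tendstoD) simp
  \<comment> \<open>The other half of \<open>\<delta>\<close> absorbs the Chebyshev factor, which is
    only bounded below by one half.\<close>
  have "((\<lambda>k. exp (- (\<delta> / 2) * real k)) \<longlongrightarrow> 0) sequentially"
  proof (rule filterlim_compose[OF exp_at_bot])
    show "filterlim (\<lambda>k. - (\<delta> / 2) * real k) at_bot sequentially"
      using \<delta> by (intro filterlim_tendsto_neg_mult_at_bot[OF tendsto_const _ filterlim_real_sequentially]) simp
  qed
  then have e2: "\<forall>\<^sub>F k in sequentially. exp (- (\<delta> / 2) * real k) < 1 / 2" by (rule order_tendstoD) simp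
  show ?thesis using e1 e2 eventually_gt_at_top[of 0]
  proof eventually_elim
    case (elim k)
    have "exp (- real k * (l + \<delta>)) = exp (- real k * (l + \<delta> / 2)) * exp (- (\<delta> / 2) * real k)"
      by (simp add: exp_add[symmetric] algebra_simps)
    also have "\<dots> \<le> exp (- real k * (l + \<delta> / 2)) * (1 - q / (real k * d\<^sup>2))"
      using elim by (intro mult_left_mono) auto
    also have "\<dots> \<le> (block_op A g v ^^ k) (indicat_real (ball (real k *\<^sub>R x) (real k * \<epsilon>))) 0"
    proof (rule bound)
      show "q / (real k * d\<^sup>2) \<le> 1" using elim(1) by linarith
    qed (use elim in simp)
    finally show ?case .
  qed
qed

section \<open>Exponential bounds on a minimal enclosure\<close>

context deformed_walk
begin

abbreviation "word_block W m \<equiv> block_op {a. length a = m} (\<lambda>a. weight L a (oproj W)) disp"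

text \<open>A word of length \<open>n\<close> is read as \<open>k\<close> rounds, each a connecting
  word of at most \<open>N\<close> letters followed by a block of exactly \<open>m\<close>, and a
  free tail. The \<open>n - k * m\<close> letters outside the blocks move the endpoint by at most
  \<open>C\<close> each, which is the thickening of \<open>R\<close>. Decoupling costs
  \<open>\<kappa>\<close> per round, and \<open>Suc N\<close> counts the possible lengths of the
  connecting word.\<close>

lemma word_block_lower:
  fixes N :: nat and \<kappa> :: real
  defines "C \<equiv> \<Sum>i\<in>UNIV. norm (s i)"
  assumes e: "enclosure L W" and \<kappa>: "0 < \<kappa>"
    and dec: "\<And>\<sigma> b. positive_op \<sigma> \<Longrightarrow> \<sigma> \<in> block W \<Longrightarrow>
       \<kappa> * Re (trace \<sigma>) * weight L b (oproj W) \<le> (\<Sum>l\<le>N. \<Sum>c | length c = l. weight L (c @ b) \<sigma>)"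
    and "positive_op \<sigma>" "\<sigma> \<in> block W" "k * (m + N) \<le> n"
  shows "(\<kappa> / real (Suc N)) ^ k * Re (trace \<sigma>) * (word_block W m ^^ k) (indicat_real R) y \<le>
    (\<Sum>a | length a = n. indicat_real {z. \<exists>r\<in>R. dist z r \<le> C * real (n - k * m)} (y + disp a) * weight L a \<sigma>)"
  using assms(5,6,7)
proof (induction k arbitrary: n \<sigma> y)
  case 0
  show ?case
  proof (cases "y \<in> R")
    case True
    have "\<exists>r\<in>R. dist (y + disp a) r \<le> C * real n" if "length a = n" for a
      using norm_displacement[of a] True that by (intro bexI[of _ y]) (auto simp: dist_norm C_def)
    then have "(\<Sum>a | length a = n. indicat_real {z. \<exists>r\<in>R. dist z r \<le> C * real n} (y + disp a) * weight L a \<sigma>) =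
        (\<Sum>a | length a = n. weight L a \<sigma>)"
      by (intro sum.cong) (auto simp: indicator_def)
    then show ?thesis using True by (simp add: sum_weight)
  next
    case False
    then show ?thesis by (auto intro!: sum_nonneg mult_nonneg_nonneg weight_nonneg 0)
  qed
next
  case (Suc k)
  have sub: "vec.subspace W" using e by (rule enclosure_subspace)
  have C0: "0 \<le> C" by (simp add: C_def sum_nonneg)
  define \<kappa>' where "\<kappa>' = \<kappa> / real (Suc N)"
  have k': "0 < \<kappa>'" using \<kappa> by (simp add: \<kappa>'_def)
  define B where "B = (word_block W m ^^ k) (indicat_real R)"
  have B0: "0 \<le> B y" for y
    unfolding B_def by (intro block_op_nonneg weight_nonneg positive_oproj sub) auto
  define T where "T n k = {z. \<exists>r\<in>R. dist z r \<le> C * real (n - k * m)}" for n k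
  define RHS where "RHS = (\<Sum>a | length a = n. indicat_real (T n (Suc k)) (y + disp a) * weight L a \<sigma>)"
  define X where "X l = (\<Sum>c | length c = l. \<Sum>a | length a = m. \<kappa>' ^ k * B (y + disp a) * weight L (c @ a) \<sigma>)" for l
  \<comment> \<open>For a fixed length \<open>l\<close> of the connecting word, splitting words of
    length \<open>n\<close> into parts of lengths \<open>l\<close>, \<open>m\<close> and
    \<open>n'\<close> is a bijection, so nothing is counted twice. Different \<open>l\<close> do
    overlap, hence the average over \<open>Suc N\<close> lengths below.\<close>
  have X: "X l \<le> RHS" if l: "l \<le> N" for l
  proof -
    define n' where "n' = n - (l + m)"
    have n: "n = l + (m + n')" and n': "k * (m + N) \<le> n'" using Suc.prems(3) l by (auto simp: n'_def)
    have kn: "k * m \<le> n'" using n' by (simp add: algebra_simps)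
    have "X l \<le> (\<Sum>c | length c = l. \<Sum>a | length a = m. \<Sum>b | length b = n'.
        indicat_real (T n (Suc k)) (y + disp (c @ a @ b)) * weight L (c @ a @ b) \<sigma>)"
      unfolding X_def
    proof (intro sum_mono)
      fix c a :: "'j list" assume "c \<in> {c. length c = l}" "a \<in> {a. length a = m}"
      then have len: "length c = l" "length a = m" by auto
      let ?\<sigma> = "path_op L (c @ a) ** \<sigma> ** cadj (path_op L (c @ a))"
      have pos: "positive_op ?\<sigma>" and blk: "?\<sigma> \<in> block W"
        by (intro positive_op_conj path_op_block[OF e] Suc.prems)+
      have "\<kappa>' ^ k * B (y + disp a) * weight L (c @ a) \<sigma> =
          \<kappa>' ^ k * Re (trace ?\<sigma>) * B (y + disp a)" by (simp add: weight_def)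
      also have "\<dots> \<le> (\<Sum>b | length b = n'. indicat_real (T n' k) (y + disp a + disp b) * weight L b ?\<sigma>)"
        unfolding B_def \<kappa>'_def T_def by (rule Suc.IH[OF pos blk n'])
      also have "\<dots> \<le> (\<Sum>b | length b = n'. indicat_real (T n (Suc k)) (y + disp (c @ a @ b)) * weight L (c @ a @ b) \<sigma>)"
      proof (intro sum_mono)
        fix b assume "b \<in> {b :: 'j list. length b = n'}"
        have "y + disp (c @ a @ b) \<in> T n (Suc k)" if mem: "y + disp a + disp b \<in> T n' k"
        proof -
          obtain r where r: "r \<in> R" "dist (y + disp a + disp b) r \<le> C * real (n' - k * m)"
            using mem unfolding T_def by blast
          have "dist (y + disp (c @ a @ b)) r \<le>
              norm (disp c) + dist (y + disp a + disp b) r"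
            using norm_triangle_ineq[of "disp c" "y + disp a + disp b - r"]
            by (simp add: dist_norm algebra_simps)
          also have "\<dots> \<le> C * real l + C * real (n' - k * m)"
            using norm_displacement[of c] r len by (intro add_mono) (auto simp: C_def)
          also have "\<dots> = C * real (n - Suc k * m)"
            using kn by (simp add: n of_nat_diff algebra_simps)
          finally show ?thesis using r by (auto simp: T_def)
        qed
        then have "indicat_real (T n' k) (y + disp a + disp b) \<le>
            indicat_real (T n (Suc k)) (y + disp (c @ a @ b))"
          by (auto simp: indicator_def)
        moreover have "weight L b ?\<sigma> = weight L (c @ a @ b) \<sigma>"
          using weight_append[of L "c @ a" b \<sigma>] by simp
        ultimately show "indicat_real (T n' k) (y + disp a + disp b) * weight L b ?\<sigma> \<le>
            indicat_real (T n (Suc k)) (y + disp (c @ a @ b)) * weight L (c @ a @ b) \<sigma>"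
          by (auto intro!: mult_right_mono weight_nonneg Suc.prems)
      qed
      finally show "\<kappa>' ^ k * B (y + disp a) * weight L (c @ a) \<sigma> \<le>
        (\<Sum>b | length b = n'. indicat_real (T n (Suc k)) (y + disp (c @ a @ b)) * weight L (c @ a @ b) \<sigma>)" .
    qed
    also have "\<dots> = RHS" unfolding RHS_def n sum_words_append ..
    finally show ?thesis .
  qed
  have "\<kappa>' ^ Suc k * Re (trace \<sigma>) * (word_block W m ^^ Suc k) (indicat_real R) y =
      (\<Sum>a | length a = m. \<kappa>' ^ k * B (y + disp a) * (1 / real (Suc N)) * (\<kappa> * Re (trace \<sigma>) * weight L a (oproj W)))"
    unfolding funpow.simps o_apply B_def[symmetric] block_op_def[of _ _ _ B]
    by (simp add: sum_distrib_left \<kappa>'_def mult_ac)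
  also have "\<dots> \<le> (\<Sum>a | length a = m. \<kappa>' ^ k * B (y + disp a) * (1 / real (Suc N)) *
      (\<Sum>l\<le>N. \<Sum>c | length c = l. weight L (c @ a) \<sigma>))"
    using k' B0 by (intro sum_mono mult_left_mono dec Suc.prems mult_nonneg_nonneg) auto
  also have "\<dots> = (\<Sum>a | length a = m. \<Sum>l\<le>N. (1 / real (Suc N)) * (\<Sum>c | length c = l. \<kappa>' ^ k * B (y + disp a) * weight L (c @ a) \<sigma>))"
    by (simp add: sum_distrib_left sum_divide_distrib mult_ac)
  also have "\<dots> = (\<Sum>l\<le>N. (1 / real (Suc N)) * (\<Sum>a | length a = m. \<Sum>c | length c = l. \<kappa>' ^ k * B (y + disp a) * weight L (c @ a) \<sigma>))"
    by (subst sum.swap) (simp add: sum_distrib_left)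
  also have "\<dots> = (\<Sum>l\<le>N. (1 / real (Suc N)) * X l)"
    unfolding X_def by (intro sum.cong refl arg_cong2[where f = "(*)"] sum.swap)
  also have "\<dots> \<le> (\<Sum>l\<le>N. (1 / real (Suc N)) * RHS)"
    by (intro sum_mono mult_left_mono X) auto
  also have "\<dots> = RHS" by simp
  finally show ?case unfolding \<kappa>'_def RHS_def T_def .
qed

text \<open>Blocks of length \<open>m\<close> have Legendre transform at most \<open>m * l\<close>,
  each round costs a fixed factor \<open>\<kappa>'\<close>, and the letters outside the blocks shift
  the mean by a fraction of order \<open>N / m\<close>. A large fixed \<open>m\<close> makes both
  errors small before \<open>n\<close> tends to infinity.\<close>

lemma weight_lower_bound:
  assumes W: "minimal_enclosure L W" and \<sigma>: "positive_op \<sigma>" "\<sigma> \<in> block W" "\<sigma> \<noteq> 0"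
    and l: "\<And>u. u \<bullet> x - ln (radius W u) \<le> l" and \<epsilon>: "0 < \<epsilon>" and \<delta>: "0 < \<delta>"
  shows "\<forall>\<^sub>F n in sequentially. exp (- real n * (l + \<delta>)) \<le>
    (\<Sum>a | length a = n. indicat_real (ball x \<epsilon>) (disp a /\<^sub>R real n) * weight L a \<sigma>)"
proof -
  have e: "enclosure L W" and W0: "W \<noteq> {0}" using W by (auto simp: minimal_enclosure_def)
  have sub: "vec.subspace W" using e by (rule enclosure_subspace)
  define C where "C = (\<Sum>i\<in>UNIV. norm (s i))"
  have C0: "0 \<le> C" by (simp add: C_def sum_nonneg)
  have l0: "0 \<le> l" using l[of 0] by (simp add: enclosure_radius_0[OF e W0])
  obtain N \<kappa> where \<kappa>: "0 < \<kappa>" and dec: "\<And>\<sigma> b. positive_op \<sigma> \<Longrightarrow> \<sigma> \<in> block W \<Longrightarrow>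
       \<kappa> * Re (trace \<sigma>) * weight L b (oproj W) \<le> (\<Sum>l\<le>N. \<Sum>c | length c = l. weight L (c @ b) \<sigma>)"
    using decoupling[OF W] by metis
  define \<kappa>' where "\<kappa>' = \<kappa> / real (Suc N)"
  have k': "0 < \<kappa>'" using \<kappa> by (simp add: \<kappa>'_def)
  \<comment> \<open>The \<open>1\<close> covers the block estimate, which is applied with error
    \<open>1\<close> per block.\<close>
  define K where "K = \<bar>ln \<kappa>'\<bar> + 1"
  have K: "0 < K" by (simp add: K_def add_nonneg_pos)
  define t where "t = Re (trace \<sigma>)"
  have t: "0 < t" unfolding t_def by (rule positive_op_trace_pos[OF \<sigma>(1,3)])
  define D where "D = C + norm x"
  have D0: "0 \<le> D" using C0 by (simp add: D_def)
  \<comment> \<open>The two summands ensure \<open>D * real N \<le> \<epsilon> / 4 * real m\<close>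
    for the displacement outside the blocks and \<open>K \<le> \<delta> / 2 * real m\<close> for the
    cost per block. The \<open>norm x\<close> in \<open>D\<close> accounts for the target
    \<open>real n *\<^sub>R x\<close> exceeding \<open>real (k * m) *\<^sub>R x\<close>.\<close>
  obtain m :: nat where m: "4 * D * real N / \<epsilon> + 2 * K / \<delta> < real m" using reals_Archimedean2 by blast
  have mpos: "0 < real m" using m D0 K \<epsilon> \<delta> by (smt (verit) divide_nonneg_pos mult_nonneg_nonneg of_nat_0_le_iff)
  have mD: "D * real N \<le> \<epsilon> / 4 * real m"
  proof -
    have "4 * D * real N / \<epsilon> \<le> real m" using m K \<delta> by (smt (verit) divide_nonneg_pos)
    then show ?thesis using \<epsilon> by (simp add: field_simps)
  qed
  have mK: "K \<le> \<delta> / 2 * real m"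
  proof -
    have "2 * K / \<delta> \<le> real m" using m D0 \<epsilon> by (smt (verit) divide_nonneg_pos mult_nonneg_nonneg of_nat_0_le_iff)
    then show ?thesis using \<delta> by (simp add: field_simps)
  qed
  let ?A = "{a :: 'j list. length a = m}" and ?g = "\<lambda>a. weight L a (oproj W)"
  have Zm: "radius W u ^ m \<le> (\<Sum>a\<in>?A. ?g a * exp (u \<bullet> disp a))" for u
    using laplace_weight_lower[OF W, of u m] by (simp add: mult.commute)
  have rpos: "0 < radius W u" for u
    using minimal_radius[OF W, of u] perron_form_bounds(1)[OF e W0] by metis
  have cramer_l: "u \<bullet> (real m *\<^sub>R x) - ln (\<Sum>a\<in>?A. ?g a * exp (u \<bullet> disp a)) \<le> real m * l" for u
  proof -
    have "real m * ln (radius W u) = ln (radius W u ^ m)"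
      using rpos[of u] by (simp add: ln_realpow)
    also have "\<dots> \<le> ln (\<Sum>a\<in>?A. ?g a * exp (u \<bullet> disp a))"
      using Zm[of u] rpos[of u] by (intro ln_mono) (auto intro: less_le_trans[OF zero_less_power])
    finally have "u \<bullet> (real m *\<^sub>R x) - ln (\<Sum>a\<in>?A. ?g a * exp (u \<bullet> disp a)) \<le>
        real m * (u \<bullet> x - ln (radius W u))" by (simp add: algebra_simps)
    also have "\<dots> \<le> real m * l" using l by (intro mult_left_mono) auto
    finally show ?thesis .
  qed
  have g0: "0 < (\<Sum>a\<in>?A. ?g a)"
    using Zm[of 0] by (simp add: enclosure_radius_0[OF e W0])
  have "\<forall>\<^sub>F k in sequentially. exp (- real k * (real m * l + 1)) \<le>
    (word_block W m ^^ k) (indicat_real (ball (real k *\<^sub>R (real m *\<^sub>R x)) (real k * (real m * (\<epsilon> / 4))))) 0"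
    by (rule block_op_lower_bound[OF _ _ g0 cramer_l])
       (use mpos \<epsilon> in \<open>auto intro!: weight_nonneg positive_oproj sub\<close>)
  then obtain k0 where k0: "\<And>k. k0 \<le> k \<Longrightarrow> exp (- real k * (real m * l + 1)) \<le>
    (word_block W m ^^ k) (indicat_real (ball (real k *\<^sub>R (real m *\<^sub>R x)) (real k * (real m * (\<epsilon> / 4))))) 0"
    by (auto simp: eventually_sequentially)
  have ev1: "\<forall>\<^sub>F n in sequentially. k0 * (m + N) \<le> n" by (rule eventually_ge_at_top)
  have ev2: "\<forall>\<^sub>F n in sequentially. 4 * D * real (m + N) / \<epsilon> < real n"
    using filterlim_real_sequentially by (simp add: filterlim_at_top_dense)
  have ev3: "\<forall>\<^sub>F n in sequentially. - 2 * ln t / \<delta> < real n"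
    using filterlim_real_sequentially by (simp add: filterlim_at_top_dense)
  show ?thesis using ev1 ev2 ev3 eventually_gt_at_top[of 0]
  proof eventually_elim
    case (elim n)
    \<comment> \<open>As many rounds of full length \<open>m + N\<close> as fit; all letters outside
      the blocks then number at most \<open>k * N + (m + N)\<close>.\<close>
    define k where "k = n div (m + N)"
    have mN: "0 < m + N" using mpos by simp
    have kn: "k * (m + N) \<le> n" by (simp add: k_def)
    have "n < (k + 1) * (m + N)" unfolding k_def using mN by (metis Suc_eq_plus1 dividend_less_div_times mult.commute mult_Suc add.commute)
    then have nk: "n - k * m \<le> k * N + (m + N)" by (simp add: algebra_simps)
    have kk0: "k0 \<le> k" using elim(1) mN by (simp add: k_def less_eq_div_iff_mult_less_eq)
    have kmn: "k * m \<le> n" using kn by (simp add: algebra_simps)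
    have kmn': "real k * real m \<le> real n" using kmn by (metis of_nat_le_iff of_nat_mult)
    define R where "R = ball (real k *\<^sub>R (real m *\<^sub>R x)) (real k * (real m * (\<epsilon> / 4)))"
    have gap: "D * real (n - k * m) < \<epsilon> / 2 * real n"
    proof -
      have "D * real (n - k * m) \<le> D * real (k * N + (m + N))"
        by (intro mult_left_mono of_nat_mono nk D0)
      also have "\<dots> = real k * (D * real N) + D * real (m + N)" by (simp add: algebra_simps)
      also have "\<dots> \<le> real k * (\<epsilon> / 4 * real m) + D * real (m + N)"
        by (intro add_right_mono mult_left_mono mD) simp
      also have "\<dots> < \<epsilon> / 4 * real n + \<epsilon> / 4 * real n"
      proof (rule add_le_less_mono)
        have "real k * (\<epsilon> / 4 * real m) = \<epsilon> / 4 * (real k * real m)" by simp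
        also have "\<dots> \<le> \<epsilon> / 4 * real n" using kmn' \<epsilon> by (intro mult_left_mono) auto
        finally show "real k * (\<epsilon> / 4 * real m) \<le> \<epsilon> / 4 * real n" .
        show "D * real (m + N) < \<epsilon> / 4 * real n" using elim(2) \<epsilon> by (simp add: field_simps)
      qed
      finally show ?thesis by simp
    qed
    have near: "disp a /\<^sub>R real n \<in> ball x \<epsilon>"
      if mem: "0 + disp a \<in> {z. \<exists>r\<in>R. dist z r \<le> C * real (n - k * m)}" for a
    proof -
      obtain r where r: "r \<in> R" "dist (disp a) r \<le> C * real (n - k * m)" using mem by auto
      have "norm (r - real k *\<^sub>R (real m *\<^sub>R x)) < real k * (real m * (\<epsilon> / 4))"
        using r(1) by (simp add: R_def dist_norm norm_minus_commute)
      also have "\<dots> = \<epsilon> / 4 * (real k * real m)" by simp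
      also have "\<dots> \<le> \<epsilon> / 4 * real n" using kmn' \<epsilon> by (intro mult_left_mono) auto
      finally have 1: "norm (r - real k *\<^sub>R (real m *\<^sub>R x)) < \<epsilon> / 4 * real n" .
      have "disp a - real n *\<^sub>R x =
          (disp a - r) + (r - real k *\<^sub>R (real m *\<^sub>R x)) - real (n - k * m) *\<^sub>R x"
        using kmn by (simp add: of_nat_diff algebra_simps)
      then have "norm (disp a - real n *\<^sub>R x) \<le>
          norm (disp a - r) + norm (r - real k *\<^sub>R (real m *\<^sub>R x)) + norm (real (n - k * m) *\<^sub>R x)"
        using norm_triangle_ineq4[of "(disp a - r) + (r - real k *\<^sub>R (real m *\<^sub>R x))" "real (n - k * m) *\<^sub>R x"]
          norm_triangle_ineq[of "disp a - r" "r - real k *\<^sub>R (real m *\<^sub>R x)"]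
        by (simp only:)
      also have "\<dots> < C * real (n - k * m) + \<epsilon> / 4 * real n + real (n - k * m) * norm x"
        using r(2) 1 by (simp add: dist_norm)
      also have "\<dots> = D * real (n - k * m) + \<epsilon> / 4 * real n" by (simp add: D_def algebra_simps)
      also have "\<dots> \<le> \<epsilon> / 2 * real n + \<epsilon> / 4 * real n" using gap by simp
      also have "\<dots> \<le> \<epsilon> * real n" using \<epsilon> by (simp add: field_simps)
      finally have 2: "norm (disp a - real n *\<^sub>R x) < \<epsilon> * real n" .
      have "disp a /\<^sub>R real n - x = (disp a - real n *\<^sub>R x) /\<^sub>R real n"
        using elim(4) by (simp add: scaleR_diff_right)
      then have "norm (disp a /\<^sub>R real n - x) = norm (disp a - real n *\<^sub>R x) / real n"
        by (simp add: divide_inverse_commute)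
      also have "\<dots> < \<epsilon>" using 2 elim(4) by (simp add: field_simps)
      finally show ?thesis by (simp add: dist_norm norm_minus_commute)
    qed
    have "- real n * (l + \<delta>) \<le> real k * ln \<kappa>' + ln t - real k * (real m * l + 1)"
    proof -
      have "real k * K \<le> real k * (\<delta> / 2 * real m)" using mK by (intro mult_left_mono) auto
      also have "\<dots> = \<delta> / 2 * (real k * real m)" by simp
      also have "\<dots> \<le> \<delta> / 2 * real n" using kmn' \<delta> by (intro mult_left_mono) auto
      finally have 1: "real k * K \<le> \<delta> / 2 * real n" .
      have 2: "real k * real m * l \<le> real n * l" using kmn' l0 by (rule mult_right_mono)
      have 3: "- ln t \<le> \<delta> / 2 * real n" using elim(3) \<delta> by (simp add: field_simps)
      have 4: "real k * (- ln \<kappa>' + 1) \<le> real k * K" by (intro mult_left_mono) (auto simp: K_def)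
      show ?thesis using 1 2 3 4 by (simp add: algebra_simps)
    qed
    then have "exp (- real n * (l + \<delta>)) \<le> exp (real k * ln \<kappa>' + ln t - real k * (real m * l + 1))" by simp
    also have "\<dots> = \<kappa>' ^ k * t * exp (- real k * (real m * l + 1))"
      using k' t by (simp add: exp_add exp_diff exp_minus exp_of_nat_mult divide_inverse)
    also have "\<dots> \<le> \<kappa>' ^ k * t * (word_block W m ^^ k) (indicat_real R) 0"
      unfolding R_def using k' t by (intro mult_left_mono k0 kk0) auto
    also have "\<dots> \<le> (\<Sum>a | length a = n. indicat_real {z. \<exists>r\<in>R. dist z r \<le> C * real (n - k * m)} (0 + disp a) * weight L a \<sigma>)"
      unfolding \<kappa>'_def t_def C_def by (rule word_block_lower[OF e \<kappa> dec \<sigma>(1,2) kn])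
    also have "\<dots> \<le> (\<Sum>a | length a = n. indicat_real (ball x \<epsilon>) (disp a /\<^sub>R real n) * weight L a \<sigma>)"
      using near by (intro sum_mono mult_right_mono weight_nonneg \<sigma>(1)) (auto simp: indicator_def)
    finally show ?case .
  qed
qed

text \<open>Mean displacements always lie in \<open>cball 0 C\<close>, which plays the part of
  exponential tightness: only a compact part of \<open>F\<close> matters, and finitely many sets
  \<open>H u\<close> cover it. \<open>K\<close> is the sum of the Laplace constants of these
  tilts.\<close>

lemma weight_upper_bound:
  assumes W: "minimal_enclosure L W" and \<sigma>: "positive_op \<sigma>" "\<sigma> \<in> block W" and F: "closed F"
    and c: "\<And>x. x \<in> F \<Longrightarrow> \<exists>u. c < u \<bullet> x - ln (radius W u)"
  obtains K where "0 \<le> K" "\<And>n. 0 < n \<Longrightarrow>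
    (\<Sum>a | length a = n. indicat_real F (disp a /\<^sub>R real n) * weight L a \<sigma>) \<le> K * exp (- real n * c)"
proof -
  have e: "enclosure L W" and W0: "W \<noteq> {0}" using W by (auto simp: minimal_enclosure_def)
  let ?r = "radius W"
  have rpos: "0 < ?r u" for u
    using minimal_radius[OF W, of u] perron_form_bounds(1)[OF e W0] by metis
  define C where "C = (\<Sum>i\<in>UNIV. norm (s i))"
  define H where "H u = {x. c < u \<bullet> x - ln (?r u)}" for u
  have comp: "compact (F \<inter> cball 0 C)" using F by (intro closed_Int_compact compact_cball)
  have op: "open (H u)" for u unfolding H_def by (intro open_Collect_less continuous_intros)
  have cover: "F \<inter> cball 0 C \<subseteq> (\<Union>u\<in>UNIV. H u)" using c by (auto simp: H_def)
  obtain I where I: "finite I" "F \<inter> cball 0 C \<subseteq> (\<Union>u\<in>I. H u)"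
    using compactE_image[OF comp op cover] by metis
  have "\<exists>K. 0 \<le> K \<and> (\<forall>n. (\<Sum>a | length a = n. exp (u \<bullet> disp a) * weight L a \<sigma>) \<le> K * ?r u ^ n)" for u
    by (rule laplace_weight_upper[OF W \<sigma>, of u]) blast
  then have "\<exists>K. \<forall>u. 0 \<le> K u \<and> (\<forall>n. (\<Sum>a | length a = n. exp (u \<bullet> disp a) * weight L a \<sigma>) \<le> K u * ?r u ^ n)"
    by (intro choice allI)
  then obtain K where K: "\<And>u. 0 \<le> K u"
    "\<And>u n. (\<Sum>a | length a = n. exp (u \<bullet> disp a) * weight L a \<sigma>) \<le> K u * ?r u ^ n" by blast
  have "(\<Sum>a | length a = n. indicat_real F (disp a /\<^sub>R real n) * weight L a \<sigma>) \<le> (\<Sum>u\<in>I. K u) * exp (- real n * c)"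
    if n: "0 < n" for n
  proof -
    have "(\<Sum>a | length a = n. indicat_real F (disp a /\<^sub>R real n) * weight L a \<sigma>) \<le>
      (\<Sum>a | length a = n. (\<Sum>u\<in>I. exp (- real n * (c + ln (?r u))) * exp (u \<bullet> disp a)) * weight L a \<sigma>)"
    proof (intro sum_mono mult_right_mono weight_nonneg \<sigma>(1))
      fix a assume "a \<in> {a :: 'j list. length a = n}"
      then have len: "length a = n" by simp
      let ?x = "disp a /\<^sub>R real n"
      show "indicat_real F ?x \<le> (\<Sum>u\<in>I. exp (- real n * (c + ln (?r u))) * exp (u \<bullet> disp a))"
      proof (cases "?x \<in> F")
        case True
        have "norm ?x \<le> C" using norm_displacement[of a] n by (simp add: len C_def field_simps)
        then obtain u where u: "u \<in> I" "?x \<in> H u" using True I(2) by auto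
        have "c * real n \<le> (u \<bullet> ?x - ln (?r u)) * real n" using u(2) by (intro mult_right_mono) (auto simp: H_def)
        also have "\<dots> = u \<bullet> disp a - real n * ln (?r u)" using n by (simp add: field_simps)
        finally have "1 \<le> exp (- real n * (c + ln (?r u))) * exp (u \<bullet> disp a)"
          by (simp add: exp_add[symmetric] algebra_simps)
        also have "\<dots> \<le> (\<Sum>u\<in>I. exp (- real n * (c + ln (?r u))) * exp (u \<bullet> disp a))"
          using u(1) I(1) by (intro member_le_sum) auto
        finally show ?thesis using True by simp
      qed (simp add: sum_nonneg)
    qed
    also have "\<dots> = (\<Sum>u\<in>I. exp (- real n * (c + ln (?r u))) * (\<Sum>a | length a = n. exp (u \<bullet> disp a) * weight L a \<sigma>))"
      unfolding sum_distrib_left sum_distrib_right by (subst sum.swap) (simp add: mult.assoc)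
    also have "\<dots> \<le> (\<Sum>u\<in>I. exp (- real n * (c + ln (?r u))) * (K u * ?r u ^ n))"
      by (intro sum_mono mult_left_mono K) simp
    also have "\<dots> = (\<Sum>u\<in>I. K u * exp (- real n * c))"
    proof (intro sum.cong refl)
      fix u
      have "?r u ^ n = exp (real n * ln (?r u))" using rpos[of u] by (simp add: exp_of_nat_mult)
      then have "exp (- real n * (c + ln (?r u))) * ?r u ^ n = exp (- real n * c)"
        by (simp add: exp_add[symmetric] algebra_simps)
      then show "exp (- real n * (c + ln (?r u))) * (K u * ?r u ^ n) = K u * exp (- real n * c)"
        by (simp add: algebra_simps)
    qed
    also have "\<dots> = (\<Sum>u\<in>I. K u) * exp (- real n * c)" by (simp add: sum_distrib_right)
    finally show ?thesis .
  qed
  moreover have "0 \<le> (\<Sum>u\<in>I. K u)" by (intro sum_nonneg K)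
  ultimately show ?thesis using that by blast
qed

end

section \<open>The law of the mean displacement\<close>

lemma position_displacement:
  "position s n \<omega> = fst \<omega> + displacement s (map (snd \<omega>) [0..<n])"
  by (induction n) (simp_all add: add.assoc)

lemma cylinder_iff:
  "\<omega> \<in> cylinder k a \<longleftrightarrow> fst \<omega> = k \<and> map (snd \<omega>) [0..<length a] = a"
proof -
  have "map w [0..<length a] = a \<longleftrightarrow> (\<forall>i<length a. w i = a ! i)" for w
    by (subst list_eq_iff_nth_eq) simp
  then show ?thesis by (cases \<omega>) (simp add: cylinder_def)
qed

lemma locally_finite_countable:
  assumes "locally_finite_lattice V"
  shows "countable V"
proof -
  have "V = (\<Union>n::nat. V \<inter> cball 0 (real n))"
    using real_arch_simple by (auto simp: dist_norm)
  moreover have "countable (V \<inter> cball 0 (real n))" for n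
    using assms by (simp add: locally_finite_lattice_def countable_finite)
  ultimately show ?thesis by (metis countable_UN countableI_type)
qed

text \<open>Increments do not see the starting point, so the law depends only on the total internal
  state \<open>\<rho>0\<close>. The series converges absolutely because the norm of a positive
  operator is bounded by its trace.\<close>

lemma initial_state_has_sum:
  fixes \<rho> :: "real ^ 'd::finite \<Rightarrow> 'n::finite hop"
  assumes "initial_state V \<rho>"
  obtains \<rho>0 where "(\<rho> has_sum \<rho>0) V" "positive_op \<rho>0" "trace \<rho>0 = 1"
proof -
  have pos: "\<And>k. k \<in> V \<Longrightarrow> positive_op (\<rho> k)" and tr: "((\<lambda>k. trace (\<rho> k)) has_sum 1) V"
    using assms by (auto simp: initial_state_def)
  let ?C = "2 * real CARD('n) * real CARD('n)"
  have "(\<lambda>k. Re (trace (\<rho> k))) summable_on V"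
    using has_sum_Re[OF tr] by (rule has_sum_imp_summable)
  then have "(\<lambda>k. ?C * Re (trace (\<rho> k))) summable_on V" by (rule summable_on_cmult_right)
  moreover have "norm (?C * Re (trace (\<rho> k))) = ?C * Re (trace (\<rho> k))" if "k \<in> V" for k
    using positive_op_trace(2)[OF pos[OF that]] by simp
  ultimately have "(\<lambda>k. norm (?C * Re (trace (\<rho> k)))) summable_on V"
    by (simp cong: summable_on_cong)
  then have "(\<lambda>k. norm (\<rho> k)) summable_on V"
  proof (rule Infinite_Sum.abs_summable_on_comparison_test)
    fix k assume "k \<in> V"
    then show "norm (\<rho> k) \<le> norm (?C * Re (trace (\<rho> k)))"
      using positive_op_norm_le[OF pos] positive_op_trace(2)[OF pos] by simp
  qed
  then have "\<rho> summable_on V" by (rule Infinite_Sum.abs_summable_summable)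
  then have s: "(\<rho> has_sum infsum \<rho> V) V" by (rule has_sum_infsum)
  have lin: "bounded_linear (\<lambda>M :: 'n hop. cinner x (M *v x))" for x :: "'n hvec"
    by (intro bounded_linear_compose[OF bounded_bilinear.bounded_linear_right[OF bounded_bilinear_cinner]]
        bounded_bilinear.bounded_linear_left[OF bounded_bilinear_matrix_vector_mult])
  have "positive_op (infsum \<rho> V)"
    unfolding positive_op_def
  proof (intro allI conjI)
    fix x
    have h: "((\<lambda>k. cinner x (\<rho> k *v x)) has_sum cinner x (infsum \<rho> V *v x)) V"
      by (rule has_sum_bounded_linear[OF lin s])
    show "0 \<le> quad (infsum \<rho> V) x"
      by (rule has_sum_nonneg[OF has_sum_Re[OF h]]) (rule positive_op_Re[OF pos])
    have "((\<lambda>k. 0) has_sum Im (cinner x (infsum \<rho> V *v x))) V"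
      using has_sum_Im[OF h] pos by (subst (asm) has_sum_cong) (auto simp: positive_op_def complex_is_Real_iff)
    then have "Im (cinner x (infsum \<rho> V *v x)) = 0" using has_sum_0_simp has_sum_unique by blast
    then show "cinner x (infsum \<rho> V *v x) \<in> \<real>" by (simp add: complex_is_Real_iff)
  qed
  moreover have "trace (infsum \<rho> V) = 1"
    using has_sum_unique[OF has_sum_bounded_linear[OF bounded_linear_trace s] tr] .
  ultimately show ?thesis using that s by blast
qed

context deformed_walk
begin

text \<open>The event \<open>T a\<close> of reading the word \<open>a\<close> has probability at
  least \<open>weight L a \<rho>0\<close>, by additivity over finitely many starting points at a
  time. Both families sum to one over the words of length \<open>n\<close>, so the inequalities are
  equalities.\<close>

lemma mean_displacement_law_eq:
  assumes V: "locally_finite_lattice V" and \<rho>: "initial_state V \<rho>" and P: "path_law V L \<rho> P"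
    and s0: "(\<rho> has_sum \<rho>0) V" "trace \<rho>0 = 1" and B: "B \<in> sets borel"
  shows "measure (mean_displacement_law s P n) B =
    (\<Sum>a | length a = n. indicat_real B (disp a /\<^sub>R real n) * weight L a \<rho>0)"
proof -
  interpret prob_space P using P by (simp add: path_law_def)
  let ?G = "{cylinder k js | k js. k \<in> V} :: (((real ^ 'd) \<times> (nat \<Rightarrow> 'j)) set) set"
  have Gsub: "?G \<subseteq> Pow (V \<times> UNIV)" by (auto simp: cylinder_def)
  have setsP: "sets P = sets (sigma (V \<times> UNIV) ?G)" using P by (simp add: path_law_def)
  have spaceP: "space P = V \<times> UNIV" using sets_eq_imp_space_eq[OF setsP] Gsub by (simp add: space_measure_of_conv)
  have cyl: "cylinder k a \<in> sets P" if "k \<in> V" for k a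
    unfolding setsP sets_measure_of[OF Gsub] using that by (intro sigma_sets.Basic) auto
  have cnt: "countable V" by (rule locally_finite_countable[OF V])
  define T where "T a = (\<Union>k\<in>V. cylinder k a)" for a :: "'j list"
  have T: "T a \<in> sets P" for a unfolding T_def by (intro sets.countable_UN'' cnt cyl)
  have T_iff: "\<omega> \<in> T a \<longleftrightarrow> fst \<omega> \<in> V \<and> map (snd \<omega>) [0..<length a] = a" for \<omega> a
    by (auto simp: T_def cylinder_iff)
  have disj: "disjoint_family_on T {a. length a = n}" for n
    by (auto simp: disjoint_family_on_def set_eq_iff T_iff)
  have un: "(\<Union>a\<in>{a. length a = n \<and> Q a}. T a) = {\<omega>\<in>space P. Q (map (snd \<omega>) [0..<n])}" for n Q
    by (auto simp: T_iff spaceP)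
  have meas: "prob {\<omega>\<in>space P. Q (map (snd \<omega>) [0..<n])} = (\<Sum>a | length a = n \<and> Q a. prob (T a))" for n Q
    unfolding un[symmetric]
    by (rule finite_measure_finite_Union)
       (auto intro: finite_subset[OF _ finite_words[of n]] T disjoint_family_on_mono[OF _ disj[of n]])
  have wcyl: "prob (cylinder k a) = weight L a (\<rho> k)" if "k \<in> V" for k a
  proof -
    have "complex_of_real (prob (cylinder k a)) = trace (path_op L a ** \<rho> k ** cadj (path_op L a))"
      using P that unfolding path_law_def by blast
    from arg_cong[OF this, of Re] show ?thesis by (simp add: weight_def)
  qed
  have wsum: "((\<lambda>k. weight L a (\<rho> k)) has_sum weight L a \<rho>0) V" for a
    by (rule has_sum_bounded_linear[OF _ s0(1)]) (rule weight_linear[unfolded linear_conv_bounded_linear])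
  have le: "weight L a \<rho>0 \<le> prob (T a)" for a
  proof (rule has_sum_le_finite_sums[OF wsum])
    fix F assume F: "finite F" "F \<subseteq> V"
    have "(\<Sum>k\<in>F. weight L a (\<rho> k)) = (\<Sum>k\<in>F. prob (cylinder k a))"
      using F by (intro sum.cong refl) (auto simp: wcyl)
    also have "\<dots> = prob (\<Union>k\<in>F. cylinder k a)"
      using F by (intro finite_measure_finite_Union[symmetric])
        (auto simp: cyl disjoint_family_on_def cylinder_iff set_eq_iff)
    also have "\<dots> \<le> prob (T a)"
      using F by (intro finite_measure_mono T) (auto simp: T_def)
    finally show "(\<Sum>k\<in>F. weight L a (\<rho> k)) \<le> prob (T a)" .
  qed
  have "(\<Sum>a | length a = n. prob (T a)) = 1" for n
    using meas[of "\<lambda>_. True" n] prob_space by simp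
  then have "(\<Sum>a | length a = n. prob (T a) - weight L a \<rho>0) = 0" for n
    by (simp add: sum_subtractf sum_weight s0(2))
  then have weq: "prob (T a) = weight L a \<rho>0" for a
    using le by (subst (asm) sum_nonneg_eq_0_iff) auto
  let ?f = "\<lambda>\<omega>. (position s n \<omega> - position s 0 \<omega>) /\<^sub>R real n"
  have f: "?f \<omega> = disp (map (snd \<omega>) [0..<n]) /\<^sub>R real n" for \<omega>
    by (simp add: position_displacement)
  have "?f \<in> measurable P borel"
  proof (rule measurableI)
    fix A :: "(real ^ 'd) set"
    have "?f -` A \<inter> space P = (\<Union>a\<in>{a. length a = n \<and> disp a /\<^sub>R real n \<in> A}. T a)"
      unfolding un[of n "\<lambda>a. disp a /\<^sub>R real n \<in> A"] f by auto
    also have "\<dots> \<in> sets P"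
      by (intro sets.finite_UN T finite_subset[OF _ finite_words[of n]]) auto
    finally show "?f -` A \<inter> space P \<in> sets P" .
  qed simp
  then have "measure (mean_displacement_law s P n) B = prob (?f -` B \<inter> space P)"
    unfolding mean_displacement_law_def by (rule measure_distr[OF _ B])
  also have "?f -` B \<inter> space P = {\<omega>\<in>space P. disp (map (snd \<omega>) [0..<n]) /\<^sub>R real n \<in> B}"
    unfolding f by auto
  also have "prob \<dots> = (\<Sum>a | length a = n \<and> disp a /\<^sub>R real n \<in> B. weight L a \<rho>0)"
    unfolding meas[of "\<lambda>a. disp a /\<^sub>R real n \<in> B"] weq ..
  also have "\<dots> = (\<Sum>a | length a = n. indicat_real B (disp a /\<^sub>R real n) * weight L a \<rho>0)"
    by (intro sum.mono_neutral_cong_left) auto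
  finally show ?thesis .
qed

text \<open>Off-diagonal blocks of \<open>\<sigma>\<close> do not contribute: \<open>oproj W\<close>
  commutes with the path operators, and by idempotence and cyclicity of the trace it can be placed
  on both sides of \<open>\<sigma>\<close>.\<close>

lemma weight_decompose:
  assumes F: "\<And>W. W \<in> F \<Longrightarrow> enclosure L W" "(\<Sum>W\<in>F. oproj W) = mat 1"
  shows "weight L a \<sigma> = (\<Sum>W\<in>F. weight L a (oproj W ** \<sigma> ** oproj W))"
proof -
  let ?A = "path_op L a"
  have "trace (?A ** \<sigma> ** cadj ?A) = trace ((\<Sum>W\<in>F. oproj W) ** (?A ** \<sigma> ** cadj ?A))" by (simp add: F)
  also have "\<dots> = (\<Sum>W\<in>F. trace (oproj W ** (?A ** \<sigma> ** cadj ?A)))" by (simp add: matrix_mult_simps trace_simps)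
  also have "\<dots> = (\<Sum>W\<in>F. trace (?A ** (oproj W ** \<sigma> ** oproj W) ** cadj ?A))"
  proof (rule sum.cong[OF refl])
    fix W assume W: "W \<in> F"
    let ?p = "oproj W"
    note sub = enclosure_subspace[OF F(1)[OF W]]
    have c: "?A ** ?p = ?p ** ?A" by (rule oproj_commute_path[OF F(1)[OF W]])
    have c': "?p ** cadj ?A = cadj ?A ** ?p"
      using arg_cong[OF c, of cadj] by (simp add: cadj_mult oproj_cadj[OF sub])
    have "?A ** (?p ** \<sigma> ** ?p) ** cadj ?A = (?A ** ?p) ** \<sigma> ** (?p ** cadj ?A)"
      by (simp add: matrix_mul_assoc)
    also have "\<dots> = ?p ** (?A ** \<sigma> ** cadj ?A) ** ?p"
      unfolding c c' by (simp add: matrix_mul_assoc)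
    finally have "trace (?A ** (?p ** \<sigma> ** ?p) ** cadj ?A) = trace (?p ** (?A ** \<sigma> ** cadj ?A) ** ?p)" by simp
    also have "\<dots> = trace (?p ** (?p ** (?A ** \<sigma> ** cadj ?A)))" by (rule trace_mul_sym)
    also have "\<dots> = trace (?p ** (?A ** \<sigma> ** cadj ?A))"
      by (simp add: matrix_mul_assoc oproj_idem[OF sub])
    finally show "trace (?p ** (?A ** \<sigma> ** cadj ?A)) = trace (?A ** (?p ** \<sigma> ** ?p) ** cadj ?A)" by simp
  qed
  finally show ?thesis by (simp add: weight_def)
qed

lemma absorption_weight_eq:
  assumes U: "enclosure L U" and s0: "(\<rho> has_sum \<rho>0) V"
  shows "absorption_weight V L \<rho> U = trace (oproj U ** \<rho>0)"
  unfolding absorption_weight_def absorption_enclosure[OF U]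
  by (rule infsumI[OF has_sum_bounded_linear[OF _ s0]])
     (intro bounded_linear_compose[OF bounded_linear_trace]
        bounded_bilinear.bounded_linear_right[OF bounded_bilinear_matrix_mult])

text \<open>The absorption weight is the sum of the traces of the compressions to the minimal pieces
  inside \<open>U\<close>. These traces are nonnegative and vanish only with the operator, so the
  weight detects the components present in the mixture.\<close>

lemma absorption_weight_nonzero_iff:
  assumes D: "enclosure_decomposition L D" and U: "U \<in> D"
    and F: "finite F" "\<And>W. W \<in> F \<Longrightarrow> minimal_enclosure L W" "(\<Sum>W\<in>F. oproj W) = mat 1"
    and s0: "(\<rho> has_sum \<rho>0) V" "positive_op \<rho>0"
  shows "absorption_weight V L \<rho> U \<noteq> 0 \<longleftrightarrow> (\<exists>W\<in>F. W \<subseteq> U \<and> oproj W ** \<rho>0 ** oproj W \<noteq> 0)"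
proof -
  have eU: "enclosure L U" using D U by (simp add: enclosure_decomposition_def separating_enclosure_def)
  define G where "G = {W\<in>F. W \<subseteq> U}"
  let ?\<sigma> = "\<lambda>W. oproj W ** \<rho>0 ** oproj W"
  have sub: "vec.subspace W" if "W \<in> G" for W
    using F(2) that by (auto simp: G_def minimal_enclosure_def intro: enclosure_subspace)
  have pos: "positive_op (?\<sigma> W)" if "W \<in> G" for W
    using positive_op_conj[OF s0(2), of "oproj W"] by (simp add: oproj_cadj[OF sub[OF that]])
  have "oproj U = (\<Sum>W\<in>G. oproj W)" unfolding G_def by (rule oproj_minimal_sum[OF D U F])
  then have "absorption_weight V L \<rho> U = (\<Sum>W\<in>G. trace (oproj W ** \<rho>0))"
    unfolding absorption_weight_eq[OF eU s0(1)] by (simp add: matrix_mult_simps trace_simps)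
  also have "\<dots> = (\<Sum>W\<in>G. trace (?\<sigma> W))"
  proof (rule sum.cong[OF refl])
    fix W assume W: "W \<in> G"
    show "trace (oproj W ** \<rho>0) = trace (?\<sigma> W)"
      unfolding trace_mul_sym[of "oproj W ** \<rho>0"]
      by (simp add: matrix_mul_assoc oproj_idem[OF sub[OF W]])
  qed
  also have "\<dots> = complex_of_real (\<Sum>W\<in>G. Re (trace (?\<sigma> W)))"
    using positive_op_trace(1)[OF pos] by simp
  finally have "absorption_weight V L \<rho> U = 0 \<longleftrightarrow> (\<Sum>W\<in>G. Re (trace (?\<sigma> W))) = 0"
    by (simp only: of_real_eq_0_iff)
  also have "\<dots> \<longleftrightarrow> (\<forall>W\<in>G. Re (trace (?\<sigma> W)) = 0)"
    using F(1) positive_op_trace(2)[OF pos] by (intro sum_nonneg_eq_0_iff) (auto simp: G_def)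
  also have "\<dots> \<longleftrightarrow> (\<forall>W\<in>G. ?\<sigma> W = 0)"
    using positive_op_trace_0[OF pos] by (auto simp: trace_simps)
  finally show ?thesis by (auto simp: G_def)
qed


section \<open>The rate function of an enclosure\<close>

lemma enclosure_rate_le_iff:
  "enclosure_rate s L U x \<le> ereal l \<longleftrightarrow> (\<forall>u. u \<bullet> x - ln (radius U u) \<le> l)"
  by (simp add: enclosure_rate_def SUP_le_iff)

lemma enclosure_rate_nonneg:
  assumes "enclosure L U" "U \<noteq> {0}"
  shows "0 \<le> enclosure_rate s L U x"
  unfolding enclosure_rate_def
  by (rule SUP_upper2[of 0]) (simp_all add: enclosure_radius_0[OF assms])

text \<open>A sublevel set is an intersection of closed sets given by affine inequalities. It is
  bounded because the choice \<open>u = sgn x\<close>, where the radius is at most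
  \<open>exp C\<close>, gives \<open>norm x \<le> c + C\<close>.\<close>

lemma compact_enclosure_rate:
  assumes e: "enclosure L U" and U0: "U \<noteq> {0}" and h: "\<And>u. \<exists>h. perron_form U u h (radius U u)"
  shows "compact {x. enclosure_rate s L U x \<le> ereal c}"
proof -
  let ?S = "{x. enclosure_rate s L U x \<le> ereal c}"
  define C where "C = (\<Sum>i\<in>UNIV. norm (s i))"
  have "?S = (\<Inter>u. {x. u \<bullet> x - ln (radius U u) \<le> c})"
    by (auto simp: enclosure_rate_le_iff)
  moreover have "closed {x. u \<bullet> x - ln (radius U u) \<le> c}" for u
    by (intro closed_Collect_le continuous_intros)
  ultimately have "closed ?S" by auto
  have bd: "norm x \<le> c + C" if x: "x \<in> ?S" for x
  proof -
    obtain h where h: "perron_form U (sgn x) h (radius U (sgn x))" using h by blast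
    have r: "0 < radius U (sgn x)" "radius U (sgn x) \<le> exp (norm (sgn x) * C)"
      using perron_form_bounds[OF e U0 h] by (auto simp: C_def)
    have "ln (radius U (sgn x)) \<le> ln (exp (norm (sgn x) * C))"
      using r by (intro ln_mono) auto
    also have "\<dots> \<le> C" by (simp add: norm_sgn C_def sum_nonneg)
    finally have "ln (radius U (sgn x)) \<le> C" .
    moreover have "sgn x \<bullet> x = norm x"
      by (cases "x = 0") (simp_all add: sgn_div_norm dot_square_norm power2_eq_square)
    moreover have "sgn x \<bullet> x - ln (radius U (sgn x)) \<le> c"
      using x by (simp add: enclosure_rate_le_iff)
    ultimately show ?thesis by linarith
  qed
  have "bounded ?S" unfolding bounded_iff using bd by blast
  with \<open>closed ?S\<close> show ?thesis by (simp add: compact_eq_bounded_closed)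
qed

end

section \<open>From exponential bounds to logarithmic limits\<close>

lemma ext_ln_mono: "0 < p \<Longrightarrow> p \<le> q \<Longrightarrow> ereal (ln p) \<le> ext_ln q"
  by (simp add: ext_ln_def)

lemma ext_ln_le: "0 \<le> p \<Longrightarrow> p \<le> q \<Longrightarrow> 0 < q \<Longrightarrow> ext_ln p \<le> ereal (ln q)"
  by (simp add: ext_ln_def)

lemma liminf_ext_ln_ge:
  assumes "\<And>\<delta>. 0 < \<delta> \<Longrightarrow> \<forall>\<^sub>F n in sequentially. exp (- real n * (l + \<delta>)) \<le> p n"
  shows "ereal (- l) \<le> liminf (\<lambda>n. ereal (1 / real n) * ext_ln (p n))"
proof (rule ereal_le_epsilon2)
  fix \<delta> :: real assume \<delta>: "0 < \<delta>"
  have "ereal (- (l + \<delta>)) \<le> liminf (\<lambda>n. ereal (1 / real n) * ext_ln (p n))"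
  proof (rule Liminf_bounded)
    show "\<forall>\<^sub>F n in sequentially. ereal (- (l + \<delta>)) \<le> ereal (1 / real n) * ext_ln (p n)"
      using assms[OF \<delta>] eventually_gt_at_top[of 0]
    proof eventually_elim
      case (elim n)
      have "ereal (- (l + \<delta>)) = ereal (1 / real n) * ereal (ln (exp (- real n * (l + \<delta>))))"
        using elim(2) by simp
      also have "\<dots> \<le> ereal (1 / real n) * ext_ln (p n)"
        using elim(1) by (intro ereal_mult_left_mono ext_ln_mono) auto
      finally show ?case .
    qed
  qed
  then have "ereal (- (l + \<delta>)) + ereal \<delta> \<le> liminf (\<lambda>n. ereal (1 / real n) * ext_ln (p n)) + ereal \<delta>"
    by (rule add_right_mono)
  then show "ereal (- l) \<le> liminf (\<lambda>n. ereal (1 / real n) * ext_ln (p n)) + ereal \<delta>" by simp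
qed

lemma limsup_ext_ln_le:
  assumes K: "0 < K" and p: "\<And>n. 0 \<le> p n" "\<And>n. 0 < n \<Longrightarrow> p n \<le> K * exp (- real n * c)"
  shows "limsup (\<lambda>n. ereal (1 / real n) * ext_ln (p n)) \<le> ereal (- c)"
proof (rule ereal_le_epsilon2)
  fix \<delta> :: real assume \<delta>: "0 < \<delta>"
  have "limsup (\<lambda>n. ereal (1 / real n) * ext_ln (p n)) \<le> ereal (- c + \<delta>)"
  proof (rule Limsup_bounded)
    have "\<forall>\<^sub>F n in sequentially. ln K / \<delta> < real n"
      using filterlim_real_sequentially by (simp add: filterlim_at_top_dense)
    then show "\<forall>\<^sub>F n in sequentially. ereal (1 / real n) * ext_ln (p n) \<le> ereal (- c + \<delta>)"
      using eventually_gt_at_top[of 0]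
    proof eventually_elim
      case (elim n)
      have "ereal (1 / real n) * ext_ln (p n) \<le> ereal (1 / real n) * ereal (ln (K * exp (- real n * c)))"
        using elim K p by (intro ereal_mult_left_mono ext_ln_le) auto
      also have "ln (K * exp (- real n * c)) = ln K - real n * c" using K by (simp add: ln_mult)
      also have "ereal (1 / real n) * ereal (ln K - real n * c) \<le> ereal (- c + \<delta>)"
        using elim \<delta> by (simp add: field_simps)
      finally show ?case .
    qed
  qed
  then show "limsup (\<lambda>n. ereal (1 / real n) * ext_ln (p n)) \<le> ereal (- c) + ereal \<delta>" by simp
qed

section \<open>The large deviation principle\<close>

theorem theorem5p1:
  fixes V :: "(real ^ 'd::finite) set"
    and s :: "'j::finite \<Rightarrow> real ^ 'd"
    and L :: "'j \<Rightarrow> complex ^ 'n::finite ^ 'n"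
    and \<rho> :: "real ^ 'd \<Rightarrow> complex ^ 'n ^ 'n"
    and P :: "((real ^ 'd) \<times> (nat \<Rightarrow> 'j)) measure"
    and D :: "(complex ^ 'n) set set"
  assumes "locally_finite_lattice V"
    and "positively_generated V (range s)"
    and "range s \<noteq> {0}"
    and "(\<Sum>i\<in>UNIV. cadj (L i) ** L i) = mat 1"
    and "initial_state V \<rho>"
    and "path_law V L \<rho> P"
    and "fast_recurrent_space L = UNIV"
    and "enclosure_decomposition L D"
  shows "good_rate_function (walk_rate V s L \<rho> D) \<and>
    large_deviation_principle (mean_displacement_law s P) (walk_rate V s L \<rho> D)"
proof -
  interpret deformed_walk L s
    by unfold_locales (fact assms(4), fact assms(7))
  note D = assms(8)
  obtain \<rho>0 where \<rho>0: "(\<rho> has_sum \<rho>0) V" "positive_op \<rho>0" "trace \<rho>0 = 1"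
    using initial_state_has_sum[OF assms(5)] by metis
  have "enclosure L UNIV" by (simp add: enclosure_iff)
  then obtain F where F: "finite F" "\<And>W. W \<in> F \<Longrightarrow> minimal_enclosure L W" "(\<Sum>W\<in>F. oproj W) = oproj UNIV"
    using minimal_decomposition by metis
  have "oproj UNIV = (mat 1 :: 'n hop)"
    by (rule matrix_eqI_vec) (simp add: oproj_fix)
  then have F1: "(\<Sum>W\<in>F. oproj W) = mat 1" using F(3) by simp
  have Fe: "enclosure L W" "W \<noteq> {0}" if "W \<in> F" for W using F(2)[OF that] by (auto simp: minimal_enclosure_def)
  \<comment> \<open>The component of the mixture carried by \<open>W\<close>, not normalised and
    possibly zero.\<close>
  define \<sigma> where "\<sigma> W = oproj W ** \<rho>0 ** oproj W" for W
  have \<sigma>: "positive_op (\<sigma> W)" "\<sigma> W \<in> block W" if "W \<in> F" for W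
    using positive_op_conj[OF \<rho>0(2), of "oproj W"] oproj_cadj[OF enclosure_subspace[OF Fe(1)[OF that]]]
    by (simp_all add: \<sigma>_def block_def)
  define A where "A = {U \<in> D. absorption_weight V L \<rho> U \<noteq> 0}"
  have finA: "finite A" using D by (simp add: A_def enclosure_decomposition_def)
  have DU: "enclosure L U" "U \<noteq> {0}" if "U \<in> D" for U
    using D that by (auto simp: enclosure_decomposition_def separating_enclosure_def)
  have A_iff: "U \<in> A \<longleftrightarrow> U \<in> D \<and> (\<exists>W\<in>F. W \<subseteq> U \<and> \<sigma> W \<noteq> 0)" for U
    using absorption_weight_nonzero_iff[OF D _ F(1,2) F1 \<rho>0(1,2), of U] by (auto simp: A_def \<sigma>_def)
  have coverA: "\<exists>U\<in>A. W \<subseteq> U" if "W \<in> F" "\<sigma> W \<noteq> 0" for W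
    using decomposition_cover[OF D F(2)[OF that(1)]] that unfolding Bex_def A_iff by blast
  \<comment> \<open>Constancy of the radius inside a summand identifies the rates on the pieces of
    \<open>F\<close> with those in the statement, whichever minimal decomposition was
    chosen.\<close>
  have rate_eq: "enclosure_rate s L W x = enclosure_rate s L U x" if "W \<in> F" "U \<in> D" "W \<subseteq> U" for W U x
    using decomposition_radius_eq[OF D that(2) F(2)[OF that(1)] that(3)] by (simp add: enclosure_rate_def)
  \<comment> \<open>The minimum in \<open>walk_rate\<close> is over a nonempty set: otherwise all
    components, and hence the total mass, would vanish.\<close>
  have neA: "A \<noteq> {}"
  proof
    assume "A = {}"
    then have "\<sigma> W = 0" if "W \<in> F" for W using coverA[OF that] by blast
    then have "weight L [] \<rho>0 = 0"
      using weight_decompose[OF Fe(1) F1, of "[]" \<rho>0] by (simp add: \<sigma>_def trace_simps del: weight_Nil add: linear_0[OF weight_linear])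
    then show False using \<rho>0(3) by simp
  qed
  define R where "R = walk_rate V s L \<rho> D"
  have R: "R x = Min ((\<lambda>U. enclosure_rate s L U x) ` A)" for x
    by (simp add: R_def walk_rate_def A_def)
  have R_le: "R x \<le> enclosure_rate s L U x" if "U \<in> A" for x U
    unfolding R using finA that by (intro Min_le) auto
  have R_ex: "\<exists>U\<in>A. R x = enclosure_rate s L U x" for x
  proof -
    have "R x \<in> (\<lambda>U. enclosure_rate s L U x) ` A"
      unfolding R using finA neA by (intro Min_in) auto
    then show ?thesis by blast
  qed
  have R0: "0 \<le> R x" for x
    using R_ex[of x] enclosure_rate_nonneg[OF DU] by (auto simp: A_def)
  have good: "good_rate_function R"
    unfolding good_rate_function_def
  proof (intro conjI allI R0)
    fix c :: real
    have "{x. R x \<le> ereal c} = (\<Union>U\<in>A. {x. enclosure_rate s L U x \<le> ereal c})"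
      using R_ex R_le by (auto intro: order_trans) metis
    moreover have "compact {x. enclosure_rate s L U x \<le> ereal c}" if U: "U \<in> A" for U
    proof (rule compact_enclosure_rate)
      have UD: "U \<in> D" using U by (simp add: A_def)
      then show "enclosure L U" "U \<noteq> {0}" by (rule DU)+
      obtain W where W: "W \<in> F" "W \<subseteq> U" using U by (auto simp: A_iff)
      show "\<exists>h. perron_form U u h (deformed_radius s L U u)" for u
        unfolding decomposition_radius_eq[OF D UD F(2)[OF W(1)] W(2)]
        by (rule ex_perron_form_decomposition[OF D UD F(2)[OF W(1)] W(2)]) blast
    qed
    ultimately show "compact {x. R x \<le> ereal c}" using finA by (auto intro: compact_UN)
  qed
  define Q where "Q n B W = (\<Sum>a | length a = n. indicat_real B (displacement s a /\<^sub>R real n) * weight L a (\<sigma> W))" for n B W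
  have Q0: "0 \<le> Q n B W" if "W \<in> F" for n B W
    unfolding Q_def by (intro sum_nonneg mult_nonneg_nonneg weight_nonneg \<sigma> that) auto
  have law: "measure (mean_displacement_law s P n) B = (\<Sum>W\<in>F. Q n B W)" if B: "B \<in> sets borel" for n B
    unfolding mean_displacement_law_eq[OF assms(1,5,6) \<rho>0(1,3) B] Q_def \<sigma>_def
    by (subst weight_decompose[OF Fe(1) F1]) (simp_all add: sum_distrib_left sum.swap[of _ F])
  have swap: "b \<le> - a" if "a \<le> - b" for a b :: ereal
    using that ereal_minus_le_minus[of "- b" a] by simp
  have ldp: "large_deviation_principle (mean_displacement_law s P) R"
    unfolding large_deviation_principle_def
  proof (intro ballI conjI)
    fix B :: "(real ^ 'd) set" assume B: "B \<in> sets borel"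
    let ?f = "\<lambda>n. ereal (1 / real n) * ext_ln (measure (mean_displacement_law s P n) B)"
    show "liminf ?f \<le> limsup ?f" by (intro Liminf_le_Limsup) simp
    show "- (INF x\<in>interior B. R x) \<le> liminf ?f"
    proof -
      have "- liminf ?f \<le> R x" if x: "x \<in> interior B" for x
      proof (cases "R x")
        case (real l)
        \<comment> \<open>A summand attaining the minimum contains a minimal piece with nonzero
          component. That component alone gives the lower bound, since the others are
          nonnegative.\<close>
        obtain U where U: "U \<in> A" "enclosure_rate s L U x = ereal l" using R_ex[of x] real by auto
        obtain W where W: "W \<in> F" "W \<subseteq> U" "\<sigma> W \<noteq> 0" using U(1) by (auto simp: A_iff)
        have "enclosure_rate s L W x \<le> ereal l" using rate_eq[OF W(1) _ W(2)] U by (simp add: A_def)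
        then have l: "\<And>u. u \<bullet> x - ln (deformed_radius s L W u) \<le> l" by (simp add: enclosure_rate_le_iff)
        obtain \<epsilon> where \<epsilon>: "0 < \<epsilon>" "ball x \<epsilon> \<subseteq> B" using x by (auto simp: mem_interior)
        have "ereal (- l) \<le> liminf ?f"
        proof (rule liminf_ext_ln_ge)
          fix \<delta> :: real assume "0 < \<delta>"
          from weight_lower_bound[OF F(2)[OF W(1)] \<sigma>[OF W(1)] W(3) l \<epsilon>(1) this]
          show "\<forall>\<^sub>F n in sequentially. exp (- real n * (l + \<delta>)) \<le> measure (mean_displacement_law s P n) B"
          proof eventually_elim
            case (elim n)
            also have "(\<Sum>a | length a = n. indicat_real (ball x \<epsilon>) (displacement s a /\<^sub>R real n) * weight L a (\<sigma> W)) \<le> Q n B W"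
              unfolding Q_def using \<epsilon>(2)
              by (intro sum_mono mult_right_mono weight_nonneg \<sigma>(1) W(1)) (auto simp: indicator_def)
            also have "\<dots> \<le> (\<Sum>W\<in>F. Q n B W)" using F(1) W(1) Q0 by (intro member_le_sum) auto
            finally show ?case by (simp add: law[OF B])
          qed
        qed
        then show ?thesis using real by (simp add: ereal_uminus_le_reorder)
      qed (use R0[of x] in auto)
      then have "- liminf ?f \<le> (INF x\<in>interior B. R x)" by (rule INF_greatest)
      then show ?thesis by (simp add: ereal_uminus_le_reorder)
    qed
    show "limsup ?f \<le> - (INF x\<in>closure B. R x)"
    proof -
      have "(INF x\<in>closure B. R x) \<le> - limsup ?f"
      proof (rule dense_le)
        \<comment> \<open>Approaching the infimum from below also covers an infinite infimum, for
          instance for empty \<open>B\<close>.\<close>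
        fix c assume c: "c < (INF x\<in>closure B. R x)"
        show "c \<le> - limsup ?f"
        proof (cases c)
          case (real r)
          have "\<exists>K\<ge>0. \<forall>n>0. Q n (closure B) W \<le> K * exp (- real n * r)" if W: "W \<in> F" for W
          proof (cases "\<sigma> W = 0")
            \<comment> \<open>A vanishing component is set aside because \<open>W\<close> may then
              lie in a summand outside \<open>A\<close>, whose rate is not bounded below by
              \<open>R\<close>.\<close>
            case True
            then show ?thesis by (intro exI[of _ 0]) (simp add: Q_def linear_0[OF weight_linear])
          next
            case False
            obtain U where U: "U \<in> A" "W \<subseteq> U" using coverA[OF W False] by blast
            have "\<exists>u. r < u \<bullet> x - ln (deformed_radius s L W u)" if x: "x \<in> closure B" for x
            proof -
              have "ereal r < R x" using c x real by (auto intro: less_le_trans INF_lower)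
              also have "\<dots> \<le> enclosure_rate s L W x"
                using R_le[OF U(1)] rate_eq[OF W _ U(2)] U(1) by (simp add: A_def)
              finally show ?thesis by (simp add: enclosure_rate_def less_SUP_iff)
            qed
            then show ?thesis
              unfolding Q_def by (rule weight_upper_bound[OF F(2)[OF W] \<sigma>[OF W] closed_closure[of B]]) blast+
          qed
          then have "\<exists>K. \<forall>W\<in>F. 0 \<le> K W \<and> (\<forall>n>0. Q n (closure B) W \<le> K W * exp (- real n * r))"
            by (intro bchoice) blast
          then obtain K where K: "\<And>W. W \<in> F \<Longrightarrow> 0 \<le> K W"
            "\<And>W n. W \<in> F \<Longrightarrow> 0 < n \<Longrightarrow> Q n (closure B) W \<le> K W * exp (- real n * r)" by blast
          have "limsup ?f \<le> ereal (- r)"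
          proof (rule limsup_ext_ln_le)
            \<comment> \<open>The \<open>1\<close> keeps the constant positive even if all
              \<open>K W\<close> vanish, as its logarithm is taken.\<close>
            show "0 < 1 + (\<Sum>W\<in>F. K W)" using K(1) by (simp add: add_pos_nonneg sum_nonneg)
            fix n :: nat assume n: "0 < n"
            have "measure (mean_displacement_law s P n) B \<le> (\<Sum>W\<in>F. K W * exp (- real n * r))"
              unfolding law[OF B]
            proof (rule sum_mono)
              fix W assume W: "W \<in> F"
              have "Q n B W \<le> Q n (closure B) W"
                unfolding Q_def using closure_subset[of B]
                by (intro sum_mono mult_right_mono weight_nonneg \<sigma>(1) W) (auto simp: indicator_def)
              then show "Q n B W \<le> K W * exp (- real n * r)" using K(2)[OF W n] by simp
            qed
            also have "\<dots> \<le> (1 + (\<Sum>W\<in>F. K W)) * exp (- real n * r)"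
              by (simp add: sum_distrib_right algebra_simps)
            finally show "measure (mean_displacement_law s P n) B \<le> (1 + (\<Sum>W\<in>F. K W)) * exp (- real n * r)" .
          qed simp
          then have "limsup ?f \<le> - ereal r" by simp
          from swap[OF this] show ?thesis by (simp add: real)
        qed (use c in auto)
      qed
      then show ?thesis by (rule swap)
    qed
  qed
  show ?thesis using good ldp by (simp add: R_def)
qed

end
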